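(* Let $\kappa>0$ and $0\le\lambda\le\kappa/4$, and let $\zeta=\lambda/\kappa$ be the edge dependence factor, so $0\le\zeta\le 1/4$. Let $\{X_{ij}\}$ be the symmetric first order autoregression (SFAR) 2D signal with parameters $\lambda,\kappa$, whose spectral density is $$f(\omega_1,\omega_2)=\frac{1}{4\pi^2\kappa\,(1-2\zeta\cos\omega_1-2\zeta\cos\omega_2)}.$$ Let $\{W_{ij}\}$ be i.i.d. $\mathcal{N}(0,\sigma^2)$ noise with known variance $\sigma^2$, independent of $\{X_{ij}\}$, and let $$\mathrm{SNR}=\frac{P_s}{\sigma^2}=\frac{2K(4\zeta)}{\pi\kappa\sigma^2},$$ where $P_s=\mathbb{E}\{X_{00}^2\}=\frac{2K(4\zeta)}{\pi\kappa}$ is the signal power and $K(\cdot)$ is the complete elliptic integral of the first kind. Consider the Neyman-Pearson detector with level $\alpha\in(0,1)$ for the hypotheses $$\mathcal{H}_0:\ Y_{ij}=W_{ij},\ ij\in\mathcal{I}\qquad\text{vs.}\qquad \mathcal{H}_1:\ Y_{ij}=X_{ij}+W_{ij},\ ij\in\mathcal{I},$$ where $\mathcal{I}$ is a 2D lattice of sensor locations. Then the error exponent $\mathcal{K}_s=\lim_{n\to\infty}-\frac1n\log P_M$ of the miss probability $P_M$, where $n$ is the number of samples, is given by $$\mathcal{K}_s=\frac{1}{4\pi^2}\int_{-\pi}^{\pi}\int_{-\pi}^{\pi}\left(\frac12\log\left(1+\frac{\mathrm{SNR}}{(2/\pi)K(4\zeta)(1-2\zeta\cos\omega_1-2\ze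ta\cos\omega_2)}\right)+\frac12\,\frac{1}{1+\frac{\mathrm{SNR}}{(2/\pi)K(4\zeta)(1-2\zeta\cos\omega_1-2\zeta\cos\omega_2)}}-\frac12\right)d\omega_1\,d\omega_2.$$
   Context: The SFAR model is the zero-mean stationary Gauss-Markov random field on the doubly infinite 2D lattice specified by full conditional normal distributions with conditional mean $\mathbb{E}\{X_{ij}\mid X_{-ij}\}=\frac{\lambda}{\kappa}(X_{i+1,j}+X_{i-1,j}+X_{i,j+1}+X_{i,j-1})$ and conditional precision (inverse variance) $\kappa$, where $X_{-ij}$ denotes all variables except $X_{ij}$. The value $\zeta=0$ is the i.i.d. case and $\zeta=1/4$ is the perfectly correlated case; one has $K(0)=\pi/2$ and $K(1)=\infty$, and at $\zeta=1/4$ the formula is read, for given SNR, with $K(1)=\infty$. Spectral density convention: with covariance $\gamma_{ij}=\mathbb{E}\{X_{00}X_{ij}\}$, $f(\omega_1,\omega_2)=\frac{1}{4\pi^2}\sum_{ij}\gamma_{ij}\exp(-\iota(i\omega_1+j\omega_2))$, $\iota=\sqrt{-1}$, the sum being over the doubly infinite lattice. The elliptic integral is a function of the modulus: $K(k)=\int_0^{\pi/2}(1-k^2\sin^2\theta)^{-1/2}\,d\theta$. The miss probability $P_M$ is the probability of deciding $\mathcal{H}_0$ when $\mathcal{H}_1$ is true; the Neyman-Pearson detector with level $\alpha$ minimizes it subject to the false-alarm probability (deciding $\mathcal{H}_1$ when $\mathcal{H}_0$ is true) being at most $\alpha$. The limit $n\to\infty$ is taken as the set of observed lattice sites grows. 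*)

theory Defs
  imports "HOL-Probability.Probability"
begin

section \<open>Gaussian random fields on the lattice \<open>\<int> \<times> \<int>\<close>\<close>

type_synonym site = "int \<times> int"

text \<open>The normal law with mean \<open>\<mu>\<close> and standard deviation \<open>s\<close>; for \<open>s = 0\<close> it is the point
  mass at \<open>\<mu>\<close>, so that degenerate Gaussian vectors are covered.\<close>

definition normal_law :: "real \<Rightarrow> real \<Rightarrow> real measure" where
  "normal_law \<mu> s =
    (if s = 0 then return borel \<mu> else density lborel (normal_density \<mu> s))"

definition gaussian_field :: "'a measure \<Rightarrow> (site \<Rightarrow> 'a \<Rightarrow> real) \<Rightarrow> bool" where
  "gaussian_field M X \<longleftrightarrow>
    (\<forall>s. X s \<in> borel_measurable M) \<and>
    (\<forall>F c. finite F \<longrightarrow>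
      (\<exists>\<mu> v. 0 \<le> v \<and> distr M borel (\<lambda>\<omega>. \<Sum>s\<in>F. c s * X s \<omega>) = normal_law \<mu> v))"

definition stationary_field :: "'a measure \<Rightarrow> (site \<Rightarrow> 'a \<Rightarrow> real) \<Rightarrow> bool" where
  "stationary_field M X \<longleftrightarrow>
    (\<forall>h. distr M (\<Pi>\<^sub>M s\<in>UNIV. borel) (\<lambda>\<omega> s. X (s + h) \<omega>) =
         distr M (\<Pi>\<^sub>M s\<in>UNIV. borel) (\<lambda>\<omega> s. X s \<omega>))"

text \<open>The \<open>\<sigma>\<close>-algebra generated by all the variables except the one at site \<open>s\<close>.\<close>

definition sigma_except :: "'a measure \<Rightarrow> (site \<Rightarrow> 'a \<Rightarrow> real) \<Rightarrow> site \<Rightarrow> 'a measure" where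
  "sigma_except M X s =
    vimage_algebra (space M) (\<lambda>\<omega>. \<lambda>t\<in>UNIV - {s}. X t \<omega>) (\<Pi>\<^sub>M t\<in>UNIV - {s}. borel)"

text \<open>The conditional law of \<open>X s\<close> given all the other variables is normal with (random) mean \<open>m\<close>
  and precision \<open>\<kappa>\<close>; note that the second parameter of \<^const>\<open>normal_density\<close> is the standard
  deviation.\<close>

definition full_conditional_normal ::
    "'a measure \<Rightarrow> (site \<Rightarrow> 'a \<Rightarrow> real) \<Rightarrow> site \<Rightarrow> ('a \<Rightarrow> real) \<Rightarrow> real \<Rightarrow> bool" where
  "full_conditional_normal M X s m \<kappa> \<longleftrightarrow>
    (\<forall>A\<in>sets borel. AE \<omega> in M.
      real_cond_exp M (sigma_except M X s) (\<lambda>\<omega>. indicator A (X s \<omega>)) \<omega> =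
      measure (density lborel (normal_density (m \<omega>) (1 / sqrt \<kappa>))) A)"

text \<open>The symmetric first order autoregression with parameters \<open>lam\<close> and \<open>\<kappa>\<close>. For
  \<open>lam / \<kappa> = 1 / 4\<close> and finite \<open>\<kappa>\<close> the full conditionals admit no stationary field of finite power;
  there the model means the perfectly correlated Gaussian field (of arbitrary positive power), the
  limiting case for a given power.\<close>

definition sfar_signal :: "'a measure \<Rightarrow> real \<Rightarrow> real \<Rightarrow> (site \<Rightarrow> 'a \<Rightarrow> real) \<Rightarrow> bool" where
  "sfar_signal M lam \<kappa> X \<longleftrightarrow>
    gaussian_field M X \<and> (\<forall>s. integral\<^sup>L M (X s) = 0) \<and> stationary_field M X \<and>
    (if lam / \<kappa> < 1 / 4
     then \<forall>i j. full_conditional_normal M X (i, j)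
            (\<lambda>\<omega>. lam / \<kappa> * (X (i + 1, j) \<omega> + X (i - 1, j) \<omega> + X (i, j + 1) \<omega> + X (i, j - 1) \<omega>)) \<kappa>
     else (\<forall>s. AE \<omega> in M. X s \<omega> = X (0, 0) \<omega>) \<and> 0 < (\<integral>\<omega>. (X (0, 0) \<omega>)\<^sup>2 \<partial>M))"

definition white_gaussian_noise :: "'a measure \<Rightarrow> real \<Rightarrow> (site \<Rightarrow> 'a \<Rightarrow> real) \<Rightarrow> bool" where
  "white_gaussian_noise M \<sigma> W \<longleftrightarrow>
    (\<forall>s. distributed M lborel (W s) (normal_density 0 \<sigma>)) \<and>
    prob_space.indep_vars M (\<lambda>_. borel) W UNIV"

definition independent_fields ::
    "'a measure \<Rightarrow> (site \<Rightarrow> 'a \<Rightarrow> real) \<Rightarrow> (site \<Rightarrow> 'a \<Rightarrow> real) \<Rightarrow> bool" where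
  "independent_fields M X W \<longleftrightarrow>
    prob_space.indep_var M (\<Pi>\<^sub>M s\<in>UNIV. borel) (\<lambda>\<omega> s. X s \<omega>) (\<Pi>\<^sub>M s\<in>UNIV. borel) (\<lambda>\<omega> s. W s \<omega>)"

definition signal_power :: "'a measure \<Rightarrow> (site \<Rightarrow> 'a \<Rightarrow> real) \<Rightarrow> real" where
  "signal_power M X = (\<integral>\<omega>. (X (0, 0) \<omega>)\<^sup>2 \<partial>M)"

definition has_spectral_density ::
    "'a measure \<Rightarrow> (site \<Rightarrow> 'a \<Rightarrow> real) \<Rightarrow> (real \<Rightarrow> real \<Rightarrow> real) \<Rightarrow> bool" where
  "has_spectral_density M X f \<longleftrightarrow>
    (\<forall>w1 w2.
      ((\<lambda>(i, j). 1 / (4 * of_real pi ^ 2) * of_real (\<integral>\<omega>. X (0, 0) \<omega> * X (i, j) \<omega> \<partial>M) *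
          exp (- \<i> * of_real (of_int i * w1 + of_int j * w2)))
        has_sum complex_of_real (f w1 w2)) UNIV)"


section \<open>The complete elliptic integral of the first kind\<close>

text \<open>A function of the modulus \<open>k\<close>, with values in \<^typ>\<open>ennreal\<close> so that its value at \<open>k = 1\<close> is
  \<open>\<infinity>\<close>. The integrand vanishes by convention where \<open>1 - k\<^sup>2 sin\<^sup>2 t = 0\<close>, which is a null
  set.\<close>

definition ellipticK :: "real \<Rightarrow> ennreal" where
  "ellipticK k = (\<integral>\<^sup>+t\<in>{0..pi / 2}. ennreal ((1 - k\<^sup>2 * (sin t)\<^sup>2) powr (- 1 / 2)) \<partial>lborel)"


section \<open>Neyman-Pearson detection\<close>

definition field_law ::
    "'a measure \<Rightarrow> site set \<Rightarrow> (site \<Rightarrow> 'a \<Rightarrow> real) \<Rightarrow> (site \<Rightarrow> real) measure" where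
  "field_law M I Y = distr M (\<Pi>\<^sub>M s\<in>I. borel) (\<lambda>\<omega>. \<lambda>s\<in>I. Y s \<omega>)"

text \<open>A detector \<open>\<phi>\<close> decides for the alternative with probability \<open>\<phi> y\<close> on observing \<open>y\<close>;
  non-randomized detectors are those with values in \<open>{0, 1}\<close>. \<open>P0\<close> and \<open>P1\<close> are the laws of the
  observation under the null hypothesis and under the alternative.\<close>

definition detector :: "'b measure \<Rightarrow> ('b \<Rightarrow> real) \<Rightarrow> bool" where
  "detector N \<phi> \<longleftrightarrow> \<phi> \<in> borel_measurable N \<and> (\<forall>y\<in>space N. 0 \<le> \<phi> y \<and> \<phi> y \<le> 1)"

definition false_alarm_prob :: "'b measure \<Rightarrow> ('b \<Rightarrow> real) \<Rightarrow> real" where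
  "false_alarm_prob P0 \<phi> = (\<integral>y. \<phi> y \<partial>P0)"

definition miss_prob :: "'b measure \<Rightarrow> ('b \<Rightarrow> real) \<Rightarrow> real" where
  "miss_prob P1 \<phi> = (\<integral>y. 1 - \<phi> y \<partial>P1)"

definition neyman_pearson ::
    "real \<Rightarrow> 'b measure \<Rightarrow> 'b measure \<Rightarrow> ('b \<Rightarrow> real) \<Rightarrow> bool" where
  "neyman_pearson \<alpha> P0 P1 \<phi> \<longleftrightarrow>
    detector P0 \<phi> \<and> false_alarm_prob P0 \<phi> \<le> \<alpha> \<and>
    (\<forall>\<psi>. detector P0 \<psi> \<and> false_alarm_prob P0 \<psi> \<le> \<alpha> \<longrightarrow> miss_prob P1 \<phi> \<le> miss_prob P1 \<psi>)"

text \<open>Observation windows: lattice rectangles, arbitrarily placed, both of whose side lengths tend to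
  infinity. Growth in only one direction would lead to a different limit.\<close>

definition growing_lattice :: "(nat \<Rightarrow> site set) \<Rightarrow> bool" where
  "growing_lattice I \<longleftrightarrow>
    (\<exists>a b c d. (\<forall>k. I k = {a k..b k} \<times> {c k..d k}) \<and>
      filterlim (\<lambda>k. b k - a k) at_top sequentially \<and>
      filterlim (\<lambda>k. d k - c k) at_top sequentially)"

text \<open>The quotient \<open>SNR / ((2 / \<pi>) K(4\<zeta>) (1 - 2\<zeta> cos w1 - 2\<zeta> cos w2))\<close>, computed in
  \<^typ>\<open>ennreal\<close>. For \<open>\<zeta> = 1 / 4\<close>, where \<open>K(1) = \<infinity>\<close>, it is \<open>0\<close> wherever
  \<open>1 - 2\<zeta> cos w1 - 2\<zeta> cos w2\<close> is nonzero, that is, off a null set of \<open>(w1, w2)\<close>.\<close>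

definition spectral_snr :: "real \<Rightarrow> real \<Rightarrow> real \<Rightarrow> real \<Rightarrow> real" where
  "spectral_snr SNR \<zeta> w1 w2 =
    enn2real (ennreal SNR /
      (ennreal (2 / pi) * ellipticK (4 * \<zeta>) * ennreal (1 - 2 * \<zeta> * cos w1 - 2 * \<zeta> * cos w2)))"

end

theory Submission
  imports Defs
begin

text \<open>Stein's lemma reduces the claim to a law of large numbers for the normalized log-likelihood
  ratio under the null hypothesis. On a rectangle, apply the Green's function of \<open>1 - \<zeta> N\<close> with zero
  boundary values (\<open>N\<close> the adjacency operator) to the innovations of the field. This splits the
  signal into two independent parts: one with that Green's function as covariance, which is explicitly
  diagonal in the discrete sine basis, and a remainder whose total variance is
  \<open>n E X\<^sub>0\<^sup>2\<close> minus the trace of the Green's function. The trace is a Riemann sum for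
  \<open>n E X\<^sub>0\<^sup>2\<close>, so the total variance of the remainder is \<open>o(n)\<close>. Mixing over the remainder changes
  the likelihood ratio by a factor that Jensen's inequality bounds from below by \<open>exp (- o(n))\<close> and
  that has mean at most one under the null hypothesis. What is left is a product problem in the sine
  basis, whose exponent is again a Riemann sum. For \<open>\<zeta> = 1/4\<close> the remainder
  is the whole signal, a single Gaussian amplitude, and the factor is only polynomially small.\<close>

text \<open>The covariance of the signal on a rectangle is a two-level Toeplitz matrix, in general
  without explicit eigenvectors, so the exact likelihood ratio cannot be written in closed form.
  Zero boundary values give an explicit basis, and the discrepancy is small in trace. No boundary
  layer is estimated: the remainder has nonnegative variances, so it is enough that two averaged
  traces have the same limit. Smallness in trace suffices because the remainder enters as a random
  shift of the mean, whose Jensen cost is its total variance divided by twice the noise variance.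

  The hypotheses speak only of laws of finite linear combinations and of conditional probabilities
  of events. Independence is therefore expressed by factorization of characteristic functions, and
  covariances are read off by comparing Gaussian exponents. They satisfy a difference equation with
  a point source, and for \<zeta> < 1/4 its bounded solution is unique because 4 \<zeta> < 1; this
  yields the Fourier formula without inverting a series.\<close>

section \<open>Characteristic functions determine laws on finite products\<close>

text \<open>After division by its total mass (equal on both sides by u = 0) the weight becomes a
  probability density, and Levy's theorem applies to the image under \<open>Y\<close>. Total mass
  zero is separate, since then the weight vanishes almost everywhere. The weight serves to carry
  information on other coordinates.\<close>

lemma weighted_Levy_uniqueness:
  assumes P: "prob_space P" and Q: "prob_space Q"
    and YP[measurable]: "Y \<in> borel_measurable P" and YQ[measurable]: "Y \<in> borel_measurable Q"
    and wP[measurable]: "w \<in> borel_measurable P" and wQ[measurable]: "w \<in> borel_measurable Q"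
    and w0: "\<And>y. 0 \<le> w y" and wB: "\<And>y. w y \<le> (B::real)"
    and eq: "\<And>u. (CLINT y|P. iexp (u * Y y) * complex_of_real (w y))
               = (CLINT y|Q. iexp (u * Y y) * complex_of_real (w y))"
    and A[measurable]: "A \<in> sets borel"
  shows "(LINT y|P. w y * indicator A (Y y)) = (LINT y|Q. w y * indicator A (Y y))"
proof -
  interpret P: prob_space P by fact
  interpret Q: prob_space Q by fact
  have iP: "integrable P w" by (rule P.integrable_const_bound[where B = B]) (auto simp: w0 wB)
  have iQ: "integrable Q w" by (rule Q.integrable_const_bound[where B = B]) (auto simp: w0 wB)
  define m where "m = (LINT y|P. w y)"
  have "complex_of_real m = complex_of_real (LINT y|Q. w y)"
    using eq[of 0] by (simp add: m_def)
  then have mQ: "m = (LINT y|Q. w y)" by simp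
  have m0: "0 \<le> m" by (simp add: m_def w0)
  show ?thesis
  proof (cases "m = 0")
    case True
    have "AE y in P. w y = 0"
      using True m_def iP w0 by (simp add: integral_nonneg_eq_0_iff_AE)
    then have a: "(LINT y|P. w y * indicator A (Y y)) = (LINT y|P. 0)"
      by (intro integral_cong_AE) auto
    have "AE y in Q. w y = 0"
      using True mQ iQ w0 by (simp add: integral_nonneg_eq_0_iff_AE)
    then have b: "(LINT y|Q. w y * indicator A (Y y)) = (LINT y|Q. 0)"
      by (intro integral_cong_AE) auto
    show ?thesis using a b by simp
  next
    case False
    then have m: "0 < m" using m0 by simp
    have law: "real_distribution (distr (density N (\<lambda>y. w y / m)) borel Y) \<and>
        char (distr (density N (\<lambda>y. w y / m)) borel Y)
          = (\<lambda>u. (CLINT y|N. iexp (u * Y y) * complex_of_real (w y)) / m) \<and>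
        measure (distr (density N (\<lambda>y. w y / m)) borel Y) A
          = (LINT y|N. w y * indicator A (Y y)) / m"
      if N: "prob_space N" and [measurable]: "Y \<in> borel_measurable N" "w \<in> borel_measurable N"
        and mN: "m = (LINT y|N. w y)" and iN: "integrable N w" for N
    proof (intro conjI)
      interpret N: prob_space N by fact
      have "(\<integral>\<^sup>+y. ennreal (w y / m) \<partial>N) = ennreal (LINT y|N. w y / m)"
        using iN m w0 by (intro nn_integral_eq_integral) auto
      also have "\<dots> = 1" using mN m by simp
      finally have tot: "(\<integral>\<^sup>+y. ennreal (w y / m) \<partial>N) = 1" .
      interpret D: prob_space "density N (\<lambda>y. w y / m)"
        by standard (simp add: emeasure_density tot cong: nn_integral_cong_simp)
      show "real_distribution (distr (density N (\<lambda>y. w y / m)) borel Y)"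
        by (rule D.real_distribution_distr) simp
      show "char (distr (density N (\<lambda>y. w y / m)) borel Y)
          = (\<lambda>u. (CLINT y|N. iexp (u * Y y) * complex_of_real (w y)) / m)"
      proof
        fix u
        have "char (distr (density N (\<lambda>y. w y / m)) borel Y) u
            = (CLINT y|N. (w y / m) *\<^sub>R iexp (u * Y y))"
          unfolding char_def using m w0
          by (subst integral_distr, simp, simp, subst integral_density) auto
        also have "\<dots> = (CLINT y|N. (iexp (u * Y y) * complex_of_real (w y)) / m)"
          by (intro Bochner_Integration.integral_cong) (auto simp: scaleR_conv_of_real)
        finally show "char (distr (density N (\<lambda>y. w y / m)) borel Y) u
           = (CLINT y|N. iexp (u * Y y) * complex_of_real (w y)) / m" by simp
      qed
      have "measure (distr (density N (\<lambda>y. w y / m)) borel Y) A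
          = (LINT x|distr (density N (\<lambda>y. w y / m)) borel Y. indicator A x)"
        by simp
      also have "\<dots> = (LINT y|N. (w y / m) *\<^sub>R indicator A (Y y))"
        using m w0 by (subst integral_distr, simp, simp, subst integral_density) auto
      also have "\<dots> = (LINT y|N. w y * indicator A (Y y) / m)"
        by (intro Bochner_Integration.integral_cong) auto
      finally show "measure (distr (density N (\<lambda>y. w y / m)) borel Y) A
          = (LINT y|N. w y * indicator A (Y y)) / m" by simp
    qed
    note lP = law[OF P YP wP m_def iP] and lQ = law[OF Q YQ wQ mQ iQ]
    have "distr (density P (\<lambda>y. w y / m)) borel Y = distr (density Q (\<lambda>y. w y / m)) borel Y"
      by (rule Levy_uniqueness) (use lP lQ eq in auto)
    then show ?thesis using lP lQ m by (metis divide_cancel_right less_irrefl)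
  qed
qed

text \<open>Induction over coordinates: one after another, an exponential factor is exchanged for
  the indicator of a Borel set by the one-dimensional uniqueness theorem. At the end only boxes
  remain, and they generate the product sigma-algebra.\<close>

theorem PiM_char_uniqueness:
  fixes P Q :: "('i \<Rightarrow> real) measure"
  assumes I: "finite I" and P: "prob_space P" and Q: "prob_space Q"
    and sP[measurable_cong]: "sets P = sets (\<Pi>\<^sub>M s\<in>I. borel)"
    and sQ[measurable_cong]: "sets Q = sets (\<Pi>\<^sub>M s\<in>I. borel)"
    and eq: "\<And>t. (CLINT y|P. iexp (\<Sum>s\<in>I. t s * y s)) = (CLINT y|Q. iexp (\<Sum>s\<in>I. t s * y s))"
  shows "P = Q"
proof -
  interpret P: prob_space P by fact
  interpret Q: prob_space Q by fact
  \<comment> \<open>The mixed transform interpolates between the hypothesis (\<open>J\<close> empty)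
    and the measures of boxes (\<open>J = I\<close>).\<close>
  have main: "(CLINT y|P. iexp (\<Sum>s\<in>I - J. t s * y s) * complex_of_real (\<Prod>s\<in>J. indicator (A s) (y s)))
      = (CLINT y|Q. iexp (\<Sum>s\<in>I - J. t s * y s) * complex_of_real (\<Prod>s\<in>J. indicator (A s) (y s)))"
    if "finite J" "J \<subseteq> I" "\<And>s. s \<in> J \<Longrightarrow> A s \<in> sets borel" for J t and A :: "'i \<Rightarrow> real set"
    using that
  proof (induction J arbitrary: t rule: finite_induct)
    case empty
    then show ?case using eq by simp
  next
    case (insert j J)
    define W where "W = (\<lambda>y::'i \<Rightarrow> real. \<Prod>s\<in>J. (indicator (A s) (y s) :: real))"
    define R where "R = I - insert j J"
    have [measurable]: "A s \<in> sets borel" if "s \<in> J" for s using insert that by auto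
    have Aj[measurable]: "A j \<in> sets borel" using insert by auto
    have jI: "j \<in> I" and JI: "J \<subseteq> I" using insert by auto
    have compP: "(\<lambda>y. y s) \<in> borel_measurable P" if "s \<in> I" for s
      using that by measurable
    have compQ: "(\<lambda>y. y s) \<in> borel_measurable Q" if "s \<in> I" for s
      using that by measurable
    have W01: "0 \<le> W y" "W y \<le> 1" for y
      unfolding W_def by (auto intro!: prod_nonneg prod_le_1)
    have WmP[measurable]: "W \<in> borel_measurable P"
      unfolding W_def using JI compP by (intro borel_measurable_prod measurable_compose[OF compP]) auto
    have WmQ[measurable]: "W \<in> borel_measurable Q"
      unfolding W_def using JI compQ by (intro borel_measurable_prod measurable_compose[OF compQ]) auto
    define \<theta> where "\<theta> = (\<lambda>t (y::'i \<Rightarrow> real). \<Sum>s\<in>R. t s * y s)"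
    have \<theta>P[measurable]: "\<theta> t \<in> borel_measurable P" for t
      unfolding \<theta>_def R_def by (intro borel_measurable_sum borel_measurable_times compP) auto
    have \<theta>Q[measurable]: "\<theta> t \<in> borel_measurable Q" for t
      unfolding \<theta>_def R_def by (intro borel_measurable_sum borel_measurable_times compQ) auto
    note [measurable] = compP[OF jI] compQ[OF jI]
    \<comment> \<open>The coordinate \<open>j\<close> still carries an exponential in the induction
      hypothesis, and its frequency is free; calling it u exhibits a characteristic function of
      \<open>y j\<close>.\<close>
    have step: "(CLINT y|P. iexp (u * y j) * (iexp (\<theta> t y) * complex_of_real (W y)))
        = (CLINT y|Q. iexp (u * y j) * (iexp (\<theta> t y) * complex_of_real (W y)))" for u t
    proof -
      have *: "iexp (\<Sum>s\<in>I - J. (t(j := u)) s * y s) = iexp (u * y j) * iexp (\<theta> t y)" for y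
      proof -
        have "I - J = insert j R" "j \<notin> R" "finite R" using jI insert I by (auto simp: R_def)
        moreover have "(\<Sum>s\<in>R. (t(j := u)) s * y s) = \<theta> t y"
          unfolding \<theta>_def by (intro sum.cong) (auto simp: R_def)
        ultimately have "(\<Sum>s\<in>I - J. (t(j := u)) s * y s) = u * y j + \<theta> t y"
          by (simp del: fun_upd_apply) simp
        then show ?thesis by (simp add: exp_add[symmetric] algebra_simps)
      qed
      show ?thesis
        using insert.IH[of "t(j := u)"] insert.prems unfolding *
        by (simp add: mult.assoc W_def)
    qed
    have \<theta>neg: "\<theta> (\<lambda>s. - t s) y = - \<theta> t y" for y by (simp add: \<theta>_def sum_negf)
    have \<theta>0: "\<theta> (\<lambda>s. 0) y = 0" for y by (simp add: \<theta>_def)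
    have W_eq: "(CLINT y|P. iexp (u * y j) * complex_of_real (W y))
        = (CLINT y|Q. iexp (u * y j) * complex_of_real (W y))" for u
      using step[of u "\<lambda>_. 0"] by (simp add: \<theta>0)
    have int: "integrable P (\<lambda>y. iexp (u * y j) * (iexp (\<theta> t y) * complex_of_real (W y)))"
      "integrable Q (\<lambda>y. iexp (u * y j) * (iexp (\<theta> t y) * complex_of_real (W y)))"
      "integrable P (\<lambda>y. iexp (u * y j) * complex_of_real (W y))"
      "integrable Q (\<lambda>y. iexp (u * y j) * complex_of_real (W y))" for u t
      by (rule P.integrable_const_bound[where B = 1] Q.integrable_const_bound[where B = 1];
          use W01 in \<open>auto simp: norm_mult\<close>)+
    have cos_sin: "complex_of_real (cos x) = (iexp x + iexp (- x)) / 2"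
      "complex_of_real (sin x) = (iexp x - iexp (- x)) / (2 * \<i>)" for x
      by (simp_all add: cos_of_real[symmetric] sin_of_real[symmetric] cos_exp_eq sin_exp_eq)
    have cosexp: "iexp a * complex_of_real ((1 + cos x) * w) =
        iexp a * complex_of_real w + (iexp a * (iexp x * complex_of_real w)) / 2
          + (iexp a * (iexp (- x) * complex_of_real w)) / 2"
      and sinexp: "iexp a * complex_of_real ((1 + sin x) * w) =
        iexp a * complex_of_real w + (iexp a * (iexp x * complex_of_real w)) / (2 * \<i>)
          - (iexp a * (iexp (- x) * complex_of_real w)) / (2 * \<i>)" for a x w
      unfolding of_real_mult of_real_add cos_sin by (simp_all add: field_simps)
    note n = \<theta>neg[symmetric]
    \<comment> \<open>The remaining exponential is complex and cannot be a weight. Its real and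
      imaginary parts become nonnegative after adding 1, and the contribution of the added 1 is the
      weight \<open>W\<close> alone, which is subtracted again in \<open>split\<close>.\<close>
    have cos_eq: "(CLINT y|P. iexp (u * y j) * complex_of_real ((1 + cos (\<theta> t y)) * W y))
        = (CLINT y|Q. iexp (u * y j) * complex_of_real ((1 + cos (\<theta> t y)) * W y))" for u
      unfolding cosexp n
      by (subst Bochner_Integration.integral_add, use int in simp, use int in simp,
          subst Bochner_Integration.integral_add, use int in simp, use int in simp,
          subst Bochner_Integration.integral_add, use int in simp, use int in simp,
          subst Bochner_Integration.integral_add, use int in simp, use int in simp)
         (simp only: integral_divide_zero step W_eq)
    have sin_eq: "(CLINT y|P. iexp (u * y j) * complex_of_real ((1 + sin (\<theta> t y)) * W y))
        = (CLINT y|Q. iexp (u * y j) * complex_of_real ((1 + sin (\<theta> t y)) * W y))" for u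
      unfolding sinexp n
      by (subst Bochner_Integration.integral_diff, use int in simp, use int in simp,
          subst Bochner_Integration.integral_add, use int in simp, use int in simp,
          subst Bochner_Integration.integral_diff, use int in simp, use int in simp,
          subst Bochner_Integration.integral_add, use int in simp, use int in simp)
         (simp only: integral_divide_zero step W_eq)
    have "0 \<le> 1 + cos x" "1 + cos x \<le> 2" "0 \<le> 1 + sin x" "1 + sin x \<le> 2" for x :: real
      using cos_ge_minus_one[of x] cos_le_one[of x] sin_ge_minus_one[of x] sin_le_one[of x]
      by linarith+
    then have bd: "0 \<le> (1 + cos x) * W y" "(1 + cos x) * W y \<le> 2" "0 \<le> (1 + sin x) * W y"
      "(1 + sin x) * W y \<le> 2" for x y
      using W01[of y] mult_mono[of "1 + cos x" 2 "W y" 1] mult_mono[of "1 + sin x" 2 "W y" 1]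
      by (simp_all del: cos_ge_minus_one sin_ge_minus_one add: mult_nonneg_nonneg)
    have fW: "(LINT y|P. W y * indicator (A j) (y j)) = (LINT y|Q. W y * indicator (A j) (y j))"
      by (rule weighted_Levy_uniqueness[OF P Q, where B = 1 and Y = "\<lambda>y. y j"]) (use W01 W_eq in auto)
    have fc: "(LINT y|P. (1 + cos (\<theta> t y)) * W y * indicator (A j) (y j))
        = (LINT y|Q. (1 + cos (\<theta> t y)) * W y * indicator (A j) (y j))"
      by (rule weighted_Levy_uniqueness[OF P Q, where B = 2 and Y = "\<lambda>y. y j"])
         (use bd cos_eq in auto)
    have fs: "(LINT y|P. (1 + sin (\<theta> t y)) * W y * indicator (A j) (y j))
        = (LINT y|Q. (1 + sin (\<theta> t y)) * W y * indicator (A j) (y j))"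
      by (rule weighted_Levy_uniqueness[OF P Q, where B = 2 and Y = "\<lambda>y. y j"])
         (use bd sin_eq in auto)
    define V where "V = (\<lambda>y. W y * indicator (A j) (y j))"
    have V01: "\<bar>V y\<bar> \<le> 1" for y using W01[of y] by (auto simp: V_def indicator_def)
    have [measurable]: "V \<in> borel_measurable P" "V \<in> borel_measurable Q"
      by (simp_all add: V_def)
    have prodV: "(\<Prod>s\<in>insert j J. indicator (A s) (y s)) = V y" for y
      using insert by (simp add: V_def W_def mult.commute)
    have bdd: "\<bar>f x * V y\<bar> \<le> 1" if "\<bar>f x\<bar> \<le> 1" for f :: "real \<Rightarrow> real" and x y
      using mult_mono[OF that V01[of y]] by (simp add: abs_mult)
    have split: "(CLINT y|N. iexp (\<theta> t y) * complex_of_real (V y))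
        = complex_of_real ((LINT y|N. (1 + cos (\<theta> t y)) * V y) - (LINT y|N. V y))
          + \<i> * complex_of_real ((LINT y|N. (1 + sin (\<theta> t y)) * V y) - (LINT y|N. V y))"
      if "prob_space N" and [measurable]: "V \<in> borel_measurable N" "\<theta> t \<in> borel_measurable N" for N
    proof -
      interpret N: prob_space N by fact
      have i: "integrable N (\<lambda>y. cos (\<theta> t y) * V y)" "integrable N (\<lambda>y. sin (\<theta> t y) * V y)"
        "integrable N V"
        by (rule N.integrable_const_bound[where B = 1]; use bdd V01 in \<open>auto\<close>)+
      have "iexp (\<theta> t y) * complex_of_real (V y)
          = complex_of_real (cos (\<theta> t y) * V y) + \<i> * complex_of_real (sin (\<theta> t y) * V y)" for y
        by (simp add: exp_Euler algebra_simps cos_of_real sin_of_real)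
      then have "(CLINT y|N. iexp (\<theta> t y) * complex_of_real (V y))
          = complex_of_real (LINT y|N. cos (\<theta> t y) * V y) + \<i> * complex_of_real (LINT y|N. sin (\<theta> t y) * V y)"
        using i by (simp only: Bochner_Integration.integral_add integrable_of_real
            integrable_mult_right integral_mult_right_zero integral_complex_of_real)
      then show ?thesis using i by (simp add: distrib_right)
    qed
    have "(CLINT y|P. iexp (\<theta> t y) * complex_of_real (V y)) = (CLINT y|Q. iexp (\<theta> t y) * complex_of_real (V y))"
      unfolding split[OF P \<open>V \<in> borel_measurable P\<close> \<theta>P] split[OF Q \<open>V \<in> borel_measurable Q\<close> \<theta>Q]
      using fW fc fs by (simp add: V_def mult.assoc)
    then show ?case unfolding prodV by (simp add: \<theta>_def R_def)
  qed
  have cyl: "emeasure P (Pi\<^sub>E I A) = emeasure Q (Pi\<^sub>E I A)" if A: "\<And>s. s \<in> I \<Longrightarrow> A s \<in> sets borel" for A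
  proof -
    have ind: "(\<Prod>s\<in>I. indicator (A s) (y s)) = (indicator (Pi\<^sub>E I A) y :: real)"
      if "y \<in> space (\<Pi>\<^sub>M s\<in>I. borel)" for y
      using that I by (auto simp: indicator_def space_PiM PiE_iff prod_zero_iff)
    have mA: "Pi\<^sub>E I A \<in> sets (\<Pi>\<^sub>M s\<in>I. borel)" using A I by (intro sets_PiM_I_finite) auto
    have sp: "space P = space (\<Pi>\<^sub>M s\<in>I. borel)" "space Q = space (\<Pi>\<^sub>M s\<in>I. borel)"
      using sP sQ by (auto dest: sets_eq_imp_space_eq)
    have "complex_of_real (LINT y|P. (\<Prod>s\<in>I. indicator (A s) (y s)))
        = complex_of_real (LINT y|Q. (\<Prod>s\<in>I. indicator (A s) (y s)))"
      using main[OF I subset_refl, of A "\<lambda>_. 0"] A unfolding integral_complex_of_real[symmetric] by simp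
    then have "(LINT y|P. (\<Prod>s\<in>I. indicator (A s) (y s))) = (LINT y|Q. (\<Prod>s\<in>I. indicator (A s) (y s)) :: real)"
      using of_real_eq_iff by blast
    also have "(LINT y|P. (\<Prod>s\<in>I. indicator (A s) (y s)) :: real) = (LINT y|P. indicator (Pi\<^sub>E I A) y)"
      by (intro Bochner_Integration.integral_cong) (auto simp: ind sp)
    also have "(LINT y|Q. (\<Prod>s\<in>I. indicator (A s) (y s)) :: real) = (LINT y|Q. indicator (Pi\<^sub>E I A) y)"
      by (intro Bochner_Integration.integral_cong) (auto simp: ind sp)
    finally have "measure P (Pi\<^sub>E I A) = measure Q (Pi\<^sub>E I A)"
      using mA sP sQ sets.sets_into_space[OF mA] by (simp add: sp Int_absorb2)
    then show ?thesis by (simp add: P.emeasure_eq_measure Q.emeasure_eq_measure)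
  qed
  show "P = Q"
  proof (rule measure_eqI_PiM_finite[OF I sP sQ, where A = "\<lambda>_. (\<Pi>\<^sub>E s\<in>I. UNIV)"])
    show "emeasure P (Pi\<^sub>E I A) = emeasure Q (Pi\<^sub>E I A)" if "\<And>i. i \<in> I \<Longrightarrow> A i \<in> sets borel" for A
      using cyl that by blast
    show "range (\<lambda>_::nat. \<Pi>\<^sub>E s\<in>I. UNIV) \<subseteq> prod_algebra I (\<lambda>_. borel)"
      using I by (auto intro!: prod_algebraI_finite)
  qed (auto simp: space_PiM)
qed

section \<open>Gaussian laws\<close>

lemma prob_space_normal_law: "0 \<le> v \<Longrightarrow> prob_space (normal_law m v)"
  unfolding normal_law_def by (auto intro: prob_space_return prob_space_normal_density)

lemma sets_normal_law[simp, measurable_cong]: "sets (normal_law m v) = sets borel"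
  by (simp add: normal_law_def)

lemma space_normal_law[simp]: "space (normal_law m v) = UNIV"
  by (simp add: normal_law_def)

text \<open>The affine image of the standard normal includes the point mass v = 0, so moments and
  characteristic functions below need no case distinction.\<close>

lemma normal_law_eq_distr:
  assumes "0 \<le> v"
  shows "normal_law m v = distr std_normal_distribution borel (\<lambda>x. m + v * x)"
proof (cases "v = 0")
  case True
  interpret prob_space std_normal_distribution by (rule prob_space_normal_density) simp
  show ?thesis
    using True distr_const[of m borel] by (simp add: normal_law_def)
next
  case False
  interpret prob_space std_normal_distribution by (rule prob_space_normal_density) simp
  have "distributed std_normal_distribution lborel (\<lambda>x. x) (normal_density 0 1)"
    unfolding distributed_def by (subst distr_id2) auto
  from normal_density_affine[OF this, of v m] False assms
  have "distributed std_normal_distribution lborel (\<lambda>x. m + v * x) (normal_density m v)" by simp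
  then have "density lborel (normal_density m v) = distr std_normal_distribution lborel (\<lambda>x. m + v * x)"
    by (simp add: distributed_def)
  also have "\<dots> = distr std_normal_distribution borel (\<lambda>x. m + v * x)"
    by (rule distr_cong) auto
  finally show ?thesis using False by (simp add: normal_law_def)
qed

lemma integrable_std_normal_power: "integrable std_normal_distribution (\<lambda>x. x ^ k)"
  by (rule integrable_std_normal_distribution_moment)

lemma normal_law_mean:
  assumes "0 \<le> v"
  shows "integrable (normal_law m v) (\<lambda>x. x)" "(LINT x|normal_law m v. x) = m"
proof -
  interpret prob_space std_normal_distribution by (rule prob_space_normal_density) simp
  have i: "integrable std_normal_distribution (\<lambda>x. x)"
    using integrable_std_normal_power[of 1] by simp
  have z: "(LINT x|std_normal_distribution. x) = 0"
    using integral_std_normal_distribution_moment_odd[of 1] by simp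
  have j: "integrable std_normal_distribution (\<lambda>x. m + v * x)"
    by (rule Bochner_Integration.integrable_add[OF integrable_const integrable_mult_right[OF i]])
  show "integrable (normal_law m v) (\<lambda>x. x)"
    unfolding normal_law_eq_distr[OF assms] by (subst integrable_distr_eq) (simp_all add: j)
  have "(LINT x|std_normal_distribution. m + v * x)
      = (LINT x|std_normal_distribution. m) + (LINT x|std_normal_distribution. v * x)"
    by (rule Bochner_Integration.integral_add[OF integrable_const integrable_mult_right[OF i]])
  also have "(LINT x|std_normal_distribution. m) = m"
    by (simp only: lebesgue_integral_const prob_space scaleR_one)
  also have "(LINT x|std_normal_distribution. v * x) = 0"
    by (simp only: integral_mult_right_zero z mult_zero_right)
  finally show "(LINT x|normal_law m v. x) = m"
    unfolding normal_law_eq_distr[OF assms] by (subst integral_distr) simp_all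
qed

lemma normal_law_second_moment:
  assumes "0 \<le> v"
  shows "integrable (normal_law 0 v) (\<lambda>x. x\<^sup>2)" "(LINT x|normal_law 0 v. x\<^sup>2) = v\<^sup>2"
proof -
  have i: "integrable std_normal_distribution (\<lambda>x. x\<^sup>2)"
    by (rule integrable_std_normal_power)
  have z: "(LINT x|std_normal_distribution. x\<^sup>2) = 1"
    using std_normal_distribution_even_moments[of 1] by (simp add: fact_numeral)
  show "integrable (normal_law 0 v) (\<lambda>x. x\<^sup>2)"
    unfolding normal_law_eq_distr[OF assms] using i
    by (subst integrable_distr_eq) (auto simp: power_mult_distrib)
  show "(LINT x|normal_law 0 v. x\<^sup>2) = v\<^sup>2"
    unfolding normal_law_eq_distr[OF assms] using i z
    by (subst integral_distr) (auto simp: power_mult_distrib)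
qed

lemma normal_law_char:
  assumes "0 \<le> v"
  shows "(CLINT x|normal_law m v. iexp (t * x)) = iexp (t * m) * complex_of_real (exp (- (t\<^sup>2 * v\<^sup>2 / 2)))"
proof -
  have "(CLINT x|normal_law m v. iexp (t * x))
      = (CLINT x|std_normal_distribution. iexp (t * m) * iexp ((t * v) * x))"
    unfolding normal_law_eq_distr[OF assms]
    by (subst integral_distr) (auto simp: exp_add[symmetric] algebra_simps)
  also have "\<dots> = iexp (t * m) * char std_normal_distribution (t * v)"
    unfolding char_def by simp
  also have "char std_normal_distribution (t * v) = complex_of_real (exp (- (t\<^sup>2 * v\<^sup>2 / 2)))"
    by (simp add: char_std_normal_distribution power_mult_distrib)
  finally show ?thesis .
qed

text \<open>Real versions, because conditional expectations are taken of real functions.\<close>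

lemma normal_law_cos_sin:
  assumes "0 \<le> v"
  shows "(LINT x|normal_law 0 v. cos (t * x)) = exp (- (t\<^sup>2 * v\<^sup>2 / 2))"
    "(LINT x|normal_law 0 v. sin (t * x)) = 0"
proof -
  interpret prob_space "normal_law 0 v" using assms by (rule prob_space_normal_law)
  have i: "integrable (normal_law 0 v) (\<lambda>x. iexp (t * x))"
    by (rule integrable_iexp) auto
  have c: "Re (iexp x) = cos x" "Im (iexp x) = sin x" for x
    by (simp_all add: Re_exp Im_exp)
  have "Re (CLINT x|normal_law 0 v. iexp (t * x)) = exp (- (t\<^sup>2 * v\<^sup>2 / 2))"
    "Im (CLINT x|normal_law 0 v. iexp (t * x)) = 0"
    by (simp_all only: normal_law_char[OF assms]) simp_all
  moreover have "(LINT x|normal_law 0 v. cos (t * x)) = Re (CLINT x|normal_law 0 v. iexp (t * x))"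
    "(LINT x|normal_law 0 v. sin (t * x)) = Im (CLINT x|normal_law 0 v. iexp (t * x))"
    by (simp_all only: integral_Re[OF i, symmetric] integral_Im[OF i, symmetric] c)
  ultimately show "(LINT x|normal_law 0 v. cos (t * x)) = exp (- (t\<^sup>2 * v\<^sup>2 / 2))"
    "(LINT x|normal_law 0 v. sin (t * x)) = 0"
    by (simp_all only:)
qed

section \<open>Linear functionals of a Gaussian field\<close>

text \<open>Finite combinations suffice, without closure in the square mean, because the conditional
  mean involves just four neighbours. The set of sites records which variables may occur: with
  \<open>- {s}\<close> the functionals are measurable with respect to
  \<open>sigma_except\<close>.\<close>

definition lin_span :: "(site \<Rightarrow> 'a \<Rightarrow> real) \<Rightarrow> site set \<Rightarrow> ('a \<Rightarrow> real) set" where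
  "lin_span X T = {S. \<exists>F c. finite F \<and> F \<subseteq> T \<and> S = (\<lambda>\<omega>. \<Sum>s\<in>F. c s * X s \<omega>)}"

lemma lin_span_base: "s \<in> T \<Longrightarrow> X s \<in> lin_span X T"
  unfolding lin_span_def by (auto intro!: exI[of _ "{s}"] exI[of _ "\<lambda>_. 1"])

lemma lin_span_zero: "(\<lambda>\<omega>. 0) \<in> lin_span X T"
  unfolding lin_span_def by (auto intro!: exI[of _ "{}"])

lemma lin_span_add:
  assumes "S \<in> lin_span X T" "R \<in> lin_span X T"
  shows "(\<lambda>\<omega>. S \<omega> + R \<omega>) \<in> lin_span X T"
proof -
  obtain F c where F: "finite F" "F \<subseteq> T" "S = (\<lambda>\<omega>. \<Sum>s\<in>F. c s * X s \<omega>)"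
    using assms(1) by (auto simp: lin_span_def)
  obtain G d where G: "finite G" "G \<subseteq> T" "R = (\<lambda>\<omega>. \<Sum>s\<in>G. d s * X s \<omega>)"
    using assms(2) by (auto simp: lin_span_def)
  have "(\<Sum>s\<in>F. c s * X s \<omega>) + (\<Sum>s\<in>G. d s * X s \<omega>)
      = (\<Sum>s\<in>F \<union> G. ((if s \<in> F then c s else 0) + (if s \<in> G then d s else 0)) * X s \<omega>)" for \<omega>
  proof -
    have "(\<Sum>s\<in>F. c s * X s \<omega>) = (\<Sum>s\<in>F \<union> G. (if s \<in> F then c s else 0) * X s \<omega>)"
      "(\<Sum>s\<in>G. d s * X s \<omega>) = (\<Sum>s\<in>F \<union> G. (if s \<in> G then d s else 0) * X s \<omega>)"
      using F(1) G(1) by (auto intro!: sum.mono_neutral_cong_left)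
    then show ?thesis by (simp add: sum.distrib distrib_right)
  qed
  then show ?thesis unfolding lin_span_def using F G
    by (auto intro!: exI[of _ "F \<union> G"]
        exI[of _ "\<lambda>s. (if s \<in> F then c s else 0) + (if s \<in> G then d s else 0)"])
qed

lemma lin_span_scale:
  assumes "S \<in> lin_span X T"
  shows "(\<lambda>\<omega>. a * S \<omega>) \<in> lin_span X T"
proof -
  obtain F c where F: "finite F" "F \<subseteq> T" "S = (\<lambda>\<omega>. \<Sum>s\<in>F. c s * X s \<omega>)"
    using assms by (auto simp: lin_span_def)
  show ?thesis unfolding lin_span_def using F
    by (auto intro!: exI[of _ "F"] exI[of _ "\<lambda>s. a * c s"] simp: sum_distrib_left mult.assoc)
qed

lemma lin_span_diff:
  assumes "S \<in> lin_span X T" "R \<in> lin_span X T"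
  shows "(\<lambda>\<omega>. S \<omega> - R \<omega>) \<in> lin_span X T"
  using lin_span_add[OF assms(1) lin_span_scale[OF assms(2), of "-1"]] by simp

lemma lin_span_sum:
  assumes "\<And>i. i \<in> J \<Longrightarrow> S i \<in> lin_span X T"
  shows "(\<lambda>\<omega>. \<Sum>i\<in>J. S i \<omega>) \<in> lin_span X T"
  using assms by (induction J rule: infinite_finite_induct) (auto intro: lin_span_zero lin_span_add)

lemma lin_span_mono: "T \<subseteq> T' \<Longrightarrow> lin_span X T \<subseteq> lin_span X T'"
  unfolding lin_span_def by blast

lemmas lin_span_intros = lin_span_base lin_span_zero lin_span_add lin_span_scale lin_span_diff
  lin_span_sum

locale centered_gaussian = prob_space M for M :: "'a measure" +
  fixes X :: "site \<Rightarrow> 'a \<Rightarrow> real"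
  assumes gaussian: "gaussian_field M X" and centered: "\<And>s. integral\<^sup>L M (X s) = 0"
begin

abbreviation "lin \<equiv> lin_span X UNIV"

lemma X_measurable[measurable]: "X s \<in> borel_measurable M"
  using gaussian unfolding gaussian_field_def by blast

lemma lin_measurable: "S \<in> lin \<Longrightarrow> S \<in> borel_measurable M"
proof -
  assume "S \<in> lin"
  then obtain F c where F: "S = (\<lambda>\<omega>. \<Sum>s\<in>F. c s * X s \<omega>)" unfolding lin_span_def by blast
  show "S \<in> borel_measurable M" unfolding F by measurable
qed

lemma lin_law_ex:
  assumes "S \<in> lin"
  obtains \<mu> v where "0 \<le> v" "distr M borel S = normal_law \<mu> v"
proof -
  obtain F c where F: "finite F" "S = (\<lambda>\<omega>. \<Sum>s\<in>F. c s * X s \<omega>)"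
    using assms by (auto simp: lin_span_def)
  from gaussian[unfolded gaussian_field_def, THEN conjunct2, rule_format, OF F(1), of c]
  show thesis using F(2) that by blast
qed

lemma lin_integrable: assumes "S \<in> lin" shows "integrable M S"
proof -
  note [measurable] = lin_measurable[OF assms]
  obtain \<mu> v where v: "0 \<le> v" "distr M borel S = normal_law \<mu> v" using lin_law_ex[OF assms] .
  have "integrable (distr M borel S) (\<lambda>x. x)" using v normal_law_mean by simp
  then show ?thesis by (subst (asm) integrable_distr_eq) auto
qed

lemma lin_mean: assumes "S \<in> lin" shows "integral\<^sup>L M S = 0"
proof -
  obtain F c where F: "finite F" "S = (\<lambda>\<omega>. \<Sum>s\<in>F. c s * X s \<omega>)"
    using assms by (auto simp: lin_span_def)
  have "integrable M (X s)" for s by (rule lin_integrable) (simp add: lin_span_base)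
  then show ?thesis using F by (simp add: Bochner_Integration.integral_sum centered)
qed

text \<open>\<open>gaussian_field\<close> supplies only some mean and some standard deviation; the
  first two moments identify them.\<close>

lemma lin_law:
  assumes "S \<in> lin"
  shows "integrable M (\<lambda>\<omega>. (S \<omega>)\<^sup>2)"
    and "distr M borel S = normal_law 0 (sqrt (LINT \<omega>|M. (S \<omega>)\<^sup>2))"
proof -
  note [measurable] = lin_measurable[OF assms]
  obtain \<mu> v where v: "0 \<le> v" "distr M borel S = normal_law \<mu> v" using lin_law_ex[OF assms] .
  have "\<mu> = (LINT x|distr M borel S. x)" using v normal_law_mean by simp
  also have "\<dots> = 0" using lin_mean[OF assms] by (subst integral_distr) auto
  finally have law: "distr M borel S = normal_law 0 v" using v by simp
  have "integrable (distr M borel S) (\<lambda>x. x\<^sup>2)" using v(1) law normal_law_second_moment by simp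
  then show "integrable M (\<lambda>\<omega>. (S \<omega>)\<^sup>2)" by (subst (asm) integrable_distr_eq) auto
  have "v\<^sup>2 = (LINT x|distr M borel S. x\<^sup>2)" using v(1) law normal_law_second_moment by simp
  also have "\<dots> = (LINT \<omega>|M. (S \<omega>)\<^sup>2)" by (subst integral_distr) auto
  finally show "distr M borel S = normal_law 0 (sqrt (LINT \<omega>|M. (S \<omega>)\<^sup>2))"
    using v(1) law by (metis real_sqrt_abs abs_of_nonneg)
qed

lemma lin_iexp:
  assumes "S \<in> lin"
  shows "(CLINT \<omega>|M. iexp (S \<omega>)) = complex_of_real (exp (- ((LINT \<omega>|M. (S \<omega>)\<^sup>2) / 2)))"
proof -
  note [measurable] = lin_measurable[OF assms]
  have "(CLINT \<omega>|M. iexp (S \<omega>)) = (CLINT x|distr M borel S. iexp (1 * x))"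
    by (subst integral_distr) auto
  also have "\<dots> = complex_of_real (exp (- ((LINT \<omega>|M. (S \<omega>)\<^sup>2) / 2)))"
    unfolding lin_law(2)[OF assms] by (subst normal_law_char) auto
  finally show ?thesis .
qed

text \<open>Turns an identity between expected cosines into one between second moments.\<close>

lemma lin_cos:
  assumes "S \<in> lin"
  shows "(LINT \<omega>|M. cos (S \<omega>)) = exp (- ((LINT \<omega>|M. (S \<omega>)\<^sup>2) / 2))"
proof -
  note [measurable] = lin_measurable[OF assms]
  have "(LINT \<omega>|M. cos (S \<omega>)) = (LINT x|distr M borel S. cos (1 * x))"
    by (subst integral_distr) auto
  also have "\<dots> = exp (- ((LINT \<omega>|M. (S \<omega>)\<^sup>2) / 2))"
    unfolding lin_law(2)[OF assms] by (subst normal_law_cos_sin) auto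
  finally show ?thesis .
qed

lemma lin_mult_integrable:
  assumes "S \<in> lin" "R \<in> lin"
  shows "integrable M (\<lambda>\<omega>. S \<omega> * R \<omega>)"
proof (rule Bochner_Integration.integrable_bound)
  show "integrable M (\<lambda>\<omega>. (S \<omega>)\<^sup>2 + (R \<omega>)\<^sup>2)"
    using lin_law(1)[OF assms(1)] lin_law(1)[OF assms(2)] by (rule Bochner_Integration.integrable_add)
  show "(\<lambda>\<omega>. S \<omega> * R \<omega>) \<in> borel_measurable M"
    by (rule borel_measurable_times) (rule lin_measurable assms)+
  have *: "norm (a * b) \<le> norm (a\<^sup>2 + b\<^sup>2)" for a b :: real
  proof -
    have "2 * (\<bar>a\<bar> * \<bar>b\<bar>) \<le> a\<^sup>2 + b\<^sup>2" "0 \<le> \<bar>a\<bar> * \<bar>b\<bar>"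
      using sum_squares_bound[of "\<bar>a\<bar>" "\<bar>b\<bar>"] by (simp_all add: mult.assoc)
    moreover have "norm (a\<^sup>2 + b\<^sup>2) = a\<^sup>2 + b\<^sup>2" by simp
    ultimately show ?thesis unfolding norm_mult real_norm_def by linarith
  qed
  show "AE \<omega> in M. norm (S \<omega> * R \<omega>) \<le> norm ((S \<omega>)\<^sup>2 + (R \<omega>)\<^sup>2)"
    by (intro AE_I2) (rule *)
qed

lemma lin_cov_sum:
  assumes "\<And>i. i \<in> J \<Longrightarrow> S i \<in> lin" "R \<in> lin"
  shows "(LINT \<omega>|M. (\<Sum>i\<in>J. a i * S i \<omega>) * R \<omega>) = (\<Sum>i\<in>J. a i * (LINT \<omega>|M. S i \<omega> * R \<omega>))"
proof -
  have "(LINT \<omega>|M. (\<Sum>i\<in>J. a i * S i \<omega>) * R \<omega>) = (LINT \<omega>|M. (\<Sum>i\<in>J. a i * (S i \<omega> * R \<omega>)))"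
    by (simp add: sum_distrib_right mult.assoc)
  also have "\<dots> = (\<Sum>i\<in>J. LINT \<omega>|M. a i * (S i \<omega> * R \<omega>))"
  proof (rule Bochner_Integration.integral_sum)
    fix i assume "i \<in> J"
    then have "integrable M (\<lambda>\<omega>. S i \<omega> * R \<omega>)" using assms by (intro lin_mult_integrable)
    then show "integrable M (\<lambda>\<omega>. a i * (S i \<omega> * R \<omega>))" by (rule integrable_mult_right)
  qed
  finally show ?thesis by (simp only: integral_mult_right_zero)
qed

lemma lin_cov_diff:
  assumes "S \<in> lin" "S' \<in> lin" "R \<in> lin"
  shows "(LINT \<omega>|M. (S \<omega> - S' \<omega>) * R \<omega>) = (LINT \<omega>|M. S \<omega> * R \<omega>) - (LINT \<omega>|M. S' \<omega> * R \<omega>)"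
  unfolding left_diff_distrib
  by (rule Bochner_Integration.integral_diff) (rule lin_mult_integrable assms)+

lemma lin_square_add:
  assumes "S \<in> lin" "R \<in> lin"
  shows "(LINT \<omega>|M. (S \<omega> + R \<omega>)\<^sup>2)
    = (LINT \<omega>|M. (S \<omega>)\<^sup>2) + 2 * (LINT \<omega>|M. S \<omega> * R \<omega>) + (LINT \<omega>|M. (R \<omega>)\<^sup>2)"
proof -
  have "(LINT \<omega>|M. (S \<omega> + R \<omega>)\<^sup>2) = (LINT \<omega>|M. (S \<omega>)\<^sup>2 + 2 * (S \<omega> * R \<omega>) + (R \<omega>)\<^sup>2)"
    by (intro Bochner_Integration.integral_cong) (auto simp: power2_eq_square algebra_simps)
  then show ?thesis
    using lin_mult_integrable[OF assms] lin_law(1)[OF assms(1)] lin_law(1)[OF assms(2)] by simp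
qed

lemma lin_square_sum:
  assumes "\<And>i. i \<in> J \<Longrightarrow> S i \<in> lin"
  shows "(LINT \<omega>|M. (\<Sum>i\<in>J. a i * S i \<omega>)\<^sup>2)
    = (\<Sum>i\<in>J. \<Sum>j\<in>J. a i * a j * (LINT \<omega>|M. S i \<omega> * S j \<omega>))"
proof -
  have "(LINT \<omega>|M. (\<Sum>i\<in>J. a i * S i \<omega>)\<^sup>2)
      = (LINT \<omega>|M. (\<Sum>i\<in>J. a i * S i \<omega>) * (\<Sum>j\<in>J. a j * S j \<omega>))"
    by (simp add: power2_eq_square)
  also have "\<dots> = (\<Sum>i\<in>J. a i * (LINT \<omega>|M. S i \<omega> * (\<Sum>j\<in>J. a j * S j \<omega>)))"
    by (rule lin_cov_sum[OF assms lin_span_sum[OF lin_span_scale[OF assms]]])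
  also have "\<dots> = (\<Sum>i\<in>J. \<Sum>j\<in>J. a i * a j * (LINT \<omega>|M. S i \<omega> * S j \<omega>))"
  proof (intro sum.cong refl)
    fix i assume "i \<in> J"
    then have "(LINT \<omega>|M. (\<Sum>j\<in>J. a j * S j \<omega>) * S i \<omega>) = (\<Sum>j\<in>J. a j * (LINT \<omega>|M. S j \<omega> * S i \<omega>))"
      by (intro lin_cov_sum[OF assms assms])
    moreover have "(LINT \<omega>|M. S i \<omega> * (\<Sum>j\<in>J. a j * S j \<omega>)) = (LINT \<omega>|M. (\<Sum>j\<in>J. a j * S j \<omega>) * S i \<omega>)"
      "(LINT \<omega>|M. S j \<omega> * S i \<omega>) = (LINT \<omega>|M. S i \<omega> * S j \<omega>)" for j
      by (simp_all only: mult.commute)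
    ultimately show "a i * (LINT \<omega>|M. S i \<omega> * (\<Sum>j\<in>J. a j * S j \<omega>))
        = (\<Sum>j\<in>J. a i * a j * (LINT \<omega>|M. S i \<omega> * S j \<omega>))"
      by (simp only: sum_distrib_left mult.assoc)
  qed
  finally show ?thesis .
qed

end

section \<open>Full conditionals and innovations\<close>

context centered_gaussian
begin

lemma sigma_except_subalgebra: "subalgebra M (sigma_except M X s)"
proof -
  have "(\<lambda>\<omega>. \<lambda>t\<in>UNIV - {s}. X t \<omega>) \<in> M \<rightarrow>\<^sub>M (\<Pi>\<^sub>M t\<in>UNIV - {s}. borel)"
    by (intro measurable_restrict) simp
  then have "sets (sigma_except M X s) \<subseteq> sets M"
    unfolding sigma_except_def
    by (subst sets_vimage_algebra2) (auto simp: space_PiM dest: measurable_sets)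
  then show ?thesis by (simp add: subalgebra_def sigma_except_def)
qed

lemma sigma_except_component:
  assumes "t \<noteq> s"
  shows "X t \<in> borel_measurable (sigma_except M X s)"
proof -
  have "(\<lambda>\<omega>. \<lambda>t\<in>UNIV - {s}. X t \<omega>) \<in> sigma_except M X s \<rightarrow>\<^sub>M (\<Pi>\<^sub>M t\<in>UNIV - {s}. borel)"
    unfolding sigma_except_def by (rule measurable_vimage_algebra1) (auto simp: space_PiM)
  from measurable_compose[OF this measurable_component_singleton[of t]] assms
  show ?thesis by simp
qed

lemma lin_sigma_except: "S \<in> lin_span X (- {s}) \<Longrightarrow> S \<in> borel_measurable (sigma_except M X s)"
  unfolding lin_span_def
  by (auto intro!: borel_measurable_sum borel_measurable_times sigma_except_component)

end

text \<open>The situation at a single site. That the mean is a finite combination of the other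
  variables makes it both measurable for the conditioning sigma-algebra and jointly Gaussian with
  the field.\<close>

locale full_conditional = centered_gaussian +
  fixes s :: site and m :: "'a \<Rightarrow> real" and \<kappa> :: real
  assumes full_cond: "full_conditional_normal M X s m \<kappa>" and kappa_pos: "0 < \<kappa>"
    and m_lin: "m \<in> lin_span X (- {s})"
begin

abbreviation "F \<equiv> sigma_except M X s"
abbreviation "N0 \<equiv> normal_law 0 (1 / sqrt \<kappa>)"

lemma m_lin': "m \<in> lin" using m_lin lin_span_mono[of "- {s}" UNIV] by auto

lemma m_meas[measurable]: "m \<in> borel_measurable M" by (rule lin_measurable[OF m_lin'])

lemma F_measurable_M: "f \<in> borel_measurable F \<Longrightarrow> f \<in> borel_measurable M"
  by (rule measurable_from_subalg[OF sigma_except_subalgebra])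

text \<open>Rewrites the random conditional law over one fixed measure, so that the sample point
  occurs only in the integrand and Fubini becomes applicable.\<close>

lemma conditional_law_shift:
  assumes [measurable]: "A \<in> sets borel"
  shows "measure (density lborel (normal_density (m \<omega>) (1 / sqrt \<kappa>))) A
    = (LINT x|N0. indicator A (m \<omega> + x))"
proof -
  have v: "0 \<le> 1 / sqrt \<kappa>" "1 / sqrt \<kappa> \<noteq> 0" using kappa_pos by auto
  have "density lborel (normal_density (m \<omega>) (1 / sqrt \<kappa>)) = normal_law (m \<omega>) (1 / sqrt \<kappa>)"
    using v by (simp add: normal_law_def)
  also have "\<dots> = distr N0 borel (\<lambda>x. m \<omega> + x)"
    unfolding normal_law_eq_distr[OF v(1)] by (subst distr_distr) (auto simp: comp_def)
  finally have "measure (density lborel (normal_density (m \<omega>) (1 / sqrt \<kappa>))) A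
      = (LINT x|distr N0 borel (\<lambda>x. m \<omega> + x). indicator A x)" by simp
  also have "\<dots> = (LINT x|N0. indicator A (m \<omega> + x))" by (subst integral_distr) auto
  finally show ?thesis .
qed

text \<open>For a fixed weight \<open>G\<close> both sides are integrals of \<open>f\<close> against
  finite measures on the line, \<open>\<nu>1\<close> and \<open>\<nu>2\<close>. The hypothesis on
  conditional probabilities says that these agree on Borel sets, hence they are equal; no
  approximation of \<open>f\<close> by simple functions is made.\<close>

lemma weighted_conditional_law:
  assumes G: "G \<in> borel_measurable F" and G0: "\<And>\<omega>. 0 \<le> G \<omega>" and GB: "\<And>\<omega>. G \<omega> \<le> (B::real)"
    and f[measurable]: "f \<in> borel_measurable borel" and fB: "\<And>x. \<bar>f x\<bar> \<le> (C::real)"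
  shows "(LINT \<omega>|M. G \<omega> * f (X s \<omega>)) = (LINT \<omega>|M. G \<omega> * (LINT x|N0. f (m \<omega> + x)))"
proof -
  interpret N0: prob_space N0 using kappa_pos by (intro prob_space_normal_law) auto
  interpret pp: pair_prob_space M N0 ..
  interpret S: sigma_finite_subalgebra M F
    using sigma_except_subalgebra finite_measure_axioms
    by (intro finite_measure_subalgebra_is_sigma_finite)
       (auto simp: finite_measure_subalgebra_def finite_measure_subalgebra_axioms_def)
  note [measurable] = F_measurable_M[OF G]
  define \<nu>1 where "\<nu>1 = distr (density M G) borel (X s)"
  define \<nu>2 where "\<nu>2 = distr (density (M \<Otimes>\<^sub>M N0) (\<lambda>p. G (fst p))) borel (\<lambda>(\<omega>, x). m \<omega> + x)"
  have B: "0 \<le> B" using G0 GB by (meson order_trans)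
  have expand: "(LINT x|\<nu>1. g x) = (LINT \<omega>|M. G \<omega> * g (X s \<omega>))"
    "(LINT x|\<nu>2. g x) = (LINT \<omega>|M. G \<omega> * (LINT x|N0. g (m \<omega> + x)))"
    if [measurable]: "g \<in> borel_measurable borel" and gB: "\<And>x. \<bar>g x\<bar> \<le> (C::real)" for g C
  proof -
    have C: "0 \<le> C" using gB by (meson abs_ge_zero order_trans)
    show "(LINT x|\<nu>1. g x) = (LINT \<omega>|M. G \<omega> * g (X s \<omega>))"
      unfolding \<nu>1_def using G0 by (subst integral_distr, simp, simp, subst integral_density) auto
    have "(LINT x|\<nu>2. g x) = (LINT p|(M \<Otimes>\<^sub>M N0). (case p of (\<omega>, x) \<Rightarrow> G \<omega> * g (m \<omega> + x)))"
      unfolding \<nu>2_def using G0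
      by (subst integral_distr, simp, simp, subst integral_density) (auto simp: split_beta')
    also have "\<dots> = (LINT \<omega>|M. LINT x|N0. G \<omega> * g (m \<omega> + x))"
    proof -
      have "\<bar>G a * g b\<bar> \<le> B * C" for a b
        using G0[of a] GB[of a] gB[of b] B by (simp add: abs_mult mult_mono)
      then have "integrable (M \<Otimes>\<^sub>M N0) (\<lambda>(\<omega>, x). G \<omega> * g (m \<omega> + x))"
        by (intro pp.P.integrable_const_bound[where B = "B * C"]) auto
      from pp.integral_fst'[OF this] show ?thesis by simp
    qed
    finally show "(LINT x|\<nu>2. g x) = (LINT \<omega>|M. G \<omega> * (LINT x|N0. g (m \<omega> + x)))" by simp
  qed
  have iG: "integrable M G" using G0 GB by (intro integrable_const_bound[where B = B]) auto
  have fin1: "finite_measure \<nu>1"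
  proof -
    have "(\<integral>\<^sup>+\<omega>. ennreal (G \<omega>) \<partial>M) < \<infinity>" using iG G0 by (simp add: nn_integral_eq_integral)
    then have "finite_measure (density M G)"
      by (intro finite_measureI) (simp add: emeasure_density cong: nn_integral_cong_simp)
    then show ?thesis unfolding \<nu>1_def by (rule finite_measure.finite_measure_distr) simp
  qed
  have fin2: "finite_measure \<nu>2"
  proof -
    have "(\<integral>\<^sup>+p. ennreal (G (fst p)) \<partial>(M \<Otimes>\<^sub>M N0)) \<le> (\<integral>\<^sup>+p. ennreal B \<partial>(M \<Otimes>\<^sub>M N0))"
      using GB by (intro nn_integral_mono) (auto intro!: ennreal_leI)
    also have "\<dots> < \<infinity>" by (simp add: pp.P.emeasure_space_1)
    finally have *: "(\<integral>\<^sup>+p. ennreal (G (fst p)) \<partial>(M \<Otimes>\<^sub>M N0)) < \<infinity>" .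
    have "emeasure (density (M \<Otimes>\<^sub>M N0) (\<lambda>p. G (fst p))) (space (M \<Otimes>\<^sub>M N0))
        = (\<integral>\<^sup>+p. ennreal (G (fst p)) \<partial>(M \<Otimes>\<^sub>M N0))"
      by (subst emeasure_density[OF _ sets.top]) (auto intro!: nn_integral_cong)
    with * have "finite_measure (density (M \<Otimes>\<^sub>M N0) (\<lambda>p. G (fst p)))"
      by (intro finite_measureI) auto
    then show ?thesis unfolding \<nu>2_def by (rule finite_measure.finite_measure_distr) simp
  qed
  have "\<nu>1 = \<nu>2"
  proof (rule measure_eqI)
    show "sets \<nu>1 = sets \<nu>2" by (simp add: \<nu>1_def \<nu>2_def)
    fix A assume "A \<in> sets \<nu>1"
    then have A[measurable]: "A \<in> sets borel" by (simp add: \<nu>1_def)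
    have ind: "(indicator A :: real \<Rightarrow> real) \<in> borel_measurable borel" "\<And>x. \<bar>indicator A x :: real\<bar> \<le> 1"
      by (auto simp: indicator_def)
    have "integrable M (\<lambda>\<omega>. G \<omega> * indicator A (X s \<omega>))"
      using G0 GB B by (intro integrable_const_bound[where B = B]) (auto simp: indicator_def)
    then have "(LINT \<omega>|M. G \<omega> * indicator A (X s \<omega>))
        = (LINT \<omega>|M. G \<omega> * real_cond_exp M F (\<lambda>\<omega>. indicator A (X s \<omega>)) \<omega>)"
      by (intro S.real_cond_exp_intg(2)[symmetric]) (auto intro: G)
    also have "\<dots> = (LINT \<omega>|M. G \<omega> * (LINT x|N0. indicator A (m \<omega> + x)))"
    proof (rule integral_cong_AE)
      show "(\<lambda>\<omega>. G \<omega> * real_cond_exp M F (\<lambda>\<omega>. indicator A (X s \<omega>)) \<omega>) \<in> borel_measurable M"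
        by (intro borel_measurable_times) auto
      show "AE \<omega> in M. G \<omega> * real_cond_exp M F (\<lambda>\<omega>. indicator A (X s \<omega>)) \<omega>
          = G \<omega> * (LINT x|N0. indicator A (m \<omega> + x))"
        using full_cond[unfolded full_conditional_normal_def, rule_format, OF A]
        unfolding conditional_law_shift[OF A] by (rule AE_mp) (intro AE_I2, simp)
    qed measurable
    finally have "(LINT x|\<nu>1. indicator A x) = (LINT x|\<nu>2. indicator A x :: real)"
      using expand[OF ind] by simp
    then have "measure \<nu>1 A = measure \<nu>2 A" by (simp add: \<nu>1_def \<nu>2_def)
    then show "emeasure \<nu>1 A = emeasure \<nu>2 A"
      using fin1 fin2 by (simp add: finite_measure.emeasure_eq_measure)
  qed
  then show ?thesis using expand[OF f fB] by simp
qed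

text \<open>A signed weight is the difference of the nonnegative weights 1 + \<open>G\<close> and
  1.\<close>

lemma bounded_conditional_law:
  assumes G: "G \<in> borel_measurable F" and GB: "\<And>\<omega>. \<bar>G \<omega>\<bar> \<le> (1::real)"
    and f[measurable]: "f \<in> borel_measurable borel" and fB: "\<And>x. \<bar>f x\<bar> \<le> (1::real)"
  shows "(LINT \<omega>|M. G \<omega> * f (X s \<omega>)) = (LINT \<omega>|M. G \<omega> * (LINT x|N0. f (m \<omega> + x)))"
proof -
  interpret N0: prob_space N0 using kappa_pos by (intro prob_space_normal_law) auto
  note [measurable] = F_measurable_M[OF G]
  have G01: "0 \<le> 1 + G \<omega>" "1 + G \<omega> \<le> 2" for \<omega> using GB[of \<omega>] by (simp_all add: abs_le_iff)
  have h: "\<bar>LINT x|N0. f (m \<omega> + x)\<bar> \<le> 1" for \<omega>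
  proof -
    have "\<bar>LINT x|N0. f (m \<omega> + x)\<bar> \<le> (LINT x|N0. \<bar>f (m \<omega> + x)\<bar>)" by (rule integral_abs_bound)
    also have "\<dots> \<le> (LINT x|N0. 1)"
      using fB by (intro integral_mono N0.integrable_const_bound[where B = 1]) auto
    finally show ?thesis using N0.prob_space by simp
  qed
  have mult1: "\<bar>a * b\<bar> \<le> 1" if "\<bar>a\<bar> \<le> 1" "\<bar>b\<bar> \<le> 1" for a b :: real
    using mult_mono[OF that] by (simp add: abs_mult)
  have [measurable]: "(\<lambda>\<omega>. LINT x|N0. f (m \<omega> + x)) \<in> borel_measurable M"
    by (rule N0.borel_measurable_lebesgue_integral) measurable
  have i: "integrable M (\<lambda>\<omega>. G \<omega> * f (X s \<omega>))" "integrable M (\<lambda>\<omega>. f (X s \<omega>))"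
    "integrable M (\<lambda>\<omega>. G \<omega> * (LINT x|N0. f (m \<omega> + x)))" "integrable M (\<lambda>\<omega>. LINT x|N0. f (m \<omega> + x))"
    by (rule integrable_const_bound[where B = 1]; use GB fB h mult1 in auto)+
  have "(LINT \<omega>|M. (1 + G \<omega>) * f (X s \<omega>)) = (LINT \<omega>|M. (1 + G \<omega>) * (LINT x|N0. f (m \<omega> + x)))"
    by (rule weighted_conditional_law[OF _ G01 f fB]) (use G in measurable)
  moreover have "(LINT \<omega>|M. 1 * f (X s \<omega>)) = (LINT \<omega>|M. 1 * (LINT x|N0. f (m \<omega> + x)))"
    by (rule weighted_conditional_law[OF _ _ _ f fB, where B = 1]) auto
  ultimately show ?thesis using i by (simp add: distrib_right)
qed

text \<open>The real part of the statement that the innovation is independent of the other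
  variables. \<open>\<Theta>\<close> collects what is measurable for them; conditionally the rest is
  a shifted centred normal, whose sine integral vanishes by symmetry and whose cosine integral is
  the factor \<open>e\<close>.\<close>

lemma innovation_cos:
  assumes "R \<in> lin_span X (- {s})"
  shows "(LINT \<omega>|M. cos (u * (X s \<omega> - m \<omega>) + R \<omega>)) = exp (- (u\<^sup>2 / \<kappa> / 2)) * (LINT \<omega>|M. cos (R \<omega>))"
proof -
  interpret N0: prob_space N0 using kappa_pos by (intro prob_space_normal_law) auto
  define \<Theta> where "\<Theta> = (\<lambda>\<omega>. R \<omega> - u * m \<omega>)"
  have F[measurable]: "\<Theta> \<in> borel_measurable F"
    unfolding \<Theta>_def using assms m_lin by (intro lin_sigma_except lin_span_intros)
  have "\<Theta> \<in> borel_measurable M" by (rule F_measurable_M) measurable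
  note [measurable] = this
  define e where "e = exp (- (u\<^sup>2 / \<kappa> / 2))"
  have kv: "0 \<le> 1 / sqrt \<kappa>" "(1 / sqrt \<kappa>)\<^sup>2 = 1 / \<kappa>" using kappa_pos by (auto simp: power_divide)
  have i: "integrable N0 (\<lambda>x. cos (u * x))" "integrable N0 (\<lambda>x. sin (u * x))"
    by (rule N0.integrable_const_bound[where B = 1]; auto)+
  have c: "(LINT x|N0. cos (u * (a + x))) = cos (u * a) * e"
    and d: "(LINT x|N0. sin (u * (a + x))) = sin (u * a) * e" for a
    using i by (simp_all add: distrib_left cos_add sin_add normal_law_cos_sin[OF kv(1)] kv(2) e_def)
  have mult1: "\<bar>a * b\<bar> \<le> 1" if "\<bar>a\<bar> \<le> 1" "\<bar>b\<bar> \<le> 1" for a b :: real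
    using mult_mono[OF that] by (simp add: abs_mult)
  have e1: "\<bar>e\<bar> \<le> 1" using kappa_pos by (simp add: e_def)
  have j: "integrable M (\<lambda>\<omega>. cos (\<Theta> \<omega>) * cos (u * X s \<omega>))" "integrable M (\<lambda>\<omega>. sin (\<Theta> \<omega>) * sin (u * X s \<omega>))"
    "integrable M (\<lambda>\<omega>. cos (\<Theta> \<omega>) * (cos (u * m \<omega>) * e))" "integrable M (\<lambda>\<omega>. sin (\<Theta> \<omega>) * (sin (u * m \<omega>) * e))"
    by (rule integrable_const_bound[where B = 1]; use e1 mult1 in auto)+
  have "(LINT \<omega>|M. cos (u * (X s \<omega> - m \<omega>) + R \<omega>)) = (LINT \<omega>|M. cos (\<Theta> \<omega>) * cos (u * X s \<omega>) - sin (\<Theta> \<omega>) * sin (u * X s \<omega>))"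
  proof (intro Bochner_Integration.integral_cong refl)
    fix \<omega>
    have "u * (X s \<omega> - m \<omega>) + R \<omega> = \<Theta> \<omega> + u * X s \<omega>" by (simp add: \<Theta>_def algebra_simps)
    then show "cos (u * (X s \<omega> - m \<omega>) + R \<omega>) = cos (\<Theta> \<omega>) * cos (u * X s \<omega>) - sin (\<Theta> \<omega>) * sin (u * X s \<omega>)"
      by (simp add: cos_add)
  qed
  also have "\<dots> = (LINT \<omega>|M. cos (\<Theta> \<omega>) * cos (u * X s \<omega>)) - (LINT \<omega>|M. sin (\<Theta> \<omega>) * sin (u * X s \<omega>))"
    using j by simp
  also have "(LINT \<omega>|M. cos (\<Theta> \<omega>) * cos (u * X s \<omega>)) = (LINT \<omega>|M. cos (\<Theta> \<omega>) * (LINT x|N0. cos (u * (m \<omega> + x))))"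
    by (rule bounded_conditional_law[where G = "\<lambda>\<omega>. cos (\<Theta> \<omega>)" and f = "\<lambda>x. cos (u * x)"]) auto
  also have "(LINT \<omega>|M. sin (\<Theta> \<omega>) * sin (u * X s \<omega>)) = (LINT \<omega>|M. sin (\<Theta> \<omega>) * (LINT x|N0. sin (u * (m \<omega> + x))))"
    by (rule bounded_conditional_law[where G = "\<lambda>\<omega>. sin (\<Theta> \<omega>)" and f = "\<lambda>x. sin (u * x)"]) auto
  also have "(LINT \<omega>|M. cos (\<Theta> \<omega>) * (LINT x|N0. cos (u * (m \<omega> + x))))
      - (LINT \<omega>|M. sin (\<Theta> \<omega>) * (LINT x|N0. sin (u * (m \<omega> + x))))
      = (LINT \<omega>|M. cos (\<Theta> \<omega>) * (cos (u * m \<omega>) * e) - sin (\<Theta> \<omega>) * (sin (u * m \<omega>) * e))"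
    unfolding c d using j(3,4) by simp
  also have "\<dots> = (LINT \<omega>|M. e * cos (R \<omega>))"
  proof (intro Bochner_Integration.integral_cong refl)
    fix \<omega>
    have "R \<omega> = \<Theta> \<omega> + u * m \<omega>" by (simp add: \<Theta>_def)
    then have "cos (R \<omega>) = cos (\<Theta> \<omega>) * cos (u * m \<omega>) - sin (\<Theta> \<omega>) * sin (u * m \<omega>)"
      by (simp only: cos_add)
    show "cos (\<Theta> \<omega>) * (cos (u * m \<omega>) * e) - sin (\<Theta> \<omega>) * (sin (u * m \<omega>) * e) = e * cos (R \<omega>)"
      unfolding \<open>cos (R \<omega>) = _\<close> by (simp add: algebra_simps)
  qed
  finally show ?thesis by (simp add: e_def)
qed

lemma innovation_lin: "(\<lambda>\<omega>. X s \<omega> - m \<omega>) \<in> lin"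
  by (intro lin_span_intros m_lin') simp

text \<open>Both sides of \<open>innovation_cos\<close> are exponentials of variances, so
  injectivity of the exponential gives an identity of second moments. Conditional expectations of
  unbounded functions are thereby avoided: the variance comes from R = 0, and then the covariance
  with any \<open>R\<close> must vanish.\<close>

lemma innovation_square:
  assumes R: "R \<in> lin_span X (- {s})"
  shows "u\<^sup>2 * (LINT \<omega>|M. (X s \<omega> - m \<omega>)\<^sup>2) + 2 * u * (LINT \<omega>|M. (X s \<omega> - m \<omega>) * R \<omega>) = u\<^sup>2 / \<kappa>"
proof -
  have R': "R \<in> lin" using R lin_span_mono[of "- {s}" UNIV] by auto
  let ?E = "LINT \<omega>|M. (u * (X s \<omega> - m \<omega>) + R \<omega>)\<^sup>2"
  have l: "(\<lambda>\<omega>. u * (X s \<omega> - m \<omega>)) \<in> lin" by (rule lin_span_scale[OF innovation_lin])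
  have "exp (- (?E / 2)) = exp (- (u\<^sup>2 / \<kappa> / 2)) * exp (- ((LINT \<omega>|M. (R \<omega>)\<^sup>2) / 2))"
    using innovation_cos[OF R, of u] lin_cos[OF lin_span_add[OF l R']] lin_cos[OF R'] by simp
  also have "\<dots> = exp (- (u\<^sup>2 / \<kappa> / 2) + - ((LINT \<omega>|M. (R \<omega>)\<^sup>2) / 2))"
    by (simp only: exp_add)
  finally have "?E = u\<^sup>2 / \<kappa> + (LINT \<omega>|M. (R \<omega>)\<^sup>2)"
    by (simp only: exp_inj_iff) (simp add: field_simps)
  then show ?thesis
    unfolding lin_square_add[OF l R'] by (simp add: power_mult_distrib mult.assoc)
qed

lemma innovation_variance: "(LINT \<omega>|M. (X s \<omega> - m \<omega>)\<^sup>2) = 1 / \<kappa>"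
  using innovation_square[OF lin_span_zero, of 1] by simp

lemma innovation_uncorrelated:
  assumes "R \<in> lin_span X (- {s})"
  shows "(LINT \<omega>|M. (X s \<omega> - m \<omega>) * R \<omega>) = 0"
  using innovation_square[OF assms, of 1] innovation_variance by simp

text \<open>Up to the factor 1 / \<kappa> the innovations are the system biorthogonal to the
  field.\<close>

lemma innovation_cov:
  "(LINT \<omega>|M. (X s \<omega> - m \<omega>) * X t \<omega>) = (if t = s then 1 / \<kappa> else 0)"
proof (cases "t = s")
  case True
  have "(LINT \<omega>|M. X s \<omega> * (X s \<omega> - m \<omega>)) - (LINT \<omega>|M. m \<omega> * (X s \<omega> - m \<omega>)) = 1 / \<kappa>"
    using innovation_variance lin_cov_diff[OF lin_span_base m_lin' innovation_lin]
    by (simp add: power2_eq_square)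
  then show ?thesis
    using innovation_uncorrelated[OF m_lin] True by (simp add: mult.commute)
next
  case False
  then show ?thesis by (auto intro!: innovation_uncorrelated lin_span_base)
qed

end

section \<open>The covariance of the autoregression\<close>

lemma (in prob_space) stationary_cov:
  assumes st: "stationary_field M X" and X: "\<And>s. X s \<in> borel_measurable M"
  shows "(LINT \<omega>|M. X (s + h) \<omega> * X (t + h) \<omega>) = (LINT \<omega>|M. X s \<omega> * X t \<omega> :: real)"
proof -
  note [measurable] = X
  have m: "(\<lambda>\<omega> s. X (s + h) \<omega>) \<in> M \<rightarrow>\<^sub>M (\<Pi>\<^sub>M s\<in>UNIV. borel)" for h
    by (rule measurable_PiM_single') auto
  have m0: "(\<lambda>\<omega> s. X s \<omega>) \<in> M \<rightarrow>\<^sub>M (\<Pi>\<^sub>M s\<in>UNIV. borel)"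
    by (rule measurable_PiM_single') auto
  have p: "(\<lambda>y. y s * y t) \<in> borel_measurable (\<Pi>\<^sub>M s\<in>(UNIV::site set). (borel :: real measure))"
    by measurable
  have "(LINT \<omega>|M. X (s + h) \<omega> * X (t + h) \<omega>)
      = (LINT y|distr M (\<Pi>\<^sub>M s\<in>UNIV. borel) (\<lambda>\<omega> s. X (s + h) \<omega>). y s * y t)"
    by (rule integral_distr[OF m p, symmetric])
  also have "\<dots> = (LINT y|distr M (\<Pi>\<^sub>M s\<in>UNIV. borel) (\<lambda>\<omega> s. X s \<omega>). y s * y t)"
    by (simp only: st[unfolded stationary_field_def, THEN spec, of h])
  also have "\<dots> = (LINT \<omega>|M. X s \<omega> * X t \<omega>)"
    by (rule integral_distr[OF m0 p])
  finally show ?thesis .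
qed

text \<open>The strict bound on \<zeta> makes 4 \<zeta> a contraction factor for the neighbour sum
  and keeps the symbol away from zero.\<close>

locale sfar = centered_gaussian +
  fixes \<zeta> \<kappa> :: real
  assumes stationary: "stationary_field M X"
    and zeta_nonneg: "0 \<le> \<zeta>" and zeta_less: "\<zeta> < 1 / 4" and kappa_pos: "0 < \<kappa>"
    and full_conditionals: "\<And>i j. full_conditional_normal M X (i, j)
      (\<lambda>\<omega>. \<zeta> * (X (i + 1, j) \<omega> + X (i - 1, j) \<omega> + X (i, j + 1) \<omega> + X (i, j - 1) \<omega>)) \<kappa>"
begin

definition innov :: "site \<Rightarrow> 'a \<Rightarrow> real" where
  "innov s \<omega> = X s \<omega> - \<zeta> * (X (s + (1, 0)) \<omega> + X (s + (- 1, 0)) \<omega> + X (s + (0, 1)) \<omega> + X (s + (0, - 1)) \<omega>)"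

definition gam :: "site \<Rightarrow> real" where
  "gam t = (LINT \<omega>|M. X (0, 0) \<omega> * X t \<omega>)"

lemma X_lin: "X s \<in> lin"
  by (rule lin_span_base) simp

lemma innov_full_conditional:
  obtains m where "full_conditional M X s m \<kappa>" "innov s = (\<lambda>\<omega>. X s \<omega> - m \<omega>)"
proof -
  obtain i j where s: "s = (i, j)" by (cases s)
  define m where "m = (\<lambda>\<omega>. \<zeta> * (X (i + 1, j) \<omega> + X (i - 1, j) \<omega> + X (i, j + 1) \<omega> + X (i, j - 1) \<omega>))"
  have "(\<lambda>\<omega>. X (i + 1, j) \<omega> + X (i - 1, j) \<omega> + X (i, j + 1) \<omega> + X (i, j - 1) \<omega>) \<in> lin_span X (- {s})"
    by (intro lin_span_add lin_span_base) (simp_all add: s)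
  then have "m \<in> lin_span X (- {s})" unfolding m_def by (rule lin_span_scale)
  then have "full_conditional M X s m \<kappa>"
    using full_conditionals[of i j] kappa_pos unfolding m_def s
    by unfold_locales
  moreover have "innov s = (\<lambda>\<omega>. X s \<omega> - m \<omega>)"
    by (rule ext) (simp add: innov_def m_def s)
  ultimately show thesis by (rule that)
qed

lemma innov_lin: "innov s \<in> lin"
proof -
  obtain m where "full_conditional M X s m \<kappa>" and m: "innov s = (\<lambda>\<omega>. X s \<omega> - m \<omega>)"
    by (rule innov_full_conditional)
  then interpret full_conditional M X s m \<kappa> by simp
  show ?thesis unfolding m by (rule innovation_lin)
qed

lemma innov_cov: "(LINT \<omega>|M. innov s \<omega> * X t \<omega>) = (if t = s then 1 / \<kappa> else 0)"
proof -
  obtain m where "full_conditional M X s m \<kappa>" and m: "innov s = (\<lambda>\<omega>. X s \<omega> - m \<omega>)"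
    by (rule innov_full_conditional)
  then interpret full_conditional M X s m \<kappa> by simp
  show ?thesis unfolding m by (rule innovation_cov)
qed

lemma innov_mult:
  assumes "R \<in> lin"
  shows "(LINT \<omega>|M. innov s \<omega> * R \<omega>) = (LINT \<omega>|M. X s \<omega> * R \<omega>)
    - \<zeta> * ((LINT \<omega>|M. X (s + (1, 0)) \<omega> * R \<omega>) + (LINT \<omega>|M. X (s + (- 1, 0)) \<omega> * R \<omega>)
        + (LINT \<omega>|M. X (s + (0, 1)) \<omega> * R \<omega>) + (LINT \<omega>|M. X (s + (0, - 1)) \<omega> * R \<omega>))"
proof -
  note i = lin_mult_integrable[OF X_lin assms]
  have "(\<lambda>\<omega>. innov s \<omega> * R \<omega>) = (\<lambda>\<omega>. X s \<omega> * R \<omega>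
      - \<zeta> * (X (s + (1, 0)) \<omega> * R \<omega> + X (s + (- 1, 0)) \<omega> * R \<omega> + X (s + (0, 1)) \<omega> * R \<omega> + X (s + (0, - 1)) \<omega> * R \<omega>))"
    by (rule ext) (simp add: innov_def algebra_simps)
  then show ?thesis
    by (simp only: Bochner_Integration.integral_diff Bochner_Integration.integral_add
        Bochner_Integration.integrable_add integrable_mult_right integral_mult_right_zero i)
qed

text \<open>Unlike those of a causal autoregression, these innovations are correlated with their
  neighbours: their covariance matrix is 1 - \<zeta> N divided by \<kappa>. This is what the sine
  basis diagonalizes on a rectangle.\<close>

lemma innov_innov_cov:
  "(LINT \<omega>|M. innov s \<omega> * innov t \<omega>)
    = ((if s = t then 1 else 0) - \<zeta> * ((if t + (1, 0) = s then 1 else 0) + (if t + (- 1, 0) = s then 1 else 0)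
        + (if t + (0, 1) = s then 1 else 0) + (if t + (0, - 1) = s then 1 else 0))) / \<kappa>"
proof -
  have "(LINT \<omega>|M. innov s \<omega> * innov t \<omega>) = (LINT \<omega>|M. innov t \<omega> * innov s \<omega>)"
    by (simp only: mult.commute)
  also have "\<dots> = (LINT \<omega>|M. X t \<omega> * innov s \<omega>)
    - \<zeta> * ((LINT \<omega>|M. X (t + (1, 0)) \<omega> * innov s \<omega>) + (LINT \<omega>|M. X (t + (- 1, 0)) \<omega> * innov s \<omega>)
        + (LINT \<omega>|M. X (t + (0, 1)) \<omega> * innov s \<omega>) + (LINT \<omega>|M. X (t + (0, - 1)) \<omega> * innov s \<omega>))"
    by (rule innov_mult[OF innov_lin])
  finally have "(LINT \<omega>|M. innov s \<omega> * innov t \<omega>) = \<dots>" .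
  moreover have "(LINT \<omega>|M. X r \<omega> * innov s \<omega>) = (if r = s then 1 else 0) / \<kappa>" for r
    using innov_cov[of s r] by (simp add: mult.commute)
  ultimately show ?thesis by (simp only: diff_divide_distrib add_divide_distrib times_divide_eq_right[symmetric])
      (simp add: eq_commute)
qed

lemma cov_eq_gam: "(LINT \<omega>|M. X s \<omega> * X t \<omega>) = gam (t - s)"
  using stationary_cov[OF stationary X_measurable, of "(0, 0)" s "t - s"]
  unfolding gam_def by (simp add: zero_prod_def[symmetric])

lemma gam_nonneg: "0 \<le> gam (0, 0)"
  unfolding gam_def by (auto intro!: integral_nonneg_AE)

lemma variance_eq_gam: "(LINT \<omega>|M. (X s \<omega>)\<^sup>2) = gam (0, 0)"
  using cov_eq_gam[of s s] by (simp add: power2_eq_square zero_prod_def)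

text \<open>By stationarity both variances are equal, so nonnegativity of the second moments of the
  sum and the difference is all that Cauchy-Schwarz requires.\<close>

lemma gam_abs_le: "\<bar>gam t\<bar> \<le> gam (0, 0)"
proof -
  have "0 \<le> (LINT \<omega>|M. (X (0, 0) \<omega> + a * X t \<omega>)\<^sup>2)" for a
    by (intro integral_nonneg_AE) simp
  moreover have "(LINT \<omega>|M. (X (0, 0) \<omega> + a * X t \<omega>)\<^sup>2) = gam (0, 0) + 2 * (a * gam t) + a\<^sup>2 * gam (0, 0)" for a
    using lin_square_add[OF X_lin lin_span_scale[OF X_lin], of "(0, 0)" a t]
    by (simp add: variance_eq_gam gam_def[of t, symmetric] power_mult_distrib mult.left_commute)
  ultimately have "0 \<le> gam (0, 0) + 2 * (a * gam t) + a\<^sup>2 * gam (0, 0)" for a by simp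
  from this[of 1] this[of "- 1"] show ?thesis by (simp add: abs_le_iff)
qed

text \<open>Biorthogonality of the innovation at the origin and the field, read as a difference
  equation: the covariance is a Green's function on the whole lattice.\<close>

lemma gam_recursion:
  "gam t - \<zeta> * (gam (t + (1, 0)) + gam (t + (- 1, 0)) + gam (t + (0, 1)) + gam (t + (0, - 1)))
    = (if t = (0, 0) then 1 / \<kappa> else 0)"
proof -
  have "(LINT \<omega>|M. innov (0, 0) \<omega> * X t \<omega>) = gam t
    - \<zeta> * (gam (t - (1, 0)) + gam (t - (- 1, 0)) + gam (t - (0, 1)) + gam (t - (0, - 1)))"
    unfolding innov_mult[OF X_lin] cov_eq_gam by (simp add: zero_prod_def[symmetric])
  then show ?thesis unfolding innov_cov by (cases t) (simp add: add.commute add.left_commute)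
qed

text \<open>Away from the origin the recursion has no source and bounds a value by 4 \<zeta> times
  the largest neighbouring one. The induction is over every \<open>n\<close> up to the distance from
  the origin, since the neighbours of a site at distance at least n + 1 have distance at least
  n.\<close>

lemma gam_decay: "\<bar>gam (i, j)\<bar> \<le> gam (0, 0) * (4 * \<zeta>) ^ (nat \<bar>i\<bar> + nat \<bar>j\<bar>)"
proof -
  have "\<bar>gam (i, j)\<bar> \<le> gam (0, 0) * (4 * \<zeta>) ^ n" if "n \<le> nat \<bar>i\<bar> + nat \<bar>j\<bar>" for n
    using that
  proof (induction n arbitrary: i j)
    case 0
    then show ?case using gam_abs_le by simp
  next
    case (Suc n)
    have "\<bar>gam (i + 1, j)\<bar> \<le> gam (0, 0) * (4 * \<zeta>) ^ n" "\<bar>gam (i - 1, j)\<bar> \<le> gam (0, 0) * (4 * \<zeta>) ^ n"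
      "\<bar>gam (i, j + 1)\<bar> \<le> gam (0, 0) * (4 * \<zeta>) ^ n" "\<bar>gam (i, j - 1)\<bar> \<le> gam (0, 0) * (4 * \<zeta>) ^ n"
      by (rule Suc.IH; use Suc.prems in arith)+
    then have "\<bar>gam (i + 1, j) + gam (i - 1, j) + gam (i, j + 1) + gam (i, j - 1)\<bar>
        \<le> 4 * (gam (0, 0) * (4 * \<zeta>) ^ n)" by linarith
    moreover have "gam (i, j) = \<zeta> * (gam (i + 1, j) + gam (i - 1, j) + gam (i, j + 1) + gam (i, j - 1))"
      using gam_recursion[of "(i, j)"] Suc.prems by (auto split: if_splits)
    ultimately have "\<bar>gam (i, j)\<bar> \<le> \<zeta> * (4 * (gam (0, 0) * (4 * \<zeta>) ^ n))"
      using zeta_nonneg by (simp add: abs_mult mult_left_mono)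
    then show ?case by (simp add: algebra_simps)
  qed
  then show ?thesis by blast
qed

end

section \<open>Absolute summability of the covariance and the spectral density\<close>

lemma int_geometric_summable:
  assumes "0 \<le> r" "r < (1::real)"
  shows "(\<lambda>i::int. r ^ nat \<bar>i\<bar>) summable_on UNIV"
proof -
  have s: "(\<lambda>n. r ^ n) summable_on (UNIV :: nat set)"
    using assms by (intro norm_summable_imp_summable_on) (simp add: summable_geometric)
  have "(\<lambda>i::int. r ^ nat \<bar>i\<bar>) summable_on range int"
    by (subst summable_on_reindex) (auto simp: comp_def s)
  moreover have "(\<lambda>i::int. r ^ nat \<bar>i\<bar>) summable_on range (\<lambda>n. - int n)"
    by (subst summable_on_reindex) (auto simp: comp_def s inj_on_def)
  ultimately have "(\<lambda>i::int. r ^ nat \<bar>i\<bar>) summable_on (range int \<union> range (\<lambda>n. - int n))"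
    by (rule summable_on_union)
  moreover have "range int \<union> range (\<lambda>n. - int n) = UNIV"
    using int_cases2 by (auto simp: image_iff) metis
  ultimately show ?thesis by simp
qed

lemma site_geometric_summable:
  assumes "0 \<le> r" "r < (1::real)"
  shows "(\<lambda>(i::int, j::int). r ^ (nat \<bar>i\<bar> + nat \<bar>j\<bar>)) summable_on UNIV"
proof -
  obtain g where g: "((\<lambda>i::int. r ^ nat \<bar>i\<bar>) has_sum g) UNIV"
    using int_geometric_summable[OF assms] by (auto simp: summable_on_def)
  have "(\<lambda>(i::int, j::int). r ^ (nat \<bar>i\<bar> + nat \<bar>j\<bar>)) summable_on (SIGMA i:UNIV. UNIV)"
  proof (rule summable_on_SigmaI)
    show "((\<lambda>j. case (i, j) of (i, j) \<Rightarrow> r ^ (nat \<bar>i\<bar> + nat \<bar>j\<bar>)) has_sum r ^ nat \<bar>i\<bar> * g) UNIV" for i :: int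
      using has_sum_cmult_right[OF g, of "r ^ nat \<bar>i\<bar>"] by (simp add: power_add)
    show "(\<lambda>i::int. r ^ nat \<bar>i\<bar> * g) summable_on UNIV"
      by (rule summable_on_cmult_left) (rule int_geometric_summable[OF assms])
  qed (use assms in auto)
  then show ?thesis by simp
qed

text \<open>The Fourier symbol of 1 - \<zeta> N; the spectral density is the reciprocal of
  \<open>4 * pi\<^sup>2 * \<kappa>\<close> times it.\<close>

definition symb :: "real \<Rightarrow> real \<Rightarrow> real \<Rightarrow> real" where
  "symb \<zeta> w1 w2 = 1 - 2 * \<zeta> * cos w1 - 2 * \<zeta> * cos w2"

lemma symb_ge: "0 \<le> \<zeta> \<Longrightarrow> 1 - 4 * \<zeta> \<le> symb \<zeta> w1 w2"
  using mult_left_mono[OF cos_le_one, of "2 * \<zeta>" w1] mult_left_mono[OF cos_le_one, of "2 * \<zeta>" w2]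
  by (simp add: symb_def)

lemma symb_pos: "0 \<le> \<zeta> \<Longrightarrow> \<zeta> < 1 / 4 \<Longrightarrow> 0 < symb \<zeta> w1 w2"
  using symb_ge[of \<zeta> w1 w2] by linarith

context sfar
begin

text \<open>Geometric decay gives absolute convergence. Translating the summation index multiplies
  the sum by a character, so transforming the recursion yields S times the symbol on one side and
  only the source 1 / \<kappa> on the other.\<close>

lemma spectral_series:
  "((\<lambda>(i, j). of_real (gam (i, j)) * exp (- \<i> * of_real (of_int i * w1 + of_int j * w2)))
    has_sum complex_of_real (1 / (\<kappa> * symb \<zeta> w1 w2))) UNIV"
proof -
  define e where "e = (\<lambda>p :: site. exp (- \<i> * of_real (of_int (fst p) * w1 + of_int (snd p) * w2)))"
  have e_add: "e (p + q) = e p * e q" for p q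
    by (simp add: e_def exp_add[symmetric] algebra_simps)
  have ne: "norm (e p) = 1" for p
    by (simp add: e_def del: of_real_add of_real_mult)
  define h where "h = (\<lambda>p. complex_of_real (gam p) * e p)"
  have "(\<lambda>p. norm (h p)) summable_on UNIV"
  proof (rule Infinite_Sum.abs_summable_on_comparison_test')
    show "(\<lambda>p. gam (0, 0) * (case p of (i::int, j::int) \<Rightarrow> (4 * \<zeta>) ^ (nat \<bar>i\<bar> + nat \<bar>j\<bar>))) summable_on UNIV"
      using zeta_nonneg zeta_less by (intro summable_on_cmult_right site_geometric_summable) auto
    show "norm (h p) \<le> gam (0, 0) * (case p of (i, j) \<Rightarrow> (4 * \<zeta>) ^ (nat \<bar>i\<bar> + nat \<bar>j\<bar>))" for p
      using gam_decay by (cases p) (simp add: h_def norm_mult ne)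
  qed
  then obtain S where S: "(h has_sum S) UNIV"
    using Infinite_Sum.abs_summable_summable unfolding summable_on_def by blast
  have shift: "((\<lambda>p. complex_of_real (gam (p + q)) * e p) has_sum S / e q) UNIV" for q
  proof -
    have "((\<lambda>p. h (p + q)) has_sum S) UNIV"
      using has_sum_reindex_bij_betw[of "\<lambda>p. p + q" UNIV UNIV h S] S
      by (simp add: bij_plus_right)
    from has_sum_cmult_right[OF this, of "1 / e q"]
    moreover have "e q \<noteq> 0" by (simp add: e_def)
    ultimately show ?thesis by (simp add: h_def e_add field_simps)
  qed
  have e4: "e (1, 0) = exp (- \<i> * w1)" "e (- 1, 0) = exp (\<i> * w1)" "e (0, 1) = exp (- \<i> * w2)"
    "e (0, - 1) = exp (\<i> * w2)" by (simp_all add: e_def)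
  have inv: "1 / exp (- z) = exp z" "1 / exp z = exp (- z)" for z :: complex
    by (simp_all add: exp_minus field_simps)
  have c2: "exp (\<i> * complex_of_real w) + exp (- (\<i> * complex_of_real w)) = complex_of_real (2 * cos w)" for w
    by (simp add: cos_of_real[symmetric] cos_exp_eq)
  have "((\<lambda>p. complex_of_real (gam (p + 0)) * e p + (- \<zeta>) * (complex_of_real (gam (p + (1, 0))) * e p
      + complex_of_real (gam (p + (- 1, 0))) * e p + complex_of_real (gam (p + (0, 1))) * e p
      + complex_of_real (gam (p + (0, - 1))) * e p))
      has_sum (S / e 0 + (- \<zeta>) * (S / e (1, 0) + S / e (- 1, 0) + S / e (0, 1) + S / e (0, - 1)))) UNIV"
    by (intro has_sum_add has_sum_cmult_right shift)
  also have "(\<lambda>p. complex_of_real (gam (p + 0)) * e p + (- \<zeta>) * (complex_of_real (gam (p + (1, 0))) * e p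
      + complex_of_real (gam (p + (- 1, 0))) * e p + complex_of_real (gam (p + (0, 1))) * e p
      + complex_of_real (gam (p + (0, - 1))) * e p))
      = (\<lambda>p. complex_of_real (if p = (0, 0) then 1 / \<kappa> else 0) * e p)"
    unfolding gam_recursion[symmetric] by (rule ext) (simp add: algebra_simps)
  also have "S / e 0 + (- \<zeta>) * (S / e (1, 0) + S / e (- 1, 0) + S / e (0, 1) + S / e (0, - 1))
      = S * (1 / e 0 - \<zeta> * ((1 / e (- 1, 0) + 1 / e (1, 0)) + (1 / e (0, - 1) + 1 / e (0, 1))))"
    by (simp add: algebra_simps)
  also have "\<dots> = S * complex_of_real (symb \<zeta> w1 w2)"
  proof -
    have a: "1 / e (- 1, 0) + 1 / e (1, 0) = complex_of_real (2 * cos w1)"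
      "1 / e (0, - 1) + 1 / e (0, 1) = complex_of_real (2 * cos w2)"
      unfolding e4 c2[symmetric] by (simp_all add: inv add.commute)
    have b: "e 0 = 1" by (simp add: e_def)
    show ?thesis unfolding a b by (simp add: symb_def algebra_simps)
  qed
  finally have "((\<lambda>p. complex_of_real (if p = (0, 0) then 1 / \<kappa> else 0) * e p)
      has_sum S * complex_of_real (symb \<zeta> w1 w2)) UNIV" .
  moreover have "((\<lambda>p. complex_of_real (if p = (0, 0) then 1 / \<kappa> else 0) * e p)
      has_sum complex_of_real (1 / \<kappa>)) UNIV"
    by (rule has_sum_finite_neutralI[of "{(0, 0)}"]) (auto simp: e_def)
  ultimately have "S * complex_of_real (symb \<zeta> w1 w2) = complex_of_real (1 / \<kappa>)"
    by (rule has_sum_unique)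
  moreover have "symb \<zeta> w1 w2 \<noteq> 0" using symb_pos[OF zeta_nonneg zeta_less, of w1 w2] by simp
  ultimately have "S = complex_of_real (1 / \<kappa>) / complex_of_real (symb \<zeta> w1 w2)"
    by (metis nonzero_mult_div_cancel_right of_real_eq_0_iff)
  then have "S = complex_of_real (1 / (\<kappa> * symb \<zeta> w1 w2))" by simp
  then show ?thesis using S by (simp add: h_def e_def split_beta')
qed

lemma has_spectral_density_sfar:
  "has_spectral_density M X (\<lambda>w1 w2. 1 / (4 * pi\<^sup>2 * \<kappa> * (1 - 2 * \<zeta> * cos w1 - 2 * \<zeta> * cos w2)))"
  unfolding has_spectral_density_def
proof (intro allI)
  fix w1 w2
  from has_sum_cmult_right[OF spectral_series[of w1 w2], of "1 / (4 * of_real pi ^ 2)"]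
  show "((\<lambda>(i, j). 1 / (4 * of_real pi ^ 2) * of_real (\<integral>\<omega>. X (0, 0) \<omega> * X (i, j) \<omega> \<partial>M) *
          exp (- \<i> * of_real (of_int i * w1 + of_int j * w2)))
        has_sum complex_of_real (1 / (4 * pi\<^sup>2 * \<kappa> * (1 - 2 * \<zeta> * cos w1 - 2 * \<zeta> * cos w2)))) UNIV"
    by (simp add: symb_def gam_def[symmetric] split_beta' mult.assoc)
qed

end

section \<open>Averages over the torus\<close>

text \<open>Normalized to mass one, so that the factor \<open>1 / (4 * pi\<^sup>2)\<close> becomes
  part of a product probability measure. The half-open interval is a fundamental domain, which makes
  translations exact.\<close>

definition circ :: "real measure" where
  "circ = density lborel (\<lambda>w. ennreal (indicator {- pi..<pi} w / (2 * pi)))"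

lemma sets_circ[simp, measurable_cong]: "sets circ = sets borel"
  by (simp add: circ_def)

lemma space_circ[simp]: "space circ = UNIV"
  by (simp add: circ_def)

lemma nn_integral_circ:
  assumes [measurable]: "f \<in> borel_measurable borel"
  shows "(\<integral>\<^sup>+w. f w \<partial>circ) = ennreal (1 / (2 * pi)) * (\<integral>\<^sup>+w. f w * indicator {- pi..<pi} w \<partial>lborel)"
proof -
  have "(\<integral>\<^sup>+w. f w \<partial>circ) = (\<integral>\<^sup>+w. ennreal (1 / (2 * pi)) * (f w * indicator {- pi..<pi} w) \<partial>lborel)"
    unfolding circ_def by (subst nn_integral_density) (auto intro!: nn_integral_cong simp: indicator_def)
  then show ?thesis by (simp add: nn_integral_cmult)
qed

lemma integral_circ:
  assumes [measurable]: "f \<in> borel_measurable borel"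
  shows "(LINT w|circ. f w) = 1 / (2 * pi) * (LINT w|lborel. (f w :: real) * indicator {- pi..<pi} w)"
proof -
  have "(LINT w|circ. f w) = (LINT w|lborel. 1 / (2 * pi) * (f w * indicator {- pi..<pi} w))"
    unfolding circ_def
    by (subst integral_density) (auto intro!: Bochner_Integration.integral_cong simp: indicator_def)
  then show ?thesis by simp
qed

lemma prob_space_circ: "prob_space circ"
proof
  have "(\<integral>\<^sup>+w. 1 \<partial>circ) = ennreal (1 / (2 * pi)) * ennreal (2 * pi)"
    by (subst nn_integral_circ) auto
  then show "emeasure circ (space circ) = 1" by (simp add: ennreal_mult[symmetric])
qed

interpretation circ: prob_space circ by (rule prob_space_circ)
interpretation torus: pair_prob_space circ circ ..

lemma nn_integral_circ_shift_nonneg: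
  assumes [measurable]: "f \<in> borel_measurable borel" and per: "\<And>x. f (x + 2 * pi) = f x"
    and a: "0 \<le> a" "a \<le> 2 * pi"
  shows "(\<integral>\<^sup>+w. f (w + a) \<partial>circ) = (\<integral>\<^sup>+w. f w \<partial>circ)"
proof -
  define J where "J = (\<lambda>u v. \<integral>\<^sup>+x. f x * indicator {u..<v} x \<partial>lborel)"
  have add: "J u w = J u v + J v w" if "u \<le> v" "v \<le> w" for u v w
  proof -
    have "J u w = (\<integral>\<^sup>+x. f x * indicator {u..<v} x + f x * indicator {v..<w} x \<partial>lborel)"
      unfolding J_def using that by (intro nn_integral_cong) (auto simp: indicator_def)
    then show ?thesis by (simp add: J_def nn_integral_add)
  qed
  have sh: "(\<integral>\<^sup>+x. f (x + c) * indicator {u..<v} x \<partial>lborel) = J (u + c) (v + c)" for u v c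
    unfolding J_def using nn_integral_real_affine[of "\<lambda>x. f x * indicator {u + c..<v + c} x" 1 c]
    by (simp add: add.commute indicator_def)
  have p: "J (u + 2 * pi) (v + 2 * pi) = J u v" for u v
    using sh[of "2 * pi" u v] per by (simp add: J_def)
  have "(\<integral>\<^sup>+x. f (x + a) * indicator {- pi..<pi} x \<partial>lborel) = J (a - pi) (a + pi)"
    by (simp add: sh algebra_simps)
  also have "\<dots> = J (a - pi) pi + J pi (a + pi)" using a by (intro add) auto
  also have "J pi (a + pi) = J (- pi) (a - pi)"
    using p[of "- pi" "a - pi"] by (simp add: algebra_simps)
  also have "J (a - pi) pi + J (- pi) (a - pi) = J (- pi) pi"
    using a by (subst add.commute) (intro add[symmetric], auto)
  finally show ?thesis by (simp add: nn_integral_circ J_def)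
qed

lemma nn_integral_circ_shift:
  assumes m: "f \<in> borel_measurable borel" and per: "\<And>x. f (x + 2 * pi) = f x"
    and a: "- 2 * pi \<le> a" "a \<le> 2 * pi"
  shows "(\<integral>\<^sup>+w. f (w + a) \<partial>circ) = (\<integral>\<^sup>+w. f w \<partial>circ)"
proof (cases "0 \<le> a")
  case True
  then show ?thesis using nn_integral_circ_shift_nonneg[OF m per] a by simp
next
  case False
  have "f (w + a) = f (w + (a + 2 * pi))" for w
    using per[of "w + a"] by (simp add: add.assoc)
  then show ?thesis using nn_integral_circ_shift_nonneg[OF m per, of "a + 2 * pi"] a False by simp
qed

lemma AE_circ: "AE w in circ. - pi \<le> w \<and> w < pi"
  unfolding circ_def by (subst AE_density) (auto simp: indicator_def ennreal_0)

lemma circ_cos_zero: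
  fixes k :: int
  assumes "k \<noteq> 0"
  shows "(LINT w|circ. cos (a + k * w)) = 0"
proof -
  have "(LINT w|lborel. cos (a + k * w) * indicator {- pi..<pi} w)
      = (LINT w|lborel. cos (a + k * w) * indicator {- pi..pi} w)"
    by (rule integral_cong_AE, simp, simp, rule AE_mp[OF AE_lborel_singleton[of pi]], rule AE_I2)
       (auto simp: indicator_def)
  also have "\<dots> = sin (a + k * pi) / k - sin (a + k * (- pi)) / k"
    by (rule integral_FTC_Icc_real)
       (use assms in \<open>auto intro!: derivative_eq_intros continuous_intros\<close>)
  also have "\<dots> = 0"
  proof -
    have "sin (a + k * pi) = sin (a + k * (- pi))"
      using sin_diff[of a "k * pi"] sin_add[of a "k * pi"] sin_times_pi_eq_0[of "real_of_int k"]
      by simp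
    then show ?thesis by simp
  qed
  finally show ?thesis by (simp add: integral_circ)
qed

section \<open>Reduction of the torus average of the inverse symbol to the elliptic integral\<close>

lemma one_minus_cos_pos:
  fixes b w :: real
  assumes b: "\<bar>b\<bar> < 1"
  shows "0 < 1 - b * cos w"
proof -
  have "b * cos w \<le> \<bar>b\<bar> * \<bar>cos w\<bar>" by (simp only: abs_mult[symmetric] abs_ge_self)
  also have "\<dots> \<le> \<bar>b\<bar> * 1" by (intro mult_left_mono) auto
  finally show ?thesis using b by simp
qed

text \<open>With \<open>b = 2 r / (1 + r\<^sup>2)\<close> the integrand is a Poisson kernel, which has an antiderivative
  that is smooth on the whole line.\<close>

lemma nn_integral_circ_inverse_one_minus_cos:
  assumes b: "\<bar>b\<bar> < 1"
  shows "(\<integral>\<^sup>+w. ennreal (1 / (1 - b * cos w)) \<partial>circ) = ennreal (1 / sqrt (1 - b\<^sup>2))"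
proof -
  define s where "s = sqrt (1 - b\<^sup>2)"
  have b2: "b\<^sup>2 < 1" using b by (simp add: abs_square_less_1)
  have s: "0 < s" "s\<^sup>2 = 1 - b\<^sup>2" using b2 by (auto simp: s_def)
  \<comment> \<open>The solution of \<open>b * (1 + r\<^sup>2) = 2 * r\<close> inside the unit
    interval, written so that b = 0 is covered.\<close>
  define r where "r = b / (1 + s)"
  have r1: "\<bar>r\<bar> < 1" using b s(1) by (simp add: r_def abs_mult field_simps)
  have rb: "b * (1 + r\<^sup>2) = 2 * r" and rs: "1 - r\<^sup>2 = s * (1 + r\<^sup>2)"
  proof -
    have bs: "b\<^sup>2 = (1 - s) * (1 + s)" using s(2) by (simp add: algebra_simps power2_eq_square)
    have "r\<^sup>2 = (1 - s) / (1 + s)"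
      unfolding r_def power_divide bs using s(1) by (simp add: power2_eq_square)
    then have q: "1 + r\<^sup>2 = 2 / (1 + s)" "1 - r\<^sup>2 = 2 * s / (1 + s)"
      using s(1) by (simp_all add: field_simps)
    show "b * (1 + r\<^sup>2) = 2 * r" "1 - r\<^sup>2 = s * (1 + r\<^sup>2)"
      unfolding q by (simp_all add: r_def)
  qed
  \<comment> \<open>The arctangent is minus the argument of 1 - r exp(i w), a number with positive
    real part. Unlike the substitution by tan (w / 2) this has no jump at the endpoints; the
    arctangent vanishes at both, and only the linear term contributes.\<close>
  define F where "F = (\<lambda>w. w + 2 * arctan (r * sin w / (1 - r * cos w)))"
  have deriv: "(F has_real_derivative s * (1 / (1 - b * cos w))) (at w)" for w
  proof -
    define D where "D = 1 - r * cos w"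
    have D: "0 < D" unfolding D_def by (rule one_minus_cos_pos[OF r1])
    define N where "N = 1 - 2 * r * cos w + r\<^sup>2"
    have DN: "D\<^sup>2 + (r * sin w)\<^sup>2 = N"
    proof -
      have "D\<^sup>2 + (r * sin w)\<^sup>2 = 1 - 2 * r * cos w + (r\<^sup>2 * (sin w)\<^sup>2 + r\<^sup>2 * (cos w)\<^sup>2)"
        unfolding D_def by (simp add: power2_eq_square algebra_simps)
      also have "r\<^sup>2 * (sin w)\<^sup>2 + r\<^sup>2 * (cos w)\<^sup>2 = r\<^sup>2"
        by (simp add: distrib_left[symmetric])
      finally show ?thesis by (simp add: N_def)
    qed
    have N0: "0 < N" unfolding DN[symmetric] using D by (intro add_pos_nonneg) auto
    have "(F has_real_derivative 1 + 2 * (inverse (1 + (r * sin w / D)\<^sup>2) *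
        ((r * cos w * D - r * sin w * (r * sin w)) / (D * D)))) (at w)"
      unfolding F_def D_def
      by (rule derivative_eq_intros refl | use D in \<open>simp add: D_def\<close>)+
    also have "r * cos w * D - r * sin w * (r * sin w) = r * cos w - (r\<^sup>2 * (sin w)\<^sup>2 + r\<^sup>2 * (cos w)\<^sup>2)"
      by (simp add: D_def power2_eq_square algebra_simps)
    also have "r\<^sup>2 * (sin w)\<^sup>2 + r\<^sup>2 * (cos w)\<^sup>2 = r\<^sup>2"
      by (simp add: distrib_left[symmetric])
    also have "inverse (1 + (r * sin w / D)\<^sup>2) = D\<^sup>2 / N"
      using D N0 by (simp add: power_divide DN[symmetric] field_simps)
    also have "D\<^sup>2 / N * ((r * cos w - r\<^sup>2) / (D * D)) = (r * cos w - r\<^sup>2) / N"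
      using D by (simp add: power2_eq_square[of D])
    also have "1 + 2 * ((r * cos w - r\<^sup>2) / N) = (N + 2 * (r * cos w - r\<^sup>2)) / N"
      using N0 by (simp add: add_divide_distrib)
    also have "N + 2 * (r * cos w - r\<^sup>2) = 1 - r\<^sup>2" by (simp add: N_def)
    also have "(1 - r\<^sup>2) / N = s * (1 + r\<^sup>2) / ((1 + r\<^sup>2) - b * (1 + r\<^sup>2) * cos w)"
    proof -
      have "N = (1 + r\<^sup>2) - 2 * r * cos w" by (simp add: N_def)
      then show ?thesis by (simp only: rs rb)
    qed
    also have "(1 + r\<^sup>2) - b * (1 + r\<^sup>2) * cos w = (1 + r\<^sup>2) * (1 - b * cos w)"
      by (simp add: algebra_simps)
    also have "s * (1 + r\<^sup>2) / ((1 + r\<^sup>2) * (1 - b * cos w)) = s * (1 / (1 - b * cos w))"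
    proof -
      have "1 + r\<^sup>2 \<noteq> 0" by (smt (verit) zero_le_power2)
      then show ?thesis by simp
    qed
    finally show ?thesis .
  qed
  have e: "ennreal (s * (1 / (1 - b * cos w))) = ennreal s * ennreal (1 / (1 - b * cos w))" for w
    using s one_minus_cos_pos[OF b, of w] by (intro ennreal_mult) auto
  have "ennreal s * (\<integral>\<^sup>+w. ennreal (1 / (1 - b * cos w)) * indicator {- pi..<pi} w \<partial>lborel)
      = (\<integral>\<^sup>+w. ennreal (s * (1 / (1 - b * cos w))) * indicator {- pi..<pi} w \<partial>lborel)"
    unfolding e mult.assoc by (rule nn_integral_cmult[symmetric]) measurable
  also have "\<dots> = (\<integral>\<^sup>+w. ennreal (s * (1 / (1 - b * cos w))) * indicator {- pi..pi} w \<partial>lborel)"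
    by (rule nn_integral_cong_AE, rule AE_mp[OF AE_lborel_singleton[of pi]], rule AE_I2)
       (auto simp: indicator_def)
  also have "\<dots> = ennreal (F pi - F (- pi))"
    by (rule nn_integral_FTC_Icc)
       (use deriv s one_minus_cos_pos[OF b] in \<open>auto intro: less_imp_le has_field_derivative_at_within\<close>)
  also have "F pi - F (- pi) = 2 * pi" by (simp add: F_def)
  finally have *: "ennreal s * (\<integral>\<^sup>+w. ennreal (1 / (1 - b * cos w)) * indicator {- pi..<pi} w \<partial>lborel) = ennreal (2 * pi)" .
  have "(\<integral>\<^sup>+w. ennreal (1 / (1 - b * cos w)) \<partial>circ)
      = ennreal (1 / (2 * pi)) * (ennreal (1 / s) * (ennreal s * (\<integral>\<^sup>+w. ennreal (1 / (1 - b * cos w)) * indicator {- pi..<pi} w \<partial>lborel)))"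
    using s by (simp add: nn_integral_circ mult.assoc[symmetric] ennreal_mult[symmetric])
  also have "\<dots> = ennreal (1 / s)"
    unfolding * using s by (simp add: ennreal_mult[symmetric])
  finally show ?thesis by (simp add: s_def)
qed

text \<open>Two shears, each a translation in the inner variable for a fixed outer one: w1 is
  replaced by w1 - w2, then w2 by w2 + w1 / 2. The half angle is not periodic in w1 but is only a
  parameter of the inner integral.\<close>

lemma nn_integral_torus_sum_to_product:
  assumes [measurable]: "g \<in> borel_measurable borel"
  shows "(\<integral>\<^sup>+w1. \<integral>\<^sup>+w2. g (cos w1 + cos w2) \<partial>circ \<partial>circ)
    = (\<integral>\<^sup>+w1. \<integral>\<^sup>+w2. g (2 * cos (w1 / 2) * cos w2) \<partial>circ \<partial>circ)"
proof -
  \<comment> \<open>The translation lemma covers shifts of at most one full period, which is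
    satisfied almost everywhere on the fundamental domain.\<close>
  have ae: "AE w in circ. - 2 * pi \<le> - w \<and> - w \<le> 2 * pi" "AE w in circ. - 2 * pi \<le> w / 2 \<and> w / 2 \<le> 2 * pi"
    by (rule AE_mp[OF AE_circ], intro AE_I2, use pi_gt_zero in linarith)+
  have "(\<integral>\<^sup>+w1. \<integral>\<^sup>+w2. g (cos w1 + cos w2) \<partial>circ \<partial>circ) = (\<integral>\<^sup>+w2. \<integral>\<^sup>+w1. g (cos w1 + cos w2) \<partial>circ \<partial>circ)"
    by (rule torus.Fubini') measurable
  also have "\<dots> = (\<integral>\<^sup>+w2. \<integral>\<^sup>+w1. g (cos (w1 + - w2) + cos w2) \<partial>circ \<partial>circ)"
  proof (rule nn_integral_cong_AE, rule AE_mp[OF ae(1)], intro AE_I2 impI)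
    fix w2 :: real assume w: "- 2 * pi \<le> - w2 \<and> - w2 \<le> 2 * pi"
    show "(\<integral>\<^sup>+w1. g (cos w1 + cos w2) \<partial>circ) = (\<integral>\<^sup>+w1. g (cos (w1 + - w2) + cos w2) \<partial>circ)"
      by (rule nn_integral_circ_shift[of "\<lambda>w. g (cos w + cos w2)", symmetric]) (use w in auto)
  qed
  also have "\<dots> = (\<integral>\<^sup>+w1. \<integral>\<^sup>+w2. g (cos (w1 + - w2) + cos w2) \<partial>circ \<partial>circ)"
    by (rule torus.Fubini') measurable
  also have "\<dots> = (\<integral>\<^sup>+w1. \<integral>\<^sup>+w2. g (2 * cos (w1 / 2) * cos (w2 - w1 / 2)) \<partial>circ \<partial>circ)"
  proof (intro nn_integral_cong arg_cong[of _ _ g])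
    fix w1 w2 :: real
    have "cos (w1 + - w2) + cos w2 = 2 * cos ((w1 - w2 + w2) / 2) * cos ((w1 - w2 - w2) / 2)"
      by (simp add: cos_plus_cos)
    also have "(w1 - w2 - w2) / 2 = - (w2 - w1 / 2)" by (simp add: field_simps)
    finally show "cos (w1 + - w2) + cos w2 = 2 * cos (w1 / 2) * cos (w2 - w1 / 2)"
      by (simp only: cos_minus) simp
  qed
  also have "\<dots> = (\<integral>\<^sup>+w1. \<integral>\<^sup>+w2. g (2 * cos (w1 / 2) * cos w2) \<partial>circ \<partial>circ)"
  proof (rule nn_integral_cong_AE, rule AE_mp[OF ae(2)], intro AE_I2 impI)
    fix w1 :: real assume w: "- 2 * pi \<le> w1 / 2 \<and> w1 / 2 \<le> 2 * pi"
    have "cos (w2 + 2 * pi - w1 / 2) = cos (w2 - w1 / 2)" for w2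
      using cos_periodic[of "w2 - w1 / 2"] by (simp add: algebra_simps)
    then show "(\<integral>\<^sup>+w2. g (2 * cos (w1 / 2) * cos (w2 - w1 / 2)) \<partial>circ) = (\<integral>\<^sup>+w2. g (2 * cos (w1 / 2) * cos w2) \<partial>circ)"
      using nn_integral_circ_shift[of "\<lambda>w2. g (2 * cos (w1 / 2) * cos (w2 - w1 / 2))" "w1 / 2"] w
      by simp
  qed
  finally show ?thesis .
qed

text \<open>A shift by \<pi> turns the cosine into a sine; evenness and t = w / 2 then reduce the
  circle to a quarter period.\<close>

lemma nn_integral_circ_elliptic:
  assumes k: "\<bar>k\<bar> < 1"
  shows "(\<integral>\<^sup>+w. ennreal (1 / sqrt (1 - (k * cos (w / 2))\<^sup>2)) \<partial>circ) = ennreal (2 / pi) * ellipticK k"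
proof -
  define g where "g = (\<lambda>w. ennreal (1 / sqrt (1 - (k * sin (w / 2))\<^sup>2)))"
  have [measurable]: "g \<in> borel_measurable borel" by (simp add: g_def)
  have g_even: "g (- w) = g w" for w by (simp add: g_def)
  have "(\<integral>\<^sup>+w. ennreal (1 / sqrt (1 - (k * cos (w / 2))\<^sup>2)) \<partial>circ)
      = (\<integral>\<^sup>+w. ennreal (1 / sqrt (1 - (k * cos ((w + pi) / 2))\<^sup>2)) \<partial>circ)"
    by (intro nn_integral_circ_shift[symmetric]) (simp_all add: add_divide_distrib power_mult_distrib)
  also have "\<dots> = (\<integral>\<^sup>+w. g w \<partial>circ)"
    by (simp add: g_def add_divide_distrib cos_add power_mult_distrib)
  also have "\<dots> = ennreal (1 / (2 * pi)) * (\<integral>\<^sup>+w. g w * indicator {- pi..<pi} w \<partial>lborel)"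
    by (rule nn_integral_circ) simp
  also have "(\<integral>\<^sup>+w. g w * indicator {- pi..<pi} w \<partial>lborel)
      = (\<integral>\<^sup>+w. g w * indicator {0..pi} w + g (- w) * indicator {0..pi} (- w) \<partial>lborel)"
    by (rule nn_integral_cong_AE, rule AE_mp[OF AE_lborel_singleton[of pi]],
        rule AE_mp[OF AE_lborel_singleton[of 0]], rule AE_mp[OF AE_lborel_singleton[of "- pi"]], rule AE_I2)
       (auto simp: indicator_def g_even)
  also have "\<dots> = (\<integral>\<^sup>+w. g w * indicator {0..pi} w \<partial>lborel) + (\<integral>\<^sup>+w. g (- w) * indicator {0..pi} (- w) \<partial>lborel)"
    by (rule nn_integral_add) auto
  also have "(\<integral>\<^sup>+w. g (- w) * indicator {0..pi} (- w) \<partial>lborel) = (\<integral>\<^sup>+w. g w * indicator {0..pi} w \<partial>lborel)"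
    using nn_integral_real_affine[of "\<lambda>w. g w * indicator {0..pi} w" "- 1" 0] by simp
  also have "(\<integral>\<^sup>+w. g w * indicator {0..pi} w \<partial>lborel) = ennreal 2 * ellipticK k"
  proof -
    have "(\<integral>\<^sup>+w. g w * indicator {0..pi} w \<partial>lborel) = ennreal 2 * (\<integral>\<^sup>+t. g (2 * t) * indicator {0..pi} (2 * t) \<partial>lborel)"
      using nn_integral_real_affine[of "\<lambda>w. g w * indicator {0..pi} w" 2 0] by simp
    also have "(\<integral>\<^sup>+t. g (2 * t) * indicator {0..pi} (2 * t) \<partial>lborel) = ellipticK k"
      unfolding ellipticK_def
    proof (intro nn_integral_cong)
      fix t :: real
      have "0 \<le> 1 - k\<^sup>2 * (sin t)\<^sup>2"
      proof -
        have "k\<^sup>2 * (sin t)\<^sup>2 \<le> 1 * 1"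
          using k by (intro mult_mono) (auto simp: abs_square_le_1 less_imp_le)
        then show ?thesis by simp
      qed
      then have "(1 - k\<^sup>2 * (sin t)\<^sup>2) powr (- 1 / 2) = 1 / sqrt (1 - k\<^sup>2 * (sin t)\<^sup>2)"
        using powr_minus_divide[of "1 - k\<^sup>2 * (sin t)\<^sup>2" "1 / 2"] powr_half_sqrt by simp
      then show "g (2 * t) * indicator {0..pi} (2 * t)
          = ennreal ((1 - k\<^sup>2 * (sin t)\<^sup>2) powr (- 1 / 2)) * indicator {0..pi / 2} t"
        by (auto simp: g_def power_mult_distrib indicator_def)
    qed
    finally show ?thesis .
  qed
  also have "ennreal (1 / (2 * pi)) * (ennreal 2 * ellipticK k + ennreal 2 * ellipticK k)
      = ennreal (1 / (2 * pi)) * (ennreal 4 * ellipticK k)"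
    by (simp add: distrib_right[symmetric] mult.assoc[symmetric])
  also have "\<dots> = ennreal (2 / pi) * ellipticK k"
    unfolding mult.assoc[symmetric] by (subst ennreal_mult[symmetric]) auto
  finally show ?thesis .
qed

text \<open>The origin of the modulus 4 \<zeta>: after the shears the inner integral is the Poisson
  one with b = 4 \<zeta> cos (w1 / 2), and its value is the elliptic integrand in w1.\<close>

lemma nn_integral_torus_symb:
  assumes z: "0 \<le> \<zeta>" "\<zeta> < 1 / 4"
  shows "(\<integral>\<^sup>+w1. \<integral>\<^sup>+w2. ennreal (1 / symb \<zeta> w1 w2) \<partial>circ \<partial>circ) = ennreal (2 / pi) * ellipticK (4 * \<zeta>)"
proof -
  have "(\<integral>\<^sup>+w1. \<integral>\<^sup>+w2. ennreal (1 / symb \<zeta> w1 w2) \<partial>circ \<partial>circ)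
      = (\<integral>\<^sup>+w1. \<integral>\<^sup>+w2. ennreal (1 / (1 - 2 * \<zeta> * (cos w1 + cos w2))) \<partial>circ \<partial>circ)"
    by (simp add: symb_def algebra_simps)
  also have "\<dots> = (\<integral>\<^sup>+w1. \<integral>\<^sup>+w2. ennreal (1 / (1 - 2 * \<zeta> * (2 * cos (w1 / 2) * cos w2))) \<partial>circ \<partial>circ)"
    by (rule nn_integral_torus_sum_to_product[of "\<lambda>c. ennreal (1 / (1 - 2 * \<zeta> * c))"]) measurable
  also have "\<dots> = (\<integral>\<^sup>+w1. ennreal (1 / sqrt (1 - (4 * \<zeta> * cos (w1 / 2))\<^sup>2)) \<partial>circ)"
  proof (rule nn_integral_cong)
    fix w1 :: real
    have "\<bar>4 * \<zeta> * cos (w1 / 2)\<bar> \<le> 4 * \<zeta> * 1"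
      unfolding abs_mult using z by (intro mult_mono) auto
    then have "\<bar>4 * \<zeta> * cos (w1 / 2)\<bar> < 1" using z by simp
    from nn_integral_circ_inverse_one_minus_cos[OF this]
    show "(\<integral>\<^sup>+w2. ennreal (1 / (1 - 2 * \<zeta> * (2 * cos (w1 / 2) * cos w2))) \<partial>circ)
        = ennreal (1 / sqrt (1 - (4 * \<zeta> * cos (w1 / 2))\<^sup>2))"
      by (simp add: mult.assoc mult.left_commute[of \<zeta> 2])
  qed
  also have "\<dots> = ennreal (2 / pi) * ellipticK (4 * \<zeta>)"
    using z by (intro nn_integral_circ_elliptic) auto
  finally show ?thesis .
qed

text \<open>At modulus 1 the integrand is 1 / cos t, which dominates 1 / (\<pi> / 2 - t), and that
  diverges logarithmically.\<close>

lemma ellipticK_1: "ellipticK 1 = \<infinity>"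
proof -
  have "ennreal (of_nat n) \<le> ellipticK 1" for n
  proof -
    \<comment> \<open>Chosen so that the logarithm at the cut-off equals n.\<close>
    define \<epsilon> where "\<epsilon> = exp (- real n)"
    have e: "0 < \<epsilon>" "\<epsilon> \<le> 1" by (simp_all add: \<epsilon>_def)
    have pi2: "1 < pi / 2" using pi_gt3 by simp
    have "(\<integral>\<^sup>+t. ennreal (1 / (pi / 2 - t)) * indicator {0..pi / 2 - \<epsilon>} t \<partial>lborel)
        = ennreal (- ln (pi / 2 - (pi / 2 - \<epsilon>)) - - ln (pi / 2 - 0))"
      using e pi2
      by (intro nn_integral_FTC_Icc) (auto intro!: derivative_eq_intros simp: divide_simps)
    also have "- ln (pi / 2 - (pi / 2 - \<epsilon>)) - - ln (pi / 2 - 0) = real n + ln (pi / 2)"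
      by (simp add: \<epsilon>_def)
    finally have "ennreal (real n + ln (pi / 2)) = (\<integral>\<^sup>+t. ennreal (1 / (pi / 2 - t)) * indicator {0..pi / 2 - \<epsilon>} t \<partial>lborel)"
      by simp
    also have "\<dots> \<le> ellipticK 1"
      unfolding ellipticK_def
    proof (intro nn_integral_mono)
      fix t :: real
      show "ennreal (1 / (pi / 2 - t)) * indicator {0..pi / 2 - \<epsilon>} t
          \<le> ennreal ((1 - 1\<^sup>2 * (sin t)\<^sup>2) powr (- 1 / 2)) * indicator {0..pi / 2} t"
      proof (cases "t \<in> {0..pi / 2 - \<epsilon>}")
        case True
        then have t: "0 \<le> t" "t < pi / 2" using e by auto
        then have c: "0 < cos t" by (intro cos_gt_zero_pi) auto
        have "1 - 1\<^sup>2 * (sin t)\<^sup>2 = (cos t)\<^sup>2" by (simp add: cos_squared_eq)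
        then have "(1 - 1\<^sup>2 * (sin t)\<^sup>2) powr (- 1 / 2) = 1 / cos t"
          using c powr_minus_divide[of "(cos t)\<^sup>2" "1 / 2"] by (simp add: powr_half_sqrt)
        moreover have "cos t \<le> pi / 2 - t"
          using sin_x_le_x[of "pi / 2 - t"] t by (simp add: sin_diff)
        ultimately show ?thesis using True e c t
          by (auto simp: indicator_def intro!: ennreal_leI divide_left_mono)
      qed auto
    qed
    finally have "ennreal (real n + ln (pi / 2)) \<le> ellipticK 1" .
    moreover have "ennreal (real n) \<le> ennreal (real n + ln (pi / 2))"
      using pi2 by (intro ennreal_leI) simp
    ultimately show ?thesis by (rule order_trans[rotated])
  qed
  then have le: "ennreal (real n) \<le> ellipticK 1" for n by simp
  show ?thesis
  proof (rule ccontr)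
    assume "ellipticK 1 \<noteq> \<infinity>"
    then have "ellipticK 1 < top" by (simp add: less_top)
    from ennreal_Ex_less_of_nat[OF this] obtain n where "ellipticK 1 < ennreal (real n)"
      by (auto simp: ennreal_of_nat_eq_real_of_nat)
    then show False using le[of n] by (simp add: leD)
  qed
qed

section \<open>Fourier representation of the covariance and the signal power\<close>

context sfar
begin

definition fourier :: "site \<Rightarrow> real" where
  "fourier t = (LINT p|(circ \<Otimes>\<^sub>M circ).
     cos (of_int (fst t) * fst p + of_int (snd t) * snd p) / symb \<zeta> (fst p) (snd p))"

lemma symb_measurable[measurable]:
  assumes [measurable]: "f \<in> borel_measurable N" "g \<in> borel_measurable N"
  shows "(\<lambda>p. symb \<zeta> (f p) (g p)) \<in> borel_measurable N"
  unfolding symb_def by measurable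

lemma fourier_bound: "\<bar>cos x / symb \<zeta> w1 w2\<bar> \<le> 1 / (1 - 4 * \<zeta>)"
proof -
  have "\<bar>cos x\<bar> / symb \<zeta> w1 w2 \<le> 1 / (1 - 4 * \<zeta>)"
    using zeta_less symb_ge[OF zeta_nonneg, of w1 w2] by (intro frac_le) auto
  then show ?thesis
    using symb_pos[OF zeta_nonneg zeta_less, of w1 w2] by (simp add: abs_divide)
qed

lemma fourier_integrable:
  "integrable (circ \<Otimes>\<^sub>M circ) (\<lambda>p. cos (a * fst p + b * snd p) / symb \<zeta> (fst p) (snd p))"
proof (rule torus.P.integrable_const_bound[where B = "1 / (1 - 4 * \<zeta>)"])
  show "AE p in circ \<Otimes>\<^sub>M circ. norm (cos (a * fst p + b * snd p) / symb \<zeta> (fst p) (snd p)) \<le> 1 / (1 - 4 * \<zeta>)"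
    by (intro AE_I2) (simp only: real_norm_def fourier_bound)
qed measurable

lemma fourier_abs_le: "\<bar>fourier t\<bar> \<le> 1 / (1 - 4 * \<zeta>)"
proof -
  have "\<bar>fourier t\<bar> \<le> (LINT p|(circ \<Otimes>\<^sub>M circ).
      \<bar>cos (of_int (fst t) * fst p + of_int (snd t) * snd p) / symb \<zeta> (fst p) (snd p)\<bar>)"
    unfolding fourier_def by (rule integral_abs_bound)
  also have "\<dots> \<le> (LINT p|(circ \<Otimes>\<^sub>M circ). 1 / (1 - 4 * \<zeta>))"
    by (rule integral_mono[OF integrable_abs[OF fourier_integrable] _ fourier_bound]) simp
  finally show ?thesis using torus.P.prob_space by simp
qed

lemma torus_orthogonality:
  "(LINT p|(circ \<Otimes>\<^sub>M circ). cos (of_int i * fst p + of_int j * snd p)) = (if i = 0 \<and> j = 0 then 1 else 0)"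
proof (cases "i = 0 \<and> j = 0")
  case True
  then show ?thesis using torus.P.prob_space by simp
next
  case False
  have i: "integrable (circ \<Otimes>\<^sub>M circ) (\<lambda>p. cos (of_int i * fst p + of_int j * snd p))"
    by (rule torus.P.integrable_const_bound[where B = 1]) auto
  show ?thesis
  proof (cases "j = 0")
    case True
    then have "i \<noteq> 0" using False by simp
    have "(LINT p|(circ \<Otimes>\<^sub>M circ). cos (of_int i * fst p + of_int j * snd p))
        = (LINT w1|circ. LINT w2|circ. cos (of_int i * w1 + of_int j * w2))"
      using torus.integral_fst'[OF i] by simp
    also have "\<dots> = (LINT w1|circ. cos (0 + of_int i * w1))"
      using True circ.prob_space by simp
    also have "\<dots> = 0" by (rule circ_cos_zero[OF \<open>i \<noteq> 0\<close>])
    finally show ?thesis using False by simp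
  next
    case j: False
    have "(LINT p|(circ \<Otimes>\<^sub>M circ). cos (of_int i * fst p + of_int j * snd p))
        = (LINT w1|circ. LINT w2|circ. cos (of_int i * w1 + of_int j * w2))"
      using torus.integral_fst'[OF i] by simp
    also have "\<dots> = 0" by (simp add: circ_cos_zero[OF j])
    finally show ?thesis using False by simp
  qed
qed

text \<open>Under the integral the difference operator multiplies the cosine by the symbol and
  cancels the denominator; orthogonality of the characters leaves the point source.\<close>

lemma fourier_recursion:
  "fourier t - \<zeta> * (fourier (t + (1, 0)) + fourier (t + (- 1, 0)) + fourier (t + (0, 1)) + fourier (t + (0, - 1)))
    = (if t = (0, 0) then 1 else 0)"
proof -
  obtain i j where t: "t = (i, j)" by (cases t)
  define c where "c = (\<lambda>(k :: int) (l :: int) (p :: real \<times> real).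
    cos (of_int k * fst p + of_int l * snd p) / symb \<zeta> (fst p) (snd p))"
  have int: "integrable (circ \<Otimes>\<^sub>M circ) (c k l)" for k l
    unfolding c_def by (rule fourier_integrable)
  have f: "fourier (k, l) = (LINT p|(circ \<Otimes>\<^sub>M circ). c k l p)" for k l
    by (simp add: fourier_def c_def)
  have "c i j p - \<zeta> * (c (i + 1) j p + c (i - 1) j p + c i (j + 1) p + c i (j - 1) p)
      = cos (of_int i * fst p + of_int j * snd p)" for p
  proof -
    obtain u v where p: "p = (u, v)" by (cases p)
    define x where "x = of_int i * u + of_int j * v"
    have e: "cos (x + u) + cos (x - u) + cos (x + v) + cos (x - v) = 2 * cos u * cos x + 2 * cos v * cos x"
      by (simp add: cos_add cos_diff)
    have "cos x - \<zeta> * (cos (x + u) + cos (x - u) + cos (x + v) + cos (x - v)) = cos x * symb \<zeta> u v"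
      unfolding e by (simp add: symb_def algebra_simps)
    then have "(cos x - \<zeta> * (cos (x + u) + cos (x - u) + cos (x + v) + cos (x - v))) / symb \<zeta> u v = cos x"
      using symb_pos[OF zeta_nonneg zeta_less, of u v] by simp
    moreover have "of_int (i + 1) * u + of_int j * v = x + u" "of_int (i - 1) * u + of_int j * v = x - u"
      "of_int i * u + of_int (j + 1) * v = x + v" "of_int i * u + of_int (j - 1) * v = x - v"
      by (simp_all add: x_def algebra_simps)
    ultimately show ?thesis
      by (simp only: c_def p fst_conv snd_conv x_def[symmetric] diff_divide_distrib add_divide_distrib
          times_divide_eq_right[symmetric])
  qed
  then have "(LINT p|(circ \<Otimes>\<^sub>M circ). c i j p - \<zeta> * (c (i + 1) j p + c (i - 1) j p + c i (j + 1) p + c i (j - 1) p))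
      = (if i = 0 \<and> j = 0 then 1 else 0)"
    by (simp only: torus_orthogonality)
  then show ?thesis unfolding t using int by (simp add: f)
qed

text \<open>Two bounded solutions of the same equation. Their difference has no source, so any
  uniform bound on it may be multiplied by 4 \<zeta> < 1 as often as desired.\<close>

lemma gam_eq_fourier: "gam t = fourier t / \<kappa>"
proof -
  define d where "d = (\<lambda>t. gam t - fourier t / \<kappa>)"
  have rec: "d t = \<zeta> * (d (t + (1, 0)) + d (t + (- 1, 0)) + d (t + (0, 1)) + d (t + (0, - 1)))" for t
  proof -
    have "d t - \<zeta> * (d (t + (1, 0)) + d (t + (- 1, 0)) + d (t + (0, 1)) + d (t + (0, - 1)))
      = (gam t - \<zeta> * (gam (t + (1, 0)) + gam (t + (- 1, 0)) + gam (t + (0, 1)) + gam (t + (0, - 1))))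
      - (fourier t - \<zeta> * (fourier (t + (1, 0)) + fourier (t + (- 1, 0)) + fourier (t + (0, 1)) + fourier (t + (0, - 1)))) / \<kappa>"
      by (simp add: d_def diff_divide_distrib add_divide_distrib algebra_simps)
    then show ?thesis unfolding gam_recursion fourier_recursion by (cases "t = (0, 0)") simp_all
  qed
  define C where "C = gam (0, 0) + 1 / (1 - 4 * \<zeta>) / \<kappa>"
  have "\<bar>d t\<bar> \<le> (4 * \<zeta>) ^ n * C" for n t
  proof (induction n arbitrary: t)
    case 0
    have "\<bar>fourier t / \<kappa>\<bar> \<le> 1 / (1 - 4 * \<zeta>) / \<kappa>"
      using divide_right_mono[OF fourier_abs_le] kappa_pos by (simp add: abs_divide)
    then have "\<bar>d t\<bar> \<le> C" using gam_abs_le[of t] unfolding d_def C_def by linarith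
    then show ?case by simp
  next
    case (Suc n)
    have "\<bar>d t\<bar> = \<zeta> * \<bar>d (t + (1, 0)) + d (t + (- 1, 0)) + d (t + (0, 1)) + d (t + (0, - 1))\<bar>"
      using zeta_nonneg by (subst rec) (simp add: abs_mult)
    also have "\<dots> \<le> \<zeta> * (4 * ((4 * \<zeta>) ^ n * C))"
      using Suc.IH[of "t + (1, 0)"] Suc.IH[of "t + (- 1, 0)"] Suc.IH[of "t + (0, 1)"] Suc.IH[of "t + (0, - 1)"] zeta_nonneg
      by (intro mult_left_mono) linarith+
    finally show ?case by (simp only: power_Suc)
  qed
  moreover have "(\<lambda>n. (4 * \<zeta>) ^ n * C) \<longlonglongrightarrow> 0 * C"
    using zeta_nonneg zeta_less by (intro tendsto_intros LIMSEQ_power_zero) auto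
  ultimately have "\<bar>d t\<bar> \<le> 0"
    by (intro tendsto_lowerbound[where f = "\<lambda>n. (4 * \<zeta>) ^ n * C" and F = sequentially]) auto
  then show ?thesis by (simp add: d_def)
qed

lemma gam_zero_eq: "gam (0, 0) = (LINT p|(circ \<Otimes>\<^sub>M circ). 1 / (\<kappa> * symb \<zeta> (fst p) (snd p)))"
proof -
  have "(\<lambda>p. 1 / (\<kappa> * symb \<zeta> (fst p) (snd p))) = (\<lambda>p. 1 / symb \<zeta> (fst p) (snd p) / \<kappa>)"
    by (simp add: mult.commute)
  then show ?thesis by (simp only: gam_eq_fourier fourier_def integral_divide_zero) simp
qed

lemma fourier_elliptic: "ennreal (\<kappa> * gam (0, 0)) = ennreal (2 / pi) * ellipticK (4 * \<zeta>)"
proof -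
  have i: "integrable (circ \<Otimes>\<^sub>M circ) (\<lambda>p. 1 / symb \<zeta> (fst p) (snd p))"
    using fourier_integrable[of 0 0] by simp
  have "\<kappa> * gam (0, 0) = fourier (0, 0)" using kappa_pos by (simp add: gam_eq_fourier)
  then have "ennreal (\<kappa> * gam (0, 0)) = (\<integral>\<^sup>+p. ennreal (1 / symb \<zeta> (fst p) (snd p)) \<partial>(circ \<Otimes>\<^sub>M circ))"
    using nn_integral_eq_integral[OF i] symb_pos[OF zeta_nonneg zeta_less]
    by (simp add: fourier_def less_imp_le)
  also have "\<dots> = (\<integral>\<^sup>+w1. \<integral>\<^sup>+w2. ennreal (1 / symb \<zeta> w1 w2) \<partial>circ \<partial>circ)"
    using circ.nn_integral_fst[of "\<lambda>p. ennreal (1 / symb \<zeta> (fst p) (snd p))" circ] by simp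
  also have "\<dots> = ennreal (2 / pi) * ellipticK (4 * \<zeta>)"
    by (rule nn_integral_torus_symb[OF zeta_nonneg zeta_less])
  finally show ?thesis .
qed

lemma power_elliptic: "ennreal (gam (0, 0)) = 2 * ellipticK (4 * \<zeta>) / ennreal (pi * \<kappa>)"
proof -
  have "ennreal (gam (0, 0)) = ennreal (1 / \<kappa>) * ennreal (\<kappa> * gam (0, 0))"
    using kappa_pos gam_nonneg by (simp add: ennreal_mult[symmetric])
  also have "\<dots> = ennreal (2 / (pi * \<kappa>)) * ellipticK (4 * \<zeta>)"
    unfolding fourier_elliptic mult.assoc[symmetric] using kappa_pos
    by (subst ennreal_mult[symmetric]) (auto simp: mult.commute)
  also have "ennreal (2 / (pi * \<kappa>)) = 2 / ennreal (pi * \<kappa>)"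
    using kappa_pos by (subst divide_ennreal[symmetric]) auto
  finally show ?thesis by (simp add: ennreal_times_divide mult.commute)
qed

lemma gam_pos: "0 < gam (0, 0)"
proof (rule ccontr)
  assume "\<not> 0 < gam (0, 0)"
  then have "gam t = 0" for t using gam_abs_le[of t] by simp
  then show False using gam_recursion[of "(0, 0)"] kappa_pos by simp
qed

text \<open>Since (2 / \<pi>) K(4 \<zeta>) is \<kappa> times the signal power, the power cancels;
  what remains is the ratio of the spectral densities of signal and noise.\<close>

lemma spectral_snr_eq:
  assumes "0 < \<sigma>"
  shows "spectral_snr (gam (0, 0) / \<sigma>\<^sup>2) \<zeta> w1 w2 = 1 / (\<kappa> * \<sigma>\<^sup>2 * symb \<zeta> w1 w2)"
proof -
  have s: "0 < symb \<zeta> w1 w2" by (rule symb_pos[OF zeta_nonneg zeta_less])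
  have "spectral_snr (gam (0, 0) / \<sigma>\<^sup>2) \<zeta> w1 w2
      = enn2real (ennreal (gam (0, 0) / \<sigma>\<^sup>2) / ennreal (\<kappa> * gam (0, 0) * symb \<zeta> w1 w2))"
    unfolding spectral_snr_def symb_def[symmetric] fourier_elliptic[symmetric]
    using s gam_pos kappa_pos by (simp add: ennreal_mult)
  also have "\<dots> = gam (0, 0) / \<sigma>\<^sup>2 / (\<kappa> * gam (0, 0) * symb \<zeta> w1 w2)"
    using s gam_pos kappa_pos by (simp add: divide_ennreal)
  also have "\<dots> = 1 / (\<kappa> * \<sigma>\<^sup>2 * symb \<zeta> w1 w2)"
    using gam_pos by (simp add: mult_ac)
  finally show ?thesis .
qed

end

section \<open>The discrete sine transform\<close>

text \<open>The eigenvectors of the path with \<open>a\<close> vertices and zero boundary values.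
  Being defined at all integers, they attain the boundary values at 0 and a + 1 as genuine
  values.\<close>

definition sine :: "nat \<Rightarrow> int \<Rightarrow> int \<Rightarrow> real" where
  "sine a p i = sqrt (2 / (a + 1)) * sin (pi * p * i / (a + 1))"

lemma sine_sym: "sine a p i = sine a i p"
  by (simp add: sine_def mult.commute mult.left_commute)

lemma sine_boundary: "sine a p 0 = 0" "sine a p (int a + 1) = 0"
proof -
  show "sine a p 0 = 0" by (simp add: sine_def)
  have "pi * p * (int a + 1) / (a + 1) = pi * p" by (simp add: field_simps)
  then show "sine a p (int a + 1) = 0"
    by (simp add: sine_def mult.commute[of pi] sin_times_pi_eq_0)
qed

lemma sine_neighbours: "sine a p (i + 1) + sine a p (i - 1) = 2 * cos (pi * of_int p / (real a + 1)) * sine a p i"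
proof -
  define x y where "x = pi * of_int p * of_int i / (real a + 1)" and "y = pi * of_int p / (real a + 1)"
  have e: "pi * of_int p * of_int (i + 1) / (real a + 1) = x + y"
    "pi * of_int p * of_int (i - 1) / (real a + 1) = x - y"
    by (simp_all add: x_def y_def distrib_left right_diff_distrib add_divide_distrib diff_divide_distrib)
  have "sin (x + y) + sin (x - y) = 2 * cos y * sin x" by (simp add: sin_add sin_diff)
  then show ?thesis
    unfolding sine_def e x_def[symmetric] y_def[symmetric] distrib_left[symmetric] by simp
qed

text \<open>Each summand becomes a difference of sines at half-integer multiples, and the sum
  telescopes.\<close>

lemma sum_cos_eq:
  assumes "sin (x / 2) \<noteq> 0"
  shows "2 * sin (x / 2) * (\<Sum>i=1..n. cos (x * real i)) = sin (x * (n + 1 / 2)) - sin (x / 2)"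
proof (induction n)
  case 0
  then show ?case by simp
next
  case (Suc n)
  have "2 * sin (x / 2) * cos (x * real (Suc n)) = sin (x * (Suc n + 1 / 2)) - sin (x * (n + 1 / 2))"
  proof -
    have "x * (Suc n + 1 / 2) = x * Suc n + x / 2" "x * (n + 1 / 2) = x * Suc n - x / 2"
      by (simp_all add: algebra_simps)
    then show ?thesis by (simp only: sin_add sin_diff) (simp add: algebra_simps)
  qed
  then show ?case using Suc by (simp add: distrib_left)
qed

text \<open>The sum depends on \<open>m\<close> only through its parity, which is what makes the sines orthogonal.\<close>

lemma sum_cos_int:
  fixes m :: int
  assumes m: "\<not> 2 * (int a + 1) dvd m"
  shows "(\<Sum>i=1..a. cos (pi * m / (a + 1) * real i)) = (if even m then - 1 else 0)"
proof -
  define x where "x = pi * m / (a + 1)"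
  define h where "h = x / 2"
  have nz: "sin h \<noteq> 0"
  proof
    assume "sin h = 0"
    then obtain k :: int where k: "h = k * pi" by (auto simp: sin_zero_iff_int2)
    then have "pi * real_of_int m = pi * real_of_int (k * (2 * (int a + 1)))"
      by (simp add: h_def x_def field_simps)
    then have "real_of_int m = real_of_int (k * (2 * (int a + 1)))"
      by (simp only: mult_left_cancel[OF pi_neq_zero])
    then have "m = k * (2 * (int a + 1))" by (simp only: of_int_eq_iff)
    then show False using m by simp
  qed
  have "x * (a + 1 / 2) = m * pi - h"
    by (simp add: h_def x_def field_simps)
  then have "sin (x * (a + 1 / 2)) = - cos (m * pi) * sin h"
    using sin_times_pi_eq_0[of "real_of_int m"] by (simp add: sin_diff)
  moreover have "cos (m * pi) = (if even m then 1 else - 1)"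
    using cos_npi_int[of m] by (simp add: mult.commute)
  ultimately have "2 * sin h * (\<Sum>i=1..a. cos (x * real i)) = 2 * sin h * (if even m then - 1 else 0)"
    using sum_cos_eq[of x a] nz by (auto simp: h_def[symmetric])
  then have "(\<Sum>i=1..a. cos (x * real i)) = (if even m then - 1 else 0)"
    using nz by (simp only: mult_cancel_left) simp
  then show ?thesis by (simp add: x_def)
qed

lemma sine_orthonormal:
  assumes p: "p \<in> {1..int a}" and q: "q \<in> {1..int a}"
  shows "(\<Sum>i\<in>{1..int a}. sine a p i * sine a q i) = (if p = q then 1 else 0)"
proof -
  have "sine a p i * sine a q i
      = 1 / (a + 1) * (cos (pi * of_int (p - q) / (a + 1) * i) - cos (pi * of_int (p + q) / (a + 1) * i))" for i :: int
  proof -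
    have "sine a p i * sine a q i = (sqrt (2 / (a + 1)) * sqrt (2 / (a + 1))) * (sin (pi * p * i / (a + 1)) * sin (pi * q * i / (a + 1)))"
      unfolding sine_def of_nat_add of_nat_1 by (simp only: mult_ac)
    also have "sqrt (2 / (a + 1)) * sqrt (2 / (a + 1)) = 2 / (a + 1)" by simp
    also have "sin (pi * p * i / (a + 1)) * sin (pi * q * i / (a + 1))
        = (cos (pi * p * i / (a + 1) - pi * q * i / (a + 1)) - cos (pi * p * i / (a + 1) + pi * q * i / (a + 1))) / 2"
      by (rule sin_times_sin)
    also have "pi * p * i / (a + 1) - pi * q * i / (a + 1) = pi * of_int (p - q) / (a + 1) * i"
      by (simp add: algebra_simps diff_divide_distrib)
    also have "pi * p * i / (a + 1) + pi * q * i / (a + 1) = pi * of_int (p + q) / (a + 1) * i"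
      by (simp add: algebra_simps add_divide_distrib)
    finally have "sine a p i * sine a q i = 2 / (a + 1) * ((cos (pi * of_int (p - q) / (a + 1) * i)
        - cos (pi * of_int (p + q) / (a + 1) * i)) / 2)" .
    moreover have "2 / c * (z / 2) = 1 / c * z" for c z :: real by simp
    ultimately show ?thesis by (simp only:)
  qed
  then have eq: "(\<Sum>i\<in>{1..int a}. sine a p i * sine a q i)
      = 1 / (a + 1) * ((\<Sum>i\<in>{1..int a}. cos (pi * of_int (p - q) / (a + 1) * i))
        - (\<Sum>i\<in>{1..int a}. cos (pi * of_int (p + q) / (a + 1) * i)))"
    by (simp only: sum_distrib_left[symmetric] sum_subtractf)
  have re: "(\<Sum>i\<in>{1..int a}. cos (c * real_of_int i)) = (\<Sum>i=1..a. cos (c * real i))" for c :: real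
    by (rule sum.reindex_bij_witness[where i = int and j = nat]) auto
  have nd: "\<not> 2 * (int a + 1) dvd m" if "m \<noteq> 0" "\<bar>m\<bar> \<le> 2 * int a" for m :: int
    using zdvd_imp_le[of "2 * (int a + 1)" "\<bar>m\<bar>"] that by (cases "m < 0") auto
  have plus: "(\<Sum>i=1..a. cos (pi * of_int (p + q) / (a + 1) * real i)) = (if even (p + q) then - 1 else 0)"
    by (rule sum_cos_int, rule nd) (use p q in auto)
  \<comment> \<open>On the diagonal this sum is a while the other one is -1, because 2 p is even;
    the difference a + 1 cancels the normalization. Off the diagonal p - q and p + q have the same
    parity and the sums agree.\<close>
  have minus: "(\<Sum>i=1..a. cos (pi * of_int (p - q) / (a + 1) * real i))
      = (if p = q then real a else if even (p + q) then - 1 else 0)"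
  proof (cases "p = q")
    case False
    have "(\<Sum>i=1..a. cos (pi * of_int (p - q) / (a + 1) * real i)) = (if even (p - q) then - 1 else 0)"
      by (rule sum_cos_int, rule nd) (use p q False in auto)
    then show ?thesis using False by simp
  qed simp
  show ?thesis unfolding eq re plus minus by (simp add: field_simps)
qed

section \<open>Gaussian mixtures\<close>

text \<open>Completing the square: the tilted density is \<open>C\<close> times a normal density
  with variance divided by \<open>q\<close>, so the integral is \<open>C\<close>.\<close>

lemma nn_integral_normal_exp_quadratic:
  assumes s: "0 < s" and b: "0 \<le> b"
  shows "(\<integral>\<^sup>+x. ennreal (exp (a * x - b * x\<^sup>2 / 2)) \<partial>normal_law 0 s)
    = ennreal (exp (a\<^sup>2 * s\<^sup>2 / (2 * (1 + b * s\<^sup>2))) / sqrt (1 + b * s\<^sup>2))"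
proof -
  define q where "q = 1 + b * s\<^sup>2"
  have q: "0 < q" unfolding q_def using b by (intro add_pos_nonneg) auto
  define s' where "s' = s / sqrt q"
  have s': "0 < s'" "s'\<^sup>2 = s\<^sup>2 / q" using s q by (simp_all add: s'_def power_divide)
  define \<mu> where "\<mu> = a * s'\<^sup>2"
  define C where "C = exp (a\<^sup>2 * s\<^sup>2 / (2 * q)) / sqrt q"
  have eq: "normal_density 0 s x * exp (a * x - b * x\<^sup>2 / 2) = C * normal_density \<mu> s' x" for x
  proof -
    have "- (x - 0)\<^sup>2 / (2 * s\<^sup>2) + (a * x - b * x\<^sup>2 / 2) = a\<^sup>2 * s\<^sup>2 / (2 * q) + - (x - \<mu>)\<^sup>2 / (2 * s'\<^sup>2)"
    proof -
      have "- (x - \<mu>)\<^sup>2 / (2 * s'\<^sup>2) = - x\<^sup>2 * q / (2 * s\<^sup>2) + a * x - a\<^sup>2 * s\<^sup>2 / (2 * q)"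
        unfolding \<mu>_def s'(2) using s q by (simp add: field_simps power2_eq_square)
      moreover have "- x\<^sup>2 * q / (2 * s\<^sup>2) = - x\<^sup>2 / (2 * s\<^sup>2) - b * x\<^sup>2 / 2"
        using s by (simp add: q_def field_simps)
      ultimately show ?thesis by simp
    qed
    then have e: "exp (- (x - 0)\<^sup>2 / (2 * s\<^sup>2)) * exp (a * x - b * x\<^sup>2 / 2)
        = exp (a\<^sup>2 * s\<^sup>2 / (2 * q)) * exp (- (x - \<mu>)\<^sup>2 / (2 * s'\<^sup>2))"
      by (simp only: exp_add[symmetric])
    have "sqrt (2 * pi * s\<^sup>2) = sqrt q * sqrt (2 * pi * s'\<^sup>2)"
      unfolding real_sqrt_mult[symmetric] s'(2) using q by simp
    then have f: "1 / sqrt (2 * pi * s\<^sup>2) = 1 / sqrt q * (1 / sqrt (2 * pi * s'\<^sup>2))" by simp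
    have "normal_density 0 s x * exp (a * x - b * x\<^sup>2 / 2)
        = 1 / sqrt (2 * pi * s\<^sup>2) * (exp (- (x - 0)\<^sup>2 / (2 * s\<^sup>2)) * exp (a * x - b * x\<^sup>2 / 2))"
      by (simp add: normal_density_def)
    also have "\<dots> = C * normal_density \<mu> s' x"
      unfolding e f by (simp add: C_def normal_density_def)
    finally show ?thesis .
  qed
  have "(\<integral>\<^sup>+x. ennreal (exp (a * x - b * x\<^sup>2 / 2)) \<partial>normal_law 0 s)
      = (\<integral>\<^sup>+x. ennreal (normal_density 0 s x * exp (a * x - b * x\<^sup>2 / 2)) \<partial>lborel)"
    using s by (simp add: normal_law_def nn_integral_density ennreal_mult)
  also have "\<dots> = (\<integral>\<^sup>+x. ennreal C * ennreal (normal_density \<mu> s' x) \<partial>lborel)"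
    unfolding eq using q by (intro nn_integral_cong ennreal_mult) (auto simp: C_def)
  also have "\<dots> = ennreal C"
    using s' prob_space.emeasure_space_1[OF prob_space_normal_density[of s' \<mu>]]
    by (simp add: nn_integral_cmult emeasure_density)
  finally show ?thesis by (simp add: C_def q_def)
qed

lemma char_PiM_normal:
  assumes fin: "finite I" and v: "\<And>i. i \<in> I \<Longrightarrow> 0 \<le> v i"
  shows "(CLINT y|(\<Pi>\<^sub>M i\<in>I. normal_law 0 (v i)). iexp (\<Sum>i\<in>I. t i * y i))
    = complex_of_real (exp (- (\<Sum>i\<in>I. (t i)\<^sup>2 * (v i)\<^sup>2) / 2))"
proof -
  \<comment> \<open>The product locale asks for a sigma-finite measure at every index; outside
    \<open>I\<close> the value is arbitrary.\<close>
  define v' where "v' = (\<lambda>i. if i \<in> I then v i else 1)"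
  have v': "0 \<le> v' i" for i using v by (simp add: v'_def)
  interpret ps: product_sigma_finite "\<lambda>i. normal_law 0 (v' i)"
    unfolding product_sigma_finite_def using v'
    by (auto intro!: prob_space_imp_sigma_finite prob_space_normal_law)
  have "(CLINT y|(\<Pi>\<^sub>M i\<in>I. normal_law 0 (v i)). iexp (\<Sum>i\<in>I. t i * y i))
      = (CLINT y|(\<Pi>\<^sub>M i\<in>I. normal_law 0 (v' i)). \<Prod>i\<in>I. iexp (t i * y i))"
  proof (rule arg_cong2[where f = "integral\<^sup>L"])
    show "(\<Pi>\<^sub>M i\<in>I. normal_law 0 (v i)) = (\<Pi>\<^sub>M i\<in>I. normal_law 0 (v' i))"
      by (rule PiM_cong) (simp_all add: v'_def)
  qed (simp add: sum_distrib_left exp_sum[OF fin])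
  also have "\<dots> = (\<Prod>i\<in>I. CLINT x|normal_law 0 (v' i). iexp (t i * x))"
  proof (rule ps.product_integral_prod[OF fin])
    fix i assume "i \<in> I"
    interpret i: prob_space "normal_law 0 (v' i)" using v' by (rule prob_space_normal_law)
    show "integrable (normal_law 0 (v' i)) (\<lambda>x. iexp (t i * x))"
      by (rule i.integrable_iexp) auto
  qed
  also have "\<dots> = (\<Prod>i\<in>I. complex_of_real (exp (- ((t i)\<^sup>2 * (v i)\<^sup>2 / 2))))"
  proof (intro prod.cong refl)
    fix i assume "i \<in> I"
    then show "(CLINT x|normal_law 0 (v' i). iexp (t i * x)) = complex_of_real (exp (- ((t i)\<^sup>2 * (v i)\<^sup>2 / 2)))"
      using normal_law_char[of "v i" 0 "t i"] v[of i] by (simp add: v'_def)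
  qed
  also have "\<dots> = complex_of_real (exp (- (\<Sum>i\<in>I. (t i)\<^sup>2 * (v i)\<^sup>2) / 2))"
    unfolding of_real_prod[symmetric] exp_sum[OF fin, symmetric]
    by (simp add: sum_negf sum_divide_distrib)
  finally show ?thesis .
qed

lemma ennreal_integral_le:
  assumes "integrable M (f :: 'a \<Rightarrow> real)"
  shows "ennreal (integral\<^sup>L M f) \<le> (\<integral>\<^sup>+x. ennreal (f x) \<partial>M)"
proof -
  have "ennreal (integral\<^sup>L M f) \<le> ennreal (LINT x|M. max 0 (f x))"
    using assms by (intro ennreal_leI integral_mono integrable_max) auto
  also have "\<dots> = (\<integral>\<^sup>+x. ennreal (max 0 (f x)) \<partial>M)"
    using assms by (intro nn_integral_eq_integral[symmetric] integrable_max) auto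
  finally show ?thesis by (simp add: ennreal_max_0')
qed

text \<open>Models an observation whose coordinates are a random shift \<open>h\<close> plus
  independent centred normals of variance \<open>\<sigma>\<^sup>2 * (1 + g i)\<close>. Here
  \<open>g\<close> is the signal-to-noise ratio of the part that the basis diagonalizes, and
  \<open>h\<close> is the remainder, with an arbitrary joint law.\<close>

locale gauss_mixture = prob_space M for M :: "'a measure" +
  fixes I :: "'i set" and \<sigma> :: real and g :: "'i \<Rightarrow> real" and h :: "'i \<Rightarrow> 'a \<Rightarrow> real"
  assumes fin: "finite I" and sigma: "0 < \<sigma>" and g: "\<And>i. i \<in> I \<Longrightarrow> 0 \<le> g i"
    and h: "\<And>i. i \<in> I \<Longrightarrow> h i \<in> borel_measurable M"
begin

definition sd :: "'i \<Rightarrow> real" where "sd i = \<sigma> * sqrt (1 + g i)"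

definition null :: "('i \<Rightarrow> real) measure" where
  "null = (\<Pi>\<^sub>M i\<in>I. normal_law 0 \<sigma>)"

text \<open>The likelihood ratio against the null hypothesis when only the variances are
  changed.\<close>

definition tilt :: "('i \<Rightarrow> real) \<Rightarrow> real" where
  "tilt y = (\<Prod>i\<in>I. exp ((y i)\<^sup>2 / (2 * \<sigma>\<^sup>2) * (g i / (1 + g i))) / sqrt (1 + g i))"

text \<open>The likelihood ratio of a shift by \<open>h\<close> at the changed variances, averaged
  over the shift.\<close>

definition mix :: "('i \<Rightarrow> real) \<Rightarrow> ennreal" where
  "mix y = (\<integral>\<^sup>+\<omega>. ennreal (exp (\<Sum>i\<in>I. (y i * h i \<omega> - (h i \<omega>)\<^sup>2 / 2) / (sd i)\<^sup>2)) \<partial>M)"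

definition lik :: "('i \<Rightarrow> real) \<Rightarrow> ennreal" where
  "lik y = ennreal (tilt y) * mix y"

lemma sd_pos: "i \<in> I \<Longrightarrow> 0 < sd i"
  using sigma g[of i] by (simp add: sd_def)

lemma sd_square: "i \<in> I \<Longrightarrow> (sd i)\<^sup>2 = \<sigma>\<^sup>2 * (1 + g i)"
  using g[of i] by (simp add: sd_def power_mult_distrib)

lemma sets_null[simp, measurable_cong]: "sets null = sets (\<Pi>\<^sub>M i\<in>I. borel)"
  unfolding null_def by (rule sets_PiM_cong) simp_all

lemma prob_space_null: "prob_space null"
  unfolding null_def using sigma by (intro prob_space_PiM prob_space_normal_law) simp

lemma tilt_pos: "0 < tilt y"
  unfolding tilt_def using g by (intro prod_pos) (simp add: add_pos_nonneg)

lemma tilt_measurable[measurable]: "tilt \<in> borel_measurable (\<Pi>\<^sub>M i\<in>I. borel)"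
  unfolding tilt_def by measurable

lemma mix_integrand_measurable:
  "(\<lambda>(y, \<omega>). ennreal (exp (\<Sum>i\<in>I. (y i * h i \<omega> - (h i \<omega>)\<^sup>2 / 2) / (sd i)\<^sup>2)))
    \<in> borel_measurable ((\<Pi>\<^sub>M i\<in>I. borel) \<Otimes>\<^sub>M M)"
proof -
  note [measurable] = h
  show ?thesis by measurable
qed

lemma mix_measurable[measurable]: "mix \<in> borel_measurable (\<Pi>\<^sub>M i\<in>I. borel)"
  unfolding mix_def using borel_measurable_nn_integral_fst[OF mix_integrand_measurable] by simp

lemma lik_measurable[measurable]: "lik \<in> borel_measurable (\<Pi>\<^sub>M i\<in>I. borel)"
  unfolding lik_def by measurable

lemma component_density:
  assumes i: "i \<in> I"
  shows "normal_density m (sd i) y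
    = normal_density 0 \<sigma> y * (exp (y\<^sup>2 / (2 * \<sigma>\<^sup>2) * (g i / (1 + g i))) / sqrt (1 + g i)
        * exp ((y * m - m\<^sup>2 / 2) / (sd i)\<^sup>2))"
proof -
  define q where "q = 1 + g i"
  have q: "0 < q" "g i = q - 1" using g[OF i] by (auto simp: q_def)
  have s2: "(sd i)\<^sup>2 = \<sigma>\<^sup>2 * q" using sd_square[OF i] by (simp add: q_def)
  have "- (y - m)\<^sup>2 / (2 * (\<sigma>\<^sup>2 * q)) = - (y - 0)\<^sup>2 / (2 * \<sigma>\<^sup>2) + y\<^sup>2 / (2 * \<sigma>\<^sup>2) * ((q - 1) / q)
      + (y * m - m\<^sup>2 / 2) / (\<sigma>\<^sup>2 * q)"
    using q(1) sigma by (simp add: field_simps power2_eq_square)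
  then have e: "exp (- (y - m)\<^sup>2 / (2 * (\<sigma>\<^sup>2 * q))) = exp (- (y - 0)\<^sup>2 / (2 * \<sigma>\<^sup>2)) * exp (y\<^sup>2 / (2 * \<sigma>\<^sup>2) * ((q - 1) / q))
      * exp ((y * m - m\<^sup>2 / 2) / (\<sigma>\<^sup>2 * q))" by (simp only: exp_add)
  have "sqrt (2 * pi * (\<sigma>\<^sup>2 * q)) = sqrt (2 * pi * \<sigma>\<^sup>2) * sqrt q"
    unfolding real_sqrt_mult[symmetric] by (simp add: mult.assoc)
  then have f: "1 / sqrt (2 * pi * (\<sigma>\<^sup>2 * q)) = 1 / sqrt (2 * pi * \<sigma>\<^sup>2) * (1 / sqrt q)" by simp
  show ?thesis unfolding normal_density_def s2 e f q_def[symmetric] q(2) by simp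
qed

lemma lik_eq: "lik y = (\<integral>\<^sup>+\<omega>. (\<Prod>i\<in>I. ennreal (exp ((y i)\<^sup>2 / (2 * \<sigma>\<^sup>2) * (g i / (1 + g i))) / sqrt (1 + g i)
        * exp ((y i * h i \<omega> - (h i \<omega>)\<^sup>2 / 2) / (sd i)\<^sup>2))) \<partial>M)"
proof -
  note [measurable] = h
  have "lik y = (\<integral>\<^sup>+\<omega>. ennreal (tilt y) * ennreal (exp (\<Sum>i\<in>I. (y i * h i \<omega> - (h i \<omega>)\<^sup>2 / 2) / (sd i)\<^sup>2)) \<partial>M)"
    unfolding lik_def mix_def by (rule nn_integral_cmult[symmetric]) measurable
  also have "\<dots> = (\<integral>\<^sup>+\<omega>. (\<Prod>i\<in>I. ennreal (exp ((y i)\<^sup>2 / (2 * \<sigma>\<^sup>2) * (g i / (1 + g i))) / sqrt (1 + g i)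
        * exp ((y i * h i \<omega> - (h i \<omega>)\<^sup>2 / 2) / (sd i)\<^sup>2))) \<partial>M)"
  proof (rule nn_integral_cong)
    fix \<omega>
    have "ennreal (tilt y) * ennreal (exp (\<Sum>i\<in>I. (y i * h i \<omega> - (h i \<omega>)\<^sup>2 / 2) / (sd i)\<^sup>2))
        = ennreal (tilt y * exp (\<Sum>i\<in>I. (y i * h i \<omega> - (h i \<omega>)\<^sup>2 / 2) / (sd i)\<^sup>2))"
      using tilt_pos[of y] by (simp add: ennreal_mult less_imp_le)
    also have "tilt y * exp (\<Sum>i\<in>I. (y i * h i \<omega> - (h i \<omega>)\<^sup>2 / 2) / (sd i)\<^sup>2)
        = (\<Prod>i\<in>I. exp ((y i)\<^sup>2 / (2 * \<sigma>\<^sup>2) * (g i / (1 + g i))) / sqrt (1 + g i)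
        * exp ((y i * h i \<omega> - (h i \<omega>)\<^sup>2 / 2) / (sd i)\<^sup>2))"
      unfolding tilt_def exp_sum[OF fin] by (simp only: prod.distrib)
    also have "ennreal \<dots> = (\<Prod>i\<in>I. ennreal (exp ((y i)\<^sup>2 / (2 * \<sigma>\<^sup>2) * (g i / (1 + g i))) / sqrt (1 + g i)
        * exp ((y i * h i \<omega> - (h i \<omega>)\<^sup>2 / 2) / (sd i)\<^sup>2)))"
      using g by (intro prod_ennreal[symmetric]) (simp add: add_nonneg_nonneg)
    finally show "ennreal (tilt y) * ennreal (exp (\<Sum>i\<in>I. (y i * h i \<omega> - (h i \<omega>)\<^sup>2 / 2) / (sd i)\<^sup>2)) = \<dots>" .
  qed
  finally show ?thesis .
qed

lemma component_emeasure:
  assumes i: "i \<in> I" and [measurable]: "A \<in> sets borel"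
  shows "(\<integral>\<^sup>+y. ennreal (exp (y\<^sup>2 / (2 * \<sigma>\<^sup>2) * (g i / (1 + g i))) / sqrt (1 + g i)
        * exp ((y * m - m\<^sup>2 / 2) / (sd i)\<^sup>2)) * indicator A y \<partial>normal_law 0 \<sigma>)
    = (\<integral>\<^sup>+v. indicator A (m + v) \<partial>normal_law 0 (sd i))"
proof -
  have "(\<integral>\<^sup>+v. indicator A (m + v) \<partial>normal_law 0 (sd i)) = (\<integral>\<^sup>+y. indicator A y \<partial>distr (normal_law 0 (sd i)) borel (\<lambda>v. m + v))"
    by (subst nn_integral_distr) auto
  also have "distr (normal_law 0 (sd i)) borel (\<lambda>v. m + v) = normal_law m (sd i)"
    using sd_pos[OF i] by (simp add: normal_law_eq_distr distr_distr comp_def)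
  also have "(\<integral>\<^sup>+y. indicator A y \<partial>normal_law m (sd i)) = (\<integral>\<^sup>+y. ennreal (normal_density m (sd i) y) * indicator A y \<partial>lborel)"
    using sd_pos[OF i] by (simp add: normal_law_def emeasure_density)
  also have "\<dots> = (\<integral>\<^sup>+y. ennreal (normal_density 0 \<sigma> y) * (ennreal (exp (y\<^sup>2 / (2 * \<sigma>\<^sup>2) * (g i / (1 + g i))) / sqrt (1 + g i)
        * exp ((y * m - m\<^sup>2 / 2) / (sd i)\<^sup>2)) * indicator A y) \<partial>lborel)"
    unfolding component_density[OF i] using g[OF i]
    by (subst ennreal_mult) (simp_all only: mult.assoc normal_density_nonneg, simp_all)
  also have "\<dots> = (\<integral>\<^sup>+y. ennreal (exp (y\<^sup>2 / (2 * \<sigma>\<^sup>2) * (g i / (1 + g i))) / sqrt (1 + g i)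
        * exp ((y * m - m\<^sup>2 / 2) / (sd i)\<^sup>2)) * indicator A y \<partial>normal_law 0 \<sigma>)"
    unfolding normal_law_def using sigma by (simp add: nn_integral_density)
  finally show ?thesis by simp
qed

definition mixture :: "('i \<Rightarrow> real) measure" where
  "mixture = distr (M \<Otimes>\<^sub>M (\<Pi>\<^sub>M i\<in>I. normal_law 0 (sd i))) (\<Pi>\<^sub>M i\<in>I. borel) (\<lambda>(\<omega>, v). \<lambda>i\<in>I. h i \<omega> + v i)"

lemma prob_space_noise: "prob_space (\<Pi>\<^sub>M i\<in>I. normal_law 0 (sd i))"
proof (rule prob_space_PiM)
  show "prob_space (normal_law 0 (sd i))" if "i \<in> I" for i
    using sd_pos[OF that] by (intro prob_space_normal_law) simp
qed

lemma sets_noise[measurable_cong]: "sets (\<Pi>\<^sub>M i\<in>I. normal_law 0 (sd i)) = sets (\<Pi>\<^sub>M i\<in>I. borel)"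
  by (rule sets_PiM_cong) simp_all

lemma mixture_map_measurable[measurable]:
  "(\<lambda>(\<omega>, v). \<lambda>i\<in>I. h i \<omega> + v i) \<in> M \<Otimes>\<^sub>M (\<Pi>\<^sub>M i\<in>I. normal_law 0 (sd i)) \<rightarrow>\<^sub>M (\<Pi>\<^sub>M i\<in>I. borel)"
proof -
  note [measurable] = h
  show ?thesis by measurable
qed

lemma prob_space_mixture: "prob_space mixture"
proof -
  interpret V: prob_space "\<Pi>\<^sub>M i\<in>I. normal_law 0 (sd i)" by (rule prob_space_noise)
  interpret p: pair_prob_space M "\<Pi>\<^sub>M i\<in>I. normal_law 0 (sd i)" ..
  show ?thesis unfolding mixture_def by (rule p.P.prob_space_distr) measurable
qed

lemma normal_sigma_finite: "product_sigma_finite (\<lambda>i. normal_law 0 (if i \<in> I then sd i else 1))"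
  unfolding product_sigma_finite_def using sd_pos
  by (auto intro!: prob_space_imp_sigma_finite prob_space_normal_law simp: less_imp_le)

text \<open>Given the sample point of the shift the coordinates are independent, so on boxes
  everything factorizes over coordinates; Fubini exchanges the average over shifts with the integral
  over observations.\<close>

lemma mixture_eq_density: "mixture = density null lik"
proof (rule measure_eqI_PiM_finite[OF fin, where A = "\<lambda>_. (\<Pi>\<^sub>E i\<in>I. UNIV)"])
  interpret V: prob_space "\<Pi>\<^sub>M i\<in>I. normal_law 0 (sd i)" by (rule prob_space_noise)
  interpret p: pair_prob_space M "\<Pi>\<^sub>M i\<in>I. normal_law 0 (sd i)" ..
  interpret Q: prob_space mixture by (rule prob_space_mixture)
  interpret N: prob_space null by (rule prob_space_null)
  interpret n: pair_prob_space null M ..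
  note [measurable] = h
  show "sets mixture = sets (\<Pi>\<^sub>M i\<in>I. borel)" "sets (density null lik) = sets (\<Pi>\<^sub>M i\<in>I. borel)"
    by (simp_all add: mixture_def)
  show "range (\<lambda>_::nat. \<Pi>\<^sub>E i\<in>I. UNIV) \<subseteq> prod_algebra I (\<lambda>_. borel)"
    using fin by (auto intro!: prod_algebraI_finite)
  show "(\<Union>i::nat. \<Pi>\<^sub>E i\<in>I. UNIV) = space (\<Pi>\<^sub>M i\<in>I. borel)" by (auto simp: space_PiM)
  show "emeasure mixture (\<Pi>\<^sub>E i\<in>I. UNIV) \<noteq> \<infinity>" for i :: nat by simp
  fix A assume A: "\<And>i. i \<in> I \<Longrightarrow> A i \<in> sets (borel :: real measure)"
  note [measurable] = A
  have mA[measurable]: "Pi\<^sub>E I A \<in> sets (\<Pi>\<^sub>M i\<in>I. borel)" using A fin by (intro sets_PiM_I_finite) auto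
  have ind: "indicator (Pi\<^sub>E I A) y = (\<Prod>i\<in>I. indicator (A i) (y i) :: ennreal)" if "y \<in> (\<Pi>\<^sub>E i\<in>I. UNIV)" for y
    using that fin by (auto simp: indicator_def PiE_iff prod_zero_iff)
  have indr: "indicator (Pi\<^sub>E I A) (\<lambda>i\<in>I. y i) = (\<Prod>i\<in>I. indicator (A i) (y i) :: ennreal)" for y
    by (subst ind) auto
  define d where "d = (\<lambda>i m y. ennreal (exp (y\<^sup>2 / (2 * \<sigma>\<^sup>2) * (g i / (1 + g i))) / sqrt (1 + g i)
        * exp ((y * m - m\<^sup>2 / 2) / (sd i)\<^sup>2)))"
  interpret ps: product_sigma_finite "\<lambda>i. normal_law 0 (if i \<in> I then sd i else 1)"
    by (rule normal_sigma_finite)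
  interpret ps0: product_sigma_finite "\<lambda>i. normal_law 0 \<sigma>"
    unfolding product_sigma_finite_def using sigma
    by (auto intro!: prob_space_imp_sigma_finite prob_space_normal_law)
  have PiM_if: "(\<Pi>\<^sub>M i\<in>I. normal_law 0 (if i \<in> I then sd i else 1)) = (\<Pi>\<^sub>M i\<in>I. normal_law 0 (sd i))"
    by (rule PiM_cong) simp_all
  have "emeasure mixture (Pi\<^sub>E I A) = (\<integral>\<^sup>+y. indicator (Pi\<^sub>E I A) y \<partial>mixture)"
    by (simp add: mixture_def)
  also have "\<dots> = (\<integral>\<^sup>+p. (case p of (\<omega>, v) \<Rightarrow> \<Prod>i\<in>I. indicator (A i) (h i \<omega> + v i)) \<partial>(M \<Otimes>\<^sub>M (\<Pi>\<^sub>M i\<in>I. normal_law 0 (sd i))))"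
    unfolding mixture_def by (subst nn_integral_distr) (auto intro!: nn_integral_cong simp: indr split_beta')
  also have "\<dots> = (\<integral>\<^sup>+\<omega>. \<integral>\<^sup>+v. (\<Prod>i\<in>I. indicator (A i) (h i \<omega> + v i)) \<partial>(\<Pi>\<^sub>M i\<in>I. normal_law 0 (sd i)) \<partial>M)"
    by (subst V.nn_integral_fst[symmetric]) (simp_all, measurable)
  also have "\<dots> = (\<integral>\<^sup>+\<omega>. (\<Prod>i\<in>I. (\<integral>\<^sup>+v. indicator (A i) (h i \<omega> + v) \<partial>normal_law 0 (sd i))) \<partial>M)"
  proof (rule nn_integral_cong)
    fix \<omega>
    have "(\<integral>\<^sup>+v. (\<Prod>i\<in>I. indicator (A i) (h i \<omega> + v i)) \<partial>(\<Pi>\<^sub>M i\<in>I. normal_law 0 (if i \<in> I then sd i else 1)))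
        = (\<Prod>i\<in>I. (\<integral>\<^sup>+v. indicator (A i) (h i \<omega> + v) \<partial>normal_law 0 (if i \<in> I then sd i else 1)))"
      using fin by (rule ps.product_nn_integral_prod) measurable
    then show "(\<integral>\<^sup>+v. (\<Prod>i\<in>I. indicator (A i) (h i \<omega> + v i)) \<partial>(\<Pi>\<^sub>M i\<in>I. normal_law 0 (sd i)))
        = (\<Prod>i\<in>I. (\<integral>\<^sup>+v. indicator (A i) (h i \<omega> + v) \<partial>normal_law 0 (sd i)))"
      unfolding PiM_if by simp
  qed
  also have "\<dots> = (\<integral>\<^sup>+\<omega>. (\<Prod>i\<in>I. (\<integral>\<^sup>+y. d i (h i \<omega>) y * indicator (A i) y \<partial>normal_law 0 \<sigma>)) \<partial>M)"
    unfolding d_def by (intro nn_integral_cong prod.cong refl component_emeasure[symmetric] A)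
  also have "\<dots> = (\<integral>\<^sup>+\<omega>. \<integral>\<^sup>+y. (\<Prod>i\<in>I. d i (h i \<omega>) (y i) * indicator (A i) (y i)) \<partial>null \<partial>M)"
    unfolding null_def by (intro nn_integral_cong ps0.product_nn_integral_prod[OF fin, symmetric])
      (simp add: d_def, measurable)
  also have "\<dots> = (\<integral>\<^sup>+y. \<integral>\<^sup>+\<omega>. (\<Prod>i\<in>I. d i (h i \<omega>) (y i) * indicator (A i) (y i)) \<partial>M \<partial>null)"
    by (rule n.Fubini') (simp add: d_def, measurable)
  also have "\<dots> = (\<integral>\<^sup>+y. lik y * indicator (Pi\<^sub>E I A) y \<partial>null)"
  proof (rule nn_integral_cong)
    fix y assume y: "y \<in> space null"
    have "(\<integral>\<^sup>+\<omega>. (\<Prod>i\<in>I. d i (h i \<omega>) (y i) * indicator (A i) (y i)) \<partial>M)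
        = (\<integral>\<^sup>+\<omega>. (\<Prod>i\<in>I. d i (h i \<omega>) (y i)) * indicator (Pi\<^sub>E I A) y \<partial>M)"
      using y by (simp add: prod.distrib ind null_def space_PiM)
    also have "\<dots> = (\<integral>\<^sup>+\<omega>. (\<Prod>i\<in>I. d i (h i \<omega>) (y i)) \<partial>M) * indicator (Pi\<^sub>E I A) y"
      by (rule nn_integral_multc) (simp add: d_def, measurable)
    finally show "(\<integral>\<^sup>+\<omega>. (\<Prod>i\<in>I. d i (h i \<omega>) (y i) * indicator (A i) (y i)) \<partial>M) = lik y * indicator (Pi\<^sub>E I A) y"
      by (simp only: lik_eq d_def)
  qed
  also have "\<dots> = emeasure (density null lik) (Pi\<^sub>E I A)"
    by (rule emeasure_density[symmetric]) measurable
  finally show "emeasure mixture (Pi\<^sub>E I A) = emeasure (density null lik) (Pi\<^sub>E I A)" .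
qed

lemma mixture_char:
  "(CLINT y|mixture. iexp (\<Sum>i\<in>I. t i * y i))
    = (CLINT \<omega>|M. iexp (\<Sum>i\<in>I. t i * h i \<omega>)) * complex_of_real (exp (- (\<Sum>i\<in>I. (t i)\<^sup>2 * (sd i)\<^sup>2) / 2))"
proof -
  interpret V: prob_space "\<Pi>\<^sub>M i\<in>I. normal_law 0 (sd i)" by (rule prob_space_noise)
  interpret p: pair_prob_space M "\<Pi>\<^sub>M i\<in>I. normal_law 0 (sd i)" ..
  note [measurable] = h
  define V where "V = (\<Pi>\<^sub>M i\<in>I. normal_law 0 (sd i))"
  have [measurable_cong]: "sets V = sets (\<Pi>\<^sub>M i\<in>I. borel)" unfolding V_def by (rule sets_noise)
  have int: "integrable (M \<Otimes>\<^sub>M V) (\<lambda>p. iexp (\<Sum>i\<in>I. t i * h i (fst p)) * iexp (\<Sum>i\<in>I. t i * snd p i))"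
    unfolding V_def by (rule p.P.integrable_const_bound[where B = 1]) (auto simp: norm_mult)
  have "(CLINT y|mixture. iexp (\<Sum>i\<in>I. t i * y i))
      = (CLINT p|(M \<Otimes>\<^sub>M V). iexp (\<Sum>i\<in>I. t i * h i (fst p)) * iexp (\<Sum>i\<in>I. t i * snd p i))"
    unfolding mixture_def V_def
    by (subst integral_distr)
       (auto intro!: Bochner_Integration.integral_cong simp: exp_add[symmetric] distrib_left sum.distrib split_beta')
  also have "\<dots> = (CLINT \<omega>|M. CLINT v|V. iexp (\<Sum>i\<in>I. t i * h i \<omega>) * iexp (\<Sum>i\<in>I. t i * v i))"
    using p.integral_fst'[OF int[unfolded V_def]] by (simp add: V_def)
  also have "\<dots> = (CLINT \<omega>|M. iexp (\<Sum>i\<in>I. t i * h i \<omega>)) * (CLINT v|V. iexp (\<Sum>i\<in>I. t i * v i))"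
    by simp
  also have "(CLINT v|V. iexp (\<Sum>i\<in>I. t i * v i)) = complex_of_real (exp (- (\<Sum>i\<in>I. (t i)\<^sup>2 * (sd i)\<^sup>2) / 2))"
    unfolding V_def using fin sd_pos by (intro char_PiM_normal) (auto intro: less_imp_le)
  finally show ?thesis .
qed

text \<open>The tilted noise has covariance at least that of the null hypothesis, so on average the
  mixture over the shifts \<open>h\<close> does not raise the likelihood ratio.\<close>

lemma nn_integral_mix_le: "(\<integral>\<^sup>+y. mix y \<partial>null) \<le> 1"
proof -
  interpret N: prob_space null by (rule prob_space_null)
  interpret n: pair_prob_space null M ..
  interpret ps0: product_sigma_finite "\<lambda>i. normal_law 0 \<sigma>"
    unfolding product_sigma_finite_def using sigma
    by (auto intro!: prob_space_imp_sigma_finite prob_space_normal_law)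
  note [measurable] = h
  have "(\<integral>\<^sup>+y. mix y \<partial>null)
      = (\<integral>\<^sup>+\<omega>. \<integral>\<^sup>+y. ennreal (exp (\<Sum>i\<in>I. (y i * h i \<omega> - (h i \<omega>)\<^sup>2 / 2) / (sd i)\<^sup>2)) \<partial>null \<partial>M)"
    unfolding mix_def by (rule n.Fubini'[symmetric]) measurable
  also have "\<dots> \<le> (\<integral>\<^sup>+\<omega>. 1 \<partial>M)"
  proof (rule nn_integral_mono)
    fix \<omega>
    have one: "(\<integral>\<^sup>+x. ennreal (exp ((x * m - m\<^sup>2 / 2) / (sd i)\<^sup>2)) \<partial>normal_law 0 \<sigma>) \<le> 1" if i: "i \<in> I" for i m
    proof -
      have s: "0 < sd i" by (rule sd_pos[OF i])
      \<comment> \<open>This is where \<open>g\<close> being nonnegative enters: the expectation of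
        one factor has exponent a nonnegative multiple of
        \<open>\<sigma>\<^sup>2 / (sd i)\<^sup>2 - 1\<close>.\<close>
      have le: "\<sigma>\<^sup>2 / (sd i)\<^sup>2 \<le> 1"
        using sigma g[OF i] by (simp add: sd_square[OF i] divide_le_eq mult_le_cancel_left1)
      have "(\<integral>\<^sup>+x. ennreal (exp ((x * m - m\<^sup>2 / 2) / (sd i)\<^sup>2)) \<partial>normal_law 0 \<sigma>)
          = (\<integral>\<^sup>+x. ennreal (exp (- (m\<^sup>2 / 2 / (sd i)\<^sup>2))) * ennreal (exp (m / (sd i)\<^sup>2 * x - 0 * x\<^sup>2 / 2)) \<partial>normal_law 0 \<sigma>)"
        by (simp add: ennreal_mult[symmetric] exp_add[symmetric] diff_divide_distrib mult.commute)
      also have "\<dots> = ennreal (exp (- (m\<^sup>2 / 2 / (sd i)\<^sup>2))) * ennreal (exp ((m / (sd i)\<^sup>2)\<^sup>2 * \<sigma>\<^sup>2 / 2))"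
        by (subst nn_integral_cmult, simp)
           (simp only: nn_integral_normal_exp_quadratic[OF sigma order_refl], simp)
      also have "\<dots> = ennreal (exp (m\<^sup>2 / 2 / (sd i)\<^sup>2 * (\<sigma>\<^sup>2 / (sd i)\<^sup>2 - 1)))"
        using s by (simp add: ennreal_mult[symmetric] exp_add[symmetric] power_divide right_diff_distrib power2_eq_square)
      also have "\<dots> \<le> 1"
      proof -
        have "m\<^sup>2 / 2 / (sd i)\<^sup>2 * (\<sigma>\<^sup>2 / (sd i)\<^sup>2 - 1) \<le> 0"
          using le by (intro mult_nonneg_nonpos) auto
        then show ?thesis by (simp only: ennreal_le_1 exp_le_one_iff)
      qed
      finally show ?thesis .
    qed
    have "(\<integral>\<^sup>+y. ennreal (exp (\<Sum>i\<in>I. (y i * h i \<omega> - (h i \<omega>)\<^sup>2 / 2) / (sd i)\<^sup>2)) \<partial>null)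
        = (\<integral>\<^sup>+y. (\<Prod>i\<in>I. ennreal (exp ((y i * h i \<omega> - (h i \<omega>)\<^sup>2 / 2) / (sd i)\<^sup>2))) \<partial>null)"
      by (simp add: exp_sum[OF fin] prod_ennreal)
    also have "\<dots> = (\<Prod>i\<in>I. (\<integral>\<^sup>+x. ennreal (exp ((x * h i \<omega> - (h i \<omega>)\<^sup>2 / 2) / (sd i)\<^sup>2)) \<partial>normal_law 0 \<sigma>))"
      unfolding null_def by (rule ps0.product_nn_integral_prod[OF fin]) measurable
    also have "\<dots> \<le> (\<Prod>i\<in>I. 1)"
      using one by (intro prod_mono_ennreal) auto
    finally show "(\<integral>\<^sup>+y. ennreal (exp (\<Sum>i\<in>I. (y i * h i \<omega> - (h i \<omega>)\<^sup>2 / 2) / (sd i)\<^sup>2)) \<partial>null) \<le> 1" by simp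
  qed
  finally show ?thesis by (simp add: emeasure_space_1)
qed

text \<open>Jensen's inequality for the centred shifts, via \<open>e\<^sup>x \<ge> e\<^sup>m (1 + x - m)\<close>.\<close>

lemma mix_ge_Jensen:
  assumes i: "\<And>i. i \<in> I \<Longrightarrow> integrable M (h i)" "\<And>i. i \<in> I \<Longrightarrow> integrable M (\<lambda>\<omega>. (h i \<omega>)\<^sup>2)"
    and mean: "\<And>i. i \<in> I \<Longrightarrow> integral\<^sup>L M (h i) = 0"
  shows "ennreal (exp (- ((\<Sum>i\<in>I. LINT \<omega>|M. (h i \<omega>)\<^sup>2) / (2 * \<sigma>\<^sup>2)))) \<le> mix y"
proof -
  note [measurable] = h
  define Z where "Z = (\<lambda>\<omega>. \<Sum>i\<in>I. (y i * h i \<omega> - (h i \<omega>)\<^sup>2 / 2) / (sd i)\<^sup>2)"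
  define m where "m = (LINT \<omega>|M. Z \<omega>)"
  have Zi: "integrable M Z" unfolding Z_def using i by simp
  \<comment> \<open>Centring removes the term linear in \<open>y\<close>, so the resulting lower
    bound is uniform in the observation.\<close>
  have "m = (\<Sum>i\<in>I. (y i * integral\<^sup>L M (h i) - (LINT \<omega>|M. (h i \<omega>)\<^sup>2) / 2) / (sd i)\<^sup>2)"
    unfolding m_def Z_def using i by (subst Bochner_Integration.integral_sum) auto
  also have "\<dots> = (\<Sum>i\<in>I. - ((LINT \<omega>|M. (h i \<omega>)\<^sup>2) / (2 * (sd i)\<^sup>2)))"
    using mean by (intro sum.cong) auto
  finally have m: "m = (\<Sum>i\<in>I. - ((LINT \<omega>|M. (h i \<omega>)\<^sup>2) / (2 * (sd i)\<^sup>2)))" .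
  have "(\<Sum>i\<in>I. - ((LINT \<omega>|M. (h i \<omega>)\<^sup>2) / (2 * \<sigma>\<^sup>2))) \<le> m"
    unfolding m
  proof (rule sum_mono)
    fix i assume i: "i \<in> I"
    have "\<sigma>\<^sup>2 \<le> (sd i)\<^sup>2" using sigma g[OF i] by (simp add: sd_square[OF i] mult_le_cancel_left1)
    then show "- ((LINT \<omega>|M. (h i \<omega>)\<^sup>2) / (2 * \<sigma>\<^sup>2)) \<le> - ((LINT \<omega>|M. (h i \<omega>)\<^sup>2) / (2 * (sd i)\<^sup>2))"
      using sigma sd_pos[OF i] by (intro le_imp_neg_le divide_left_mono) auto
  qed
  then have le: "- ((\<Sum>i\<in>I. LINT \<omega>|M. (h i \<omega>)\<^sup>2) / (2 * \<sigma>\<^sup>2)) \<le> m"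
    by (simp add: sum_negf sum_divide_distrib)
  have mixZ: "mix y = (\<integral>\<^sup>+\<omega>. ennreal (exp (Z \<omega>)) \<partial>M)" by (simp add: mix_def Z_def)
  have int: "integrable M (\<lambda>\<omega>. exp m * (1 + (Z \<omega> - m)))" using Zi by simp
  have "ennreal (exp m) = ennreal (LINT \<omega>|M. exp m * (1 + (Z \<omega> - m)))"
    using Zi by (simp add: m_def[symmetric] prob_space)
  also have "\<dots> \<le> (\<integral>\<^sup>+\<omega>. ennreal (exp m * (1 + (Z \<omega> - m))) \<partial>M)"
    by (rule ennreal_integral_le[OF int])
  also have "\<dots> \<le> mix y"
    unfolding mixZ
  proof (intro nn_integral_mono ennreal_leI)
    fix \<omega>
    have "exp m * (1 + (Z \<omega> - m)) \<le> exp m * exp (Z \<omega> - m)"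
      by (intro mult_left_mono exp_ge_add_one_self) simp
    then show "exp m * (1 + (Z \<omega> - m)) \<le> exp (Z \<omega>)" by (simp add: exp_add[symmetric])
  qed
  finally have "ennreal (exp m) \<le> mix y" .
  then show ?thesis using le by (meson ennreal_leI exp_le_cancel_iff order_trans)
qed

text \<open>For a common amplitude the total variance is proportional to the number of sites, so
  Jensen's bound would cost a fixed exponential rate. The average is instead a one-dimensional
  Gaussian integral; dropping its exponential factor, which is at least one, leaves an inverse
  square root.\<close>

lemma mix_ge_common:
  assumes Z[measurable]: "Z \<in> borel_measurable M" and law: "distr M borel Z = normal_law 0 v" and v: "0 < v"
    and ae: "\<And>i. i \<in> I \<Longrightarrow> AE \<omega> in M. h i \<omega> = Z \<omega>" and g0: "\<And>i. i \<in> I \<Longrightarrow> g i = 0"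
  shows "ennreal (1 / sqrt (1 + card I / \<sigma>\<^sup>2 * v\<^sup>2)) \<le> mix y"
proof -
  define a where "a = (\<Sum>i\<in>I. y i) / \<sigma>\<^sup>2"
  define b where "b = card I / \<sigma>\<^sup>2"
  have "AE \<omega> in M. \<forall>i\<in>I. h i \<omega> = Z \<omega>"
    using fin ae by (simp add: AE_finite_all)
  then have "AE \<omega> in M. ennreal (exp (\<Sum>i\<in>I. (y i * h i \<omega> - (h i \<omega>)\<^sup>2 / 2) / (sd i)\<^sup>2)) = ennreal (exp (a * Z \<omega> - b * (Z \<omega>)\<^sup>2 / 2))"
  proof eventually_elim
    case (elim \<omega>)
    have "(\<Sum>i\<in>I. (y i * h i \<omega> - (h i \<omega>)\<^sup>2 / 2) / (sd i)\<^sup>2) = (\<Sum>i\<in>I. (y i * Z \<omega> - (Z \<omega>)\<^sup>2 / 2) / \<sigma>\<^sup>2)"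
      using elim g0 by (intro sum.cong) (auto simp: sd_square)
    also have "\<dots> = a * Z \<omega> - b * (Z \<omega>)\<^sup>2 / 2"
      by (simp add: a_def b_def sum_divide_distrib[symmetric] sum_subtractf sum_distrib_right[symmetric]
          diff_divide_distrib)
    finally show ?case by simp
  qed
  then have "mix y = (\<integral>\<^sup>+\<omega>. ennreal (exp (a * Z \<omega> - b * (Z \<omega>)\<^sup>2 / 2)) \<partial>M)"
    unfolding mix_def by (rule nn_integral_cong_AE)
  also have "\<dots> = (\<integral>\<^sup>+x. ennreal (exp (a * x - b * x\<^sup>2 / 2)) \<partial>normal_law 0 v)"
    unfolding law[symmetric] by (subst nn_integral_distr) auto
  also have "\<dots> = ennreal (exp (a\<^sup>2 * v\<^sup>2 / (2 * (1 + b * v\<^sup>2))) / sqrt (1 + b * v\<^sup>2))"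
    using v by (intro nn_integral_normal_exp_quadratic) (auto simp: b_def)
  also have "\<dots> \<ge> ennreal (1 / sqrt (1 + b * v\<^sup>2))"
    by (intro ennreal_leI divide_right_mono) (auto simp: b_def)
  finally show ?thesis by (simp add: b_def)
qed

text \<open>Reduces the identification of the likelihood ratio to a product formula for
  characteristic functions.\<close>

lemma law_eq_density_lik:
  assumes P: "prob_space P" "sets P = sets (\<Pi>\<^sub>M i\<in>I. borel)"
    and char: "\<And>t. (CLINT y|P. iexp (\<Sum>i\<in>I. t i * y i))
      = (CLINT \<omega>|M. iexp (\<Sum>i\<in>I. t i * h i \<omega>)) * complex_of_real (exp (- (\<Sum>i\<in>I. (t i)\<^sup>2 * (sd i)\<^sup>2) / 2))"
  shows "P = density null lik"
  unfolding mixture_eq_density[symmetric]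
  by (rule PiM_char_uniqueness[OF fin P(1) prob_space_mixture P(2)])
     (simp_all only: char mixture_char, simp add: mixture_def)

end

section \<open>The likelihood ratio under the null hypothesis\<close>

text \<open>The Kullback-Leibler divergence of the standard normal law relative to the centred
  normal law of variance 1 + s.\<close>

definition stein :: "real \<Rightarrow> real" where
  "stein s = 1 / 2 * ln (1 + s) + 1 / 2 * (1 / (1 + s)) - 1 / 2"

lemma square_deviation_moments:
  fixes \<sigma> :: real
  assumes s: "0 < \<sigma>"
  defines "w \<equiv> \<lambda>x. x\<^sup>2 / \<sigma>\<^sup>2 - 1"
  shows "integrable (normal_law 0 \<sigma>) w" "(LINT x|normal_law 0 \<sigma>. w x) = 0"
    "integrable (normal_law 0 \<sigma>) (\<lambda>x. w x * w x)" "(LINT x|normal_law 0 \<sigma>. w x * w x) = 2"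
proof -
  interpret S: prob_space std_normal_distribution by (rule prob_space_normal_density) simp
  have law: "normal_law 0 \<sigma> = distr std_normal_distribution borel (\<lambda>x. \<sigma> * x)"
    using normal_law_eq_distr[of \<sigma> 0] s by simp
  have w: "w (\<sigma> * x) = x\<^sup>2 - 1" for x using s by (simp add: w_def power_mult_distrib)
  have [measurable]: "w \<in> borel_measurable borel" by (simp add: w_def)
  have i: "integrable std_normal_distribution (\<lambda>x. x\<^sup>2)" "integrable std_normal_distribution (\<lambda>x. x ^ 4)"
    by (rule integrable_std_normal_power)+
  have m: "(LINT x|std_normal_distribution. x\<^sup>2) = 1" "(LINT x|std_normal_distribution. x ^ 4) = 3"
    using std_normal_distribution_even_moments[of 1] std_normal_distribution_even_moments[of 2]
    by (simp_all add: fact_numeral)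
  have one: "(LINT x|std_normal_distribution. 1) = (1::real)"
    by (simp only: lebesgue_integral_const S.prob_space scaleR_one)
  have sq: "(x\<^sup>2 - 1) * (x\<^sup>2 - 1) = x ^ 4 - 2 * x\<^sup>2 + 1" for x :: real
    by (simp add: power2_eq_square power4_eq_xxxx algebra_simps)
  show "integrable (normal_law 0 \<sigma>) w"
    unfolding law by (subst integrable_distr_eq) (use i in \<open>simp_all add: w\<close>)
  show "(LINT x|normal_law 0 \<sigma>. w x) = 0"
    unfolding law by (subst integral_distr) (use i one in \<open>simp_all add: w m\<close>)
  show "integrable (normal_law 0 \<sigma>) (\<lambda>x. w x * w x)"
    unfolding law by (subst integrable_distr_eq) (use i in \<open>simp_all add: w sq\<close>)
  show "(LINT x|normal_law 0 \<sigma>. w x * w x) = 2"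
    unfolding law by (subst integral_distr) (use i one in \<open>simp_all add: w sq m\<close>)
qed

context gauss_mixture
begin

definition dev :: "('i \<Rightarrow> real) \<Rightarrow> real" where
  "dev y = (\<Sum>i\<in>I. g i / (1 + g i) / 2 * ((y i)\<^sup>2 / \<sigma>\<^sup>2 - 1))"

text \<open>Splits the logarithm into its mean under the null hypothesis, minus a sum of
  divergences, and the centred fluctuation \<open>dev\<close>.\<close>

lemma ln_tilt: "ln (tilt y) = dev y - (\<Sum>i\<in>I. stein (g i))"
proof -
  have "ln (tilt y) = (\<Sum>i\<in>I. ln (exp ((y i)\<^sup>2 / (2 * \<sigma>\<^sup>2) * (g i / (1 + g i))) / sqrt (1 + g i)))"
    unfolding tilt_def
  proof (rule ln_prod[OF fin])
    fix i assume "i \<in> I"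
    then have "0 < 1 + g i" using g[of i] by simp
    then have "0 < exp ((y i)\<^sup>2 / (2 * \<sigma>\<^sup>2) * (g i / (1 + g i))) / sqrt (1 + g i)" by simp
    then show "exp ((y i)\<^sup>2 / (2 * \<sigma>\<^sup>2) * (g i / (1 + g i))) / sqrt (1 + g i) \<noteq> 0"
      by (rule less_imp_neq[symmetric])
  qed
  also have "\<dots> = (\<Sum>i\<in>I. g i / (1 + g i) / 2 * ((y i)\<^sup>2 / \<sigma>\<^sup>2 - 1) - stein (g i))"
  proof (rule sum.cong[OF refl])
    fix i assume "i \<in> I"
    then have p: "0 < 1 + g i" using g[of i] by simp
    have "ln (exp ((y i)\<^sup>2 / (2 * \<sigma>\<^sup>2) * (g i / (1 + g i))) / sqrt (1 + g i))
        = (y i)\<^sup>2 / (2 * \<sigma>\<^sup>2) * (g i / (1 + g i)) - ln (1 + g i) / 2"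
      using p by (simp add: ln_div ln_sqrt)
    moreover have "g i / (1 + g i) / 2 = 1 / 2 - 1 / 2 * (1 / (1 + g i))"
      using p by (simp add: field_simps)
    moreover have "(y i)\<^sup>2 / (2 * \<sigma>\<^sup>2) * (g i / (1 + g i)) = g i / (1 + g i) / 2 * ((y i)\<^sup>2 / \<sigma>\<^sup>2)"
      by (simp only: times_divide_times_eq divide_divide_eq_left mult_ac)
    ultimately show "ln (exp ((y i)\<^sup>2 / (2 * \<sigma>\<^sup>2) * (g i / (1 + g i))) / sqrt (1 + g i))
        = g i / (1 + g i) / 2 * ((y i)\<^sup>2 / \<sigma>\<^sup>2 - 1) - stein (g i)"
      unfolding stein_def right_diff_distrib mult_1_right by linarith
  qed
  finally show ?thesis by (simp add: dev_def sum_subtractf)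
qed

lemma dev_measurable[measurable]: "dev \<in> borel_measurable (\<Pi>\<^sub>M i\<in>I. borel)"
  unfolding dev_def by measurable

text \<open>Distinct coordinates are orthogonal, a centred normalized square has second moment 2,
  and every coefficient is at most 1/2. Each coordinate thus contributes at most 1/2 whatever
  \<open>g\<close> is, so the fluctuation has order the square root of the number of sites.\<close>

lemma dev_square_integral:
  "integrable null (\<lambda>y. (dev y)\<^sup>2)" "(LINT y|null. (dev y)\<^sup>2) \<le> card I / 2"
proof -
  interpret ps0: product_sigma_finite "\<lambda>i. normal_law 0 \<sigma>"
    unfolding product_sigma_finite_def using sigma
    by (auto intro!: prob_space_imp_sigma_finite prob_space_normal_law)
  interpret n: prob_space "normal_law 0 \<sigma>" using sigma by (intro prob_space_normal_law) simp
  define w where "w = (\<lambda>x. x\<^sup>2 / \<sigma>\<^sup>2 - 1)"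
  define c where "c = (\<lambda>i. g i / (1 + g i) / 2)"
  have m: "integrable (normal_law 0 \<sigma>) w" "(LINT x|normal_law 0 \<sigma>. w x) = 0"
    "integrable (normal_law 0 \<sigma>) (\<lambda>x. w x * w x)" "(LINT x|normal_law 0 \<sigma>. w x * w x) = 2"
    using square_deviation_moments[OF sigma] by (simp_all only: w_def)
  have ij: "integrable null (\<lambda>y. w (y i) * w (y j)) \<and>
      (LINT y|null. w (y i) * w (y j)) = (if i = j then 2 else 0)" if i: "i \<in> I" and j: "j \<in> I" for i j
  proof -
    \<comment> \<open>Writes the product of two coordinates as a product over all of
      \<open>I\<close>, in one form for i = j and for distinct i, j.\<close>
    define f where "f = (\<lambda>k x. (if k = i then w x else 1) * (if k = j then w x else 1))"
    have one: "integrable (normal_law 0 \<sigma>) (\<lambda>x. 1::real)" by simp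
    have fi: "integrable (normal_law 0 \<sigma>) (f k)" for k
      using m by (cases "k = i"; cases "k = j") (simp_all add: f_def)
    have pr: "(\<Prod>k\<in>I. f k (y k)) = w (y i) * w (y j)" for y
      unfolding f_def prod.distrib using fin i j by (simp add: prod.delta)
    have "integrable null (\<lambda>y. \<Prod>k\<in>I. f k (y k))"
      unfolding null_def using fin fi by (rule ps0.product_integrable_prod)
    moreover have "(LINT y|null. (\<Prod>k\<in>I. f k (y k))) = (\<Prod>k\<in>I. LINT x|normal_law 0 \<sigma>. f k x)"
      unfolding null_def using fin fi by (rule ps0.product_integral_prod)
    moreover have "(\<Prod>k\<in>I. LINT x|normal_law 0 \<sigma>. f k x) = (if i = j then 2 else 0)"
    proof (cases "i = j")
      case True
      have "(\<Prod>k\<in>I. LINT x|normal_law 0 \<sigma>. f k x) = (\<Prod>k\<in>I. if k = i then 2 else 1)"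
        using m n.prob_space True by (intro prod.cong) (simp_all add: f_def)
      then show ?thesis using True fin i by simp
    next
      case False
      have "(LINT x|normal_law 0 \<sigma>. f i x) = 0" using m False by (simp add: f_def)
      then show ?thesis using False fin i by (simp add: prod_zero_iff) blast
    qed
    ultimately show ?thesis by (simp only: pr)
  qed
  have sq: "(dev y)\<^sup>2 = (\<Sum>i\<in>I. \<Sum>j\<in>I. c i * c j * (w (y i) * w (y j)))" for y
    unfolding dev_def power2_eq_square[of "sum _ _"] sum_product
    by (simp add: c_def w_def mult_ac)
  show "integrable null (\<lambda>y. (dev y)\<^sup>2)"
    unfolding sq by (intro Bochner_Integration.integrable_sum integrable_mult_right) (use ij in blast)
  have "(LINT y|null. (dev y)\<^sup>2) = (\<Sum>i\<in>I. \<Sum>j\<in>I. c i * c j * (LINT y|null. w (y i) * w (y j)))"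
    unfolding sq using ij by (simp add: Bochner_Integration.integral_sum)
  also have "\<dots> = (\<Sum>i\<in>I. \<Sum>j\<in>I. if i = j then c i * c j * 2 else 0)"
    by (intro sum.cong refl) (simp add: ij)
  also have "\<dots> = (\<Sum>i\<in>I. 2 * (c i * c i))"
    using fin by (simp add: sum.delta mult_ac)
  also have "\<dots> \<le> (\<Sum>i\<in>I. 1 / 2)"
  proof (rule sum_mono)
    fix i assume "i \<in> I"
    then have "0 \<le> c i" "c i \<le> 1 / 2" using g[of i] by (auto simp: c_def divide_le_eq)
    then have "c i * c i \<le> 1 / 2 * (1 / 2)" by (intro mult_mono) auto
    then show "2 * (c i * c i) \<le> 1 / 2" by simp
  qed
  finally show "(LINT y|null. (dev y)\<^sup>2) \<le> card I / 2" by simp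
qed

lemma dev_tail:
  assumes a: "0 < a"
  shows "measure null {y\<in>space null. a \<le> \<bar>dev y\<bar>} \<le> card I / (2 * a\<^sup>2)"
proof -
  interpret N: prob_space null by (rule prob_space_null)
  have "measure null {y\<in>space null. a\<^sup>2 \<le> (dev y)\<^sup>2} \<le> (LINT y|null. (dev y)\<^sup>2) / a\<^sup>2"
    using a dev_square_integral(1) by (intro integral_Markov_inequality_measure[where A = "{}"]) auto
  also have "\<dots> \<le> (card I / 2) / a\<^sup>2"
    using dev_square_integral(2) by (intro divide_right_mono) auto
  also have "{y\<in>space null. a\<^sup>2 \<le> (dev y)\<^sup>2} = {y\<in>space null. a \<le> \<bar>dev y\<bar>}"
    using a by (auto simp: abs_le_square_iff[symmetric])
  finally show ?thesis by simp
qed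

text \<open>Markov's inequality with mean at most one; there is no pointwise upper bound on
  \<open>mix\<close>.\<close>

lemma mix_tail:
  assumes a: "0 < a"
  shows "measure null {y\<in>space null. ennreal (exp a) \<le> mix y} \<le> exp (- a)"
proof -
  interpret N: prob_space null by (rule prob_space_null)
  have "emeasure null ({y\<in>space null. 1 \<le> ennreal (exp (- a)) * mix y}) \<le> ennreal (exp (- a)) * (\<integral>\<^sup>+y. mix y * indicator (space null) y \<partial>null)"
    by (rule nn_integral_Markov_inequality) measurable
  also have "\<dots> \<le> ennreal (exp (- a)) * 1"
  proof (intro mult_left_mono)
    have "(\<integral>\<^sup>+y. mix y * indicator (space null) y \<partial>null) = (\<integral>\<^sup>+y. mix y \<partial>null)"
      by (rule nn_integral_cong) simp
    then show "(\<integral>\<^sup>+y. mix y * indicator (space null) y \<partial>null) \<le> 1" using nn_integral_mix_le by simp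
  qed simp
  also have "{y\<in>space null. 1 \<le> ennreal (exp (- a)) * mix y} = {y\<in>space null. ennreal (exp a) \<le> mix y}"
  proof -
    have "1 \<le> ennreal (exp (- a)) * z \<longleftrightarrow> ennreal (exp a) \<le> z" for z
    proof
      assume "1 \<le> ennreal (exp (- a)) * z"
      then have "ennreal (exp a) * 1 \<le> ennreal (exp a) * (ennreal (exp (- a)) * z)" by (intro mult_left_mono) auto
      then show "ennreal (exp a) \<le> z" by (simp add: mult.assoc[symmetric] ennreal_mult[symmetric] exp_add[symmetric])
    next
      assume "ennreal (exp a) \<le> z"
      then have "ennreal (exp (- a)) * ennreal (exp a) \<le> ennreal (exp (- a)) * z" by (intro mult_left_mono) auto
      then show "1 \<le> ennreal (exp (- a)) * z" by (simp add: ennreal_mult[symmetric] exp_add[symmetric])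
    qed
    then show ?thesis by simp
  qed
  finally show ?thesis by (simp add: N.emeasure_eq_measure)
qed

text \<open>Since the bound on \<open>mix\<close> holds for every observation, only the fluctuation
  can fail, and Chebyshev's inequality controls it.\<close>

lemma lik_lower_tail:
  assumes b: "\<And>y. ennreal (exp (- b)) \<le> mix y" and a: "0 < a"
  shows "measure null {y\<in>space null. lik y < ennreal (exp (- ((\<Sum>i\<in>I. stein (g i)) + a + b)))} \<le> card I / (2 * a\<^sup>2)"
proof -
  interpret N: prob_space null by (rule prob_space_null)
  have "{y\<in>space null. lik y < ennreal (exp (- ((\<Sum>i\<in>I. stein (g i)) + a + b)))} \<subseteq> {y\<in>space null. a \<le> \<bar>dev y\<bar>}"
  proof (intro subsetI CollectI conjI)
    fix y assume y: "y \<in> {y\<in>space null. lik y < ennreal (exp (- ((\<Sum>i\<in>I. stein (g i)) + a + b)))}"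
    then show "y \<in> space null" by simp
    have "ennreal (tilt y) * ennreal (exp (- b)) \<le> lik y"
      unfolding lik_def using b by (intro mult_left_mono) auto
    moreover have "tilt y = exp (dev y - (\<Sum>i\<in>I. stein (g i)))"
      using tilt_pos[of y] ln_tilt[of y] by (metis exp_ln)
    ultimately have "ennreal (exp (dev y - (\<Sum>i\<in>I. stein (g i)) - b)) \<le> lik y"
      by (simp add: ennreal_mult[symmetric] exp_add[symmetric])
    also have "lik y < ennreal (exp (- ((\<Sum>i\<in>I. stein (g i)) + a + b)))" using y by simp
    finally have "exp (dev y - (\<Sum>i\<in>I. stein (g i)) - b) < exp (- ((\<Sum>i\<in>I. stein (g i)) + a + b))"
      by (simp only: ennreal_less_iff[OF exp_ge_zero])
    then show "a \<le> \<bar>dev y\<bar>" by simp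
  qed
  then have "measure null {y\<in>space null. lik y < ennreal (exp (- ((\<Sum>i\<in>I. stein (g i)) + a + b)))}
      \<le> measure null {y\<in>space null. a \<le> \<bar>dev y\<bar>}" by (rule N.finite_measure_mono) measurable
  then show ?thesis using dev_tail[OF a] by simp
qed

text \<open>One \<open>a\<close> is spent on the fluctuation and one on \<open>mix\<close>, hence 2
  a and two error terms.\<close>

lemma lik_upper_tail:
  assumes a: "0 < a"
  shows "measure null {y\<in>space null. ennreal (exp (- ((\<Sum>i\<in>I. stein (g i)) - 2 * a))) \<le> lik y}
    \<le> card I / (2 * a\<^sup>2) + exp (- a)"
proof -
  interpret N: prob_space null by (rule prob_space_null)
  let ?A = "{y\<in>space null. a \<le> \<bar>dev y\<bar>}" and ?B = "{y\<in>space null. ennreal (exp a) \<le> mix y}"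
  have "{y\<in>space null. ennreal (exp (- ((\<Sum>i\<in>I. stein (g i)) - 2 * a))) \<le> lik y} \<subseteq> ?A \<union> ?B"
  proof (rule subsetI, rule ccontr)
    fix y assume y: "y \<in> {y\<in>space null. ennreal (exp (- ((\<Sum>i\<in>I. stein (g i)) - 2 * a))) \<le> lik y}"
      and "y \<notin> ?A \<union> ?B"
    then have d: "dev y < a" and m: "mix y < ennreal (exp a)" by auto
    have t: "tilt y = exp (dev y - (\<Sum>i\<in>I. stein (g i)))"
      using tilt_pos[of y] ln_tilt[of y] by (metis exp_ln)
    have "lik y \<le> ennreal (tilt y) * ennreal (exp a)"
      unfolding lik_def using m by (intro mult_left_mono) auto
    also have "\<dots> = ennreal (exp (dev y - (\<Sum>i\<in>I. stein (g i)) + a))"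
      unfolding t by (simp add: ennreal_mult[symmetric] exp_add[symmetric])
    also have "\<dots> < ennreal (exp (- ((\<Sum>i\<in>I. stein (g i)) - 2 * a)))"
      using d by (intro ennreal_lessI) auto
    finally show False using y by auto
  qed
  then have "measure null {y\<in>space null. ennreal (exp (- ((\<Sum>i\<in>I. stein (g i)) - 2 * a))) \<le> lik y}
      \<le> measure null (?A \<union> ?B)" by (rule N.finite_measure_mono) measurable
  also have "\<dots> \<le> measure null ?A + measure null ?B"
    by (rule measure_Un_le) measurable
  finally show ?thesis using dev_tail[OF a] mix_tail[OF a] by simp
qed

end

section \<open>Stein's lemma\<close>

text \<open>Pointwise c (1 - \<phi> - 1{L < c}) is at most L (1 - \<phi>): where L < c the left side
  is nonpositive, elsewhere it is evident. Integrating under \<open>P0\<close> bounds the miss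
  probability of any test of level \<alpha>.\<close>

lemma stein_lower_bound:
  assumes P0: "prob_space P0" and L[measurable]: "L \<in> borel_measurable P0"
    and P1: "prob_space (density P0 L)"
    and \<phi>: "detector P0 \<phi>" "false_alarm_prob P0 \<phi> \<le> \<alpha>" and c: "0 \<le> c"
  shows "c * (1 - \<alpha> - measure P0 {y\<in>space P0. L y < ennreal c}) \<le> miss_prob (density P0 L) \<phi>"
proof -
  interpret P0: prob_space P0 by fact
  interpret P1: prob_space "density P0 L" by fact
  have [measurable]: "\<phi> \<in> borel_measurable P0" and \<phi>01: "\<And>y. y \<in> space P0 \<Longrightarrow> 0 \<le> \<phi> y \<and> \<phi> y \<le> 1"
    using \<phi>(1) by (auto simp: detector_def)
  let ?B = "{y\<in>space P0. L y < ennreal c}"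
  have iphi: "integrable P0 \<phi>" by (rule P0.integrable_const_bound[where B = 1]) (use \<phi>01 in auto)
  have i1: "integrable (density P0 L) (\<lambda>y. 1 - \<phi> y)"
    by (rule P1.integrable_const_bound[where B = 1]) (use \<phi>01 in \<open>auto intro!: AE_I2\<close>)
  have iB: "integrable P0 (\<lambda>y. indicator ?B y :: real)"
    by (rule P0.integrable_const_bound[where B = 1]) (auto simp: indicator_def)
  have "1 - \<alpha> - measure P0 ?B \<le> (LINT y|P0. 1 - \<phi> y - indicator ?B y)"
    using iphi iB \<phi>(2) P0.prob_space by (simp add: false_alarm_prob_def)
  then have "c * (1 - \<alpha> - measure P0 ?B) \<le> c * (LINT y|P0. 1 - \<phi> y - indicator ?B y)"
    using c by (rule mult_left_mono)
  also have "\<dots> = (LINT y|P0. c * (1 - \<phi> y - indicator ?B y))" by simp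
  finally have le: "c * (1 - \<alpha> - measure P0 ?B) \<le> (LINT y|P0. c * (1 - \<phi> y - indicator ?B y))" .
  have ic: "integrable P0 (\<lambda>y. c * (1 - \<phi> y - indicator ?B y))" using iphi iB by simp
  have "ennreal (LINT y|P0. c * (1 - \<phi> y - indicator ?B y)) \<le> (\<integral>\<^sup>+y. ennreal (c * (1 - \<phi> y - indicator ?B y)) \<partial>P0)"
    by (rule ennreal_integral_le[OF ic])
  also have "\<dots> \<le> (\<integral>\<^sup>+y. L y * ennreal (1 - \<phi> y) \<partial>P0)"
  proof (rule nn_integral_mono)
    fix y assume y: "y \<in> space P0"
    show "ennreal (c * (1 - \<phi> y - indicator ?B y)) \<le> L y * ennreal (1 - \<phi> y)"
    proof (cases "L y < ennreal c")
      case True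
      then have "c * (1 - \<phi> y - indicator ?B y) \<le> 0"
        using y \<phi>01[OF y] c by (simp add: mult_nonneg_nonpos)
      then show ?thesis by (simp add: ennreal_neg)
    next
      case False
      then have "ennreal c * ennreal (1 - \<phi> y) \<le> L y * ennreal (1 - \<phi> y)" by (intro mult_right_mono) auto
      then show ?thesis using False y \<phi>01[OF y] c by (simp add: ennreal_mult)
    qed
  qed
  also have "\<dots> = (\<integral>\<^sup>+y. ennreal (1 - \<phi> y) \<partial>density P0 L)"
    by (rule nn_integral_density[symmetric]) measurable
  also have "\<dots> = ennreal (miss_prob (density P0 L) \<phi>)"
    unfolding miss_prob_def using i1 \<phi>01 by (intro nn_integral_eq_integral) auto
  finally have *: "ennreal (LINT y|P0. c * (1 - \<phi> y - indicator ?B y)) \<le> ennreal (miss_prob (density P0 L) \<phi>)" .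
  have "0 \<le> miss_prob (density P0 L) \<phi>"
    unfolding miss_prob_def using \<phi>01 by (intro integral_nonneg_AE AE_I2) auto
  then have "(LINT y|P0. c * (1 - \<phi> y - indicator ?B y)) \<le> miss_prob (density P0 L) \<phi>"
    using * by (simp add: ennreal_le_iff)
  then show ?thesis using le by simp
qed

text \<open>The optimal test is compared with the threshold test that decides for the alternative
  when L is at least c. Its misses lie where the density is below c.\<close>

lemma stein_upper_bound:
  assumes P0: "prob_space P0" and L[measurable]: "L \<in> borel_measurable P0"
    and P1: "prob_space (density P0 L)"
    and np: "neyman_pearson \<alpha> P0 (density P0 L) \<phi>" and c: "0 \<le> c"
    and small: "measure P0 {y\<in>space P0. ennreal c \<le> L y} \<le> \<alpha>"
  shows "miss_prob (density P0 L) \<phi> \<le> c"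
proof -
  interpret P0: prob_space P0 by fact
  interpret P1: prob_space "density P0 L" by fact
  let ?A = "{y\<in>space P0. ennreal c \<le> L y}"
  define \<psi> where "\<psi> = (indicator ?A :: _ \<Rightarrow> real)"
  have m[measurable]: "\<psi> \<in> borel_measurable P0" unfolding \<psi>_def by measurable
  have "detector P0 \<psi>" by (auto simp: detector_def m) (auto simp: \<psi>_def indicator_def)
  moreover have "false_alarm_prob P0 \<psi> \<le> \<alpha>" using small by (simp add: false_alarm_prob_def \<psi>_def)
  ultimately have "miss_prob (density P0 L) \<phi> \<le> miss_prob (density P0 L) \<psi>"
    using np by (auto simp: neyman_pearson_def)
  also have "miss_prob (density P0 L) \<psi> \<le> c"
  proof -
    have "ennreal (miss_prob (density P0 L) \<psi>) = (\<integral>\<^sup>+y. ennreal (1 - \<psi> y) \<partial>density P0 L)"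
      unfolding miss_prob_def
      by (intro nn_integral_eq_integral[symmetric] P1.integrable_const_bound[where B = 1])
         (auto simp: \<psi>_def indicator_def)
    also have "\<dots> = (\<integral>\<^sup>+y. L y * ennreal (1 - \<psi> y) \<partial>P0)"
      by (rule nn_integral_density) measurable
    also have "\<dots> \<le> (\<integral>\<^sup>+y. ennreal c \<partial>P0)"
      by (intro nn_integral_mono) (auto simp: \<psi>_def indicator_def)
    also have "\<dots> = ennreal c" by (simp add: P0.emeasure_space_1)
    finally show ?thesis using c by (simp add: ennreal_le_iff)
  qed
  finally show ?thesis .
qed

text \<open>Formulated with tails of L under \<open>P0\<close> alone, so that concentration at the
  rate \<open>K\<close> replaces an i.i.d. assumption and the alternative enters only as a
  density.\<close>

theorem stein_lemma:
  fixes P0 :: "nat \<Rightarrow> 'b measure" and n :: "nat \<Rightarrow> real"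
  assumes P0: "\<And>k. prob_space (P0 k)" and L: "\<And>k. L k \<in> borel_measurable (P0 k)"
    and P1: "\<And>k. prob_space (density (P0 k) (L k))"
    and np: "\<And>k. neyman_pearson \<alpha> (P0 k) (density (P0 k) (L k)) (\<phi> k)"
    and \<alpha>: "0 < \<alpha>" "\<alpha> < 1" and n: "filterlim n at_top sequentially"
    and low: "\<And>\<epsilon>. 0 < \<epsilon> \<Longrightarrow>
      (\<lambda>k. measure (P0 k) {y\<in>space (P0 k). L k y < ennreal (exp (- (n k * (K + \<epsilon>))))}) \<longlonglongrightarrow> 0"
    and up: "\<And>\<epsilon>. 0 < \<epsilon> \<Longrightarrow>
      (\<lambda>k. measure (P0 k) {y\<in>space (P0 k). ennreal (exp (- (n k * (K - \<epsilon>)))) \<le> L k y}) \<longlonglongrightarrow> 0"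
  shows "(\<lambda>k. - (1 / n k) * ln (miss_prob (density (P0 k) (L k)) (\<phi> k))) \<longlonglongrightarrow> K"
proof (rule LIMSEQ_I)
  fix r :: real assume r: "0 < r"
  \<comment> \<open>One \<epsilon> is lost in the tail, and one more in the lower bound on the miss
    probability for absorbing the constant \<open>C\<close>. The level enters only there: a tail
    below (1 - \<alpha>) / 2 leaves mass (1 - \<alpha>) / 2.\<close>
  define \<epsilon> where "\<epsilon> = r / 4"
  have e: "0 < \<epsilon>" using r by (simp add: \<epsilon>_def)
  define C where "C = - ln ((1 - \<alpha>) / 2)"
  have ev1: "\<forall>\<^sub>F k in sequentially. measure (P0 k) {y\<in>space (P0 k). L k y < ennreal (exp (- (n k * (K + \<epsilon>))))} < (1 - \<alpha>) / 2"
    using order_tendstoD(2)[OF low[OF e], of "(1 - \<alpha>) / 2"] \<alpha> by simp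
  have ev2: "\<forall>\<^sub>F k in sequentially. measure (P0 k) {y\<in>space (P0 k). ennreal (exp (- (n k * (K - \<epsilon>)))) \<le> L k y} < \<alpha>"
    using order_tendstoD(2)[OF up[OF e] \<alpha>(1)] .
  have ev3: "\<forall>\<^sub>F k in sequentially. max 1 (\<bar>C\<bar> / \<epsilon>) \<le> n k"
    using n unfolding filterlim_at_top by blast
  have "\<forall>\<^sub>F k in sequentially. norm (- (1 / n k) * ln (miss_prob (density (P0 k) (L k)) (\<phi> k)) - K) < r"
    using ev1 ev2 ev3
  proof eventually_elim
    case (elim k)
    define p where "p = miss_prob (density (P0 k) (L k)) (\<phi> k)"
    have nk: "0 < n k" and nC: "\<bar>C\<bar> \<le> \<epsilon> * n k" using elim(3) e by (auto simp: divide_le_eq mult.commute)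
    have "exp (- (n k * (K + \<epsilon>))) * (1 - \<alpha> - measure (P0 k) {y\<in>space (P0 k). L k y < ennreal (exp (- (n k * (K + \<epsilon>))))}) \<le> p"
      unfolding p_def using np[of k] by (intro stein_lower_bound P0 L P1) (auto simp: neyman_pearson_def)
    moreover have "exp (- (n k * (K + \<epsilon>))) * ((1 - \<alpha>) / 2)
        \<le> exp (- (n k * (K + \<epsilon>))) * (1 - \<alpha> - measure (P0 k) {y\<in>space (P0 k). L k y < ennreal (exp (- (n k * (K + \<epsilon>))))})"
      using elim(1) by (intro mult_left_mono) auto
    ultimately have lo: "exp (- (n k * (K + \<epsilon>))) * ((1 - \<alpha>) / 2) \<le> p" by (rule order_trans[rotated])
    \<comment> \<open>Keeps the miss probability positive, so that its logarithm is genuine and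
      monotonicity applies.\<close>
    have pos: "0 < exp (- (n k * (K + \<epsilon>))) * ((1 - \<alpha>) / 2)" using \<alpha> by simp
    have hi: "p \<le> exp (- (n k * (K - \<epsilon>)))"
      unfolding p_def using elim(2) by (intro stein_upper_bound[OF P0 L P1 np]) auto
    have "ln (exp (- (n k * (K + \<epsilon>))) * ((1 - \<alpha>) / 2)) \<le> ln p" using lo pos by (subst ln_le_cancel_iff) auto
    moreover have "ln (exp (- (n k * (K + \<epsilon>))) * ((1 - \<alpha>) / 2)) = - (n k * (K + \<epsilon>)) - C"
      using \<alpha> by (subst ln_mult) (auto simp: C_def)
    ultimately have l1: "- ln p \<le> n k * (K + \<epsilon>) + C" by linarith
    have "ln p \<le> ln (exp (- (n k * (K - \<epsilon>))))" using lo pos hi by (subst ln_le_cancel_iff) auto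
    then have l2: "n k * (K - \<epsilon>) \<le> - ln p" by simp
    have "- ln p \<le> n k * (K + 2 * \<epsilon>)" using l1 nC by (simp add: algebra_simps)
    then have "- ln p / n k \<le> K + 2 * \<epsilon>" using nk by (simp only: pos_divide_le_eq mult.commute)
    moreover have "K - \<epsilon> \<le> - ln p / n k" using l2 nk by (simp only: pos_le_divide_eq mult.commute)
    ultimately show ?case using r by (simp add: p_def[symmetric] \<epsilon>_def abs_less_iff)
  qed
  then show "\<exists>no. \<forall>k\<ge>no. norm (- (1 / n k) * ln (miss_prob (density (P0 k) (L k)) (\<phi> k)) - K) < r"
    by (simp add: eventually_sequentially)
qed

section \<open>Riemann sums over the torus\<close>

text \<open>The number of the cell of width \<pi> / a that contains |w|. It presents a sum over 1,
  ..., a as the integral of a step function on the circle, folded by evenness.\<close>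

definition grid :: "nat \<Rightarrow> real \<Rightarrow> int" where
  "grid a w = \<lceil>a * \<bar>w\<bar> / pi\<rceil>"

lemma grid_measurable[measurable]: "(\<lambda>w. real_of_int (grid a w)) \<in> borel_measurable borel"
  unfolding grid_def by measurable

lemma grid_bounds: "a * \<bar>w\<bar> / pi \<le> grid a w" "grid a w < a * \<bar>w\<bar> / pi + 1"
  unfolding grid_def by linarith+

lemma grid_eq_iff:
  assumes "0 < a"
  shows "grid a w = i \<longleftrightarrow> (of_int i - 1) * pi / a < \<bar>w\<bar> \<and> \<bar>w\<bar> \<le> of_int i * pi / a"
proof -
  have "grid a w = i \<longleftrightarrow> of_int i - 1 < a * \<bar>w\<bar> / pi \<and> a * \<bar>w\<bar> / pi \<le> of_int i"
    by (simp add: grid_def ceiling_eq_iff)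
  also have "of_int i - 1 < a * \<bar>w\<bar> / pi \<longleftrightarrow> (of_int i - 1) * pi / a < \<bar>w\<bar>"
    using assms by (simp add: less_divide_eq divide_less_eq mult.commute)
  also have "a * \<bar>w\<bar> / pi \<le> of_int i \<longleftrightarrow> \<bar>w\<bar> \<le> of_int i * pi / a"
    using assms by (simp add: le_divide_eq divide_le_eq mult.commute)
  finally show ?thesis .
qed

lemma circ_measure_annulus:
  assumes "0 \<le> u" "u \<le> v" "v \<le> pi"
  shows "(LINT w|circ. indicator {w. u < \<bar>w\<bar> \<and> \<bar>w\<bar> \<le> v} w) = (v - u) / pi"
proof -
  have "(LINT w|lborel. indicator {w. u < \<bar>w\<bar> \<and> \<bar>w\<bar> \<le> v} w * indicator {- pi..<pi} w)
      = (LINT w|lborel. indicator {u<..v} w + indicator {- v..<- u} w :: real)"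
    by (rule integral_cong_AE, simp, simp, rule AE_mp[OF AE_lborel_singleton[of pi]], rule AE_I2)
       (use assms in \<open>auto simp: indicator_def abs_if split: if_splits\<close>)
  also have "\<dots> = 2 * (v - u)"
    using assms by (subst Bochner_Integration.integral_add) auto
  finally have *: "(LINT w|lborel. indicator {w. u < \<bar>w\<bar> \<and> \<bar>w\<bar> \<le> v} w * indicator {- pi..<pi} w) = 2 * (v - u)" .
  show ?thesis
    by (subst integral_circ) (simp, simp only: *, simp add: field_simps)
qed

lemma AE_circ_grid:
  assumes "0 < a"
  shows "AE w in circ. grid a w \<in> {1..int a}"
proof -
  \<comment> \<open>At w = 0 the cell number would be 0, outside the range of summation.\<close>
  have "AE w in circ. w \<noteq> 0"
    unfolding circ_def by (subst AE_density) (auto intro: AE_mp[OF AE_lborel_singleton[of 0]])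
  with AE_circ show ?thesis
  proof eventually_elim
    case (elim w)
    have "0 < a * \<bar>w\<bar> / pi" "a * \<bar>w\<bar> / pi \<le> a"
      using elim assms by (auto simp: divide_le_eq abs_le_iff)
    then show ?case using grid_bounds[where a = a and w = w]
      by (auto simp: grid_def ceiling_le_iff)
  qed
qed

lemma circ_grid_average:
  assumes a: "0 < a"
  shows "(LINT w|circ. \<psi> (grid a w)) = (\<Sum>i\<in>{1..int a}. \<psi> i) / real a"
proof -
  define S where "S = (\<lambda>i. {w. (of_int i - 1) * pi / a < \<bar>w\<bar> \<and> \<bar>w\<bar> \<le> of_int i * pi / a})"
  have [measurable]: "S i \<in> sets borel" for i unfolding S_def by measurable
  have Siff: "w \<in> S i \<longleftrightarrow> grid a w = i" for w i by (simp add: S_def grid_eq_iff[OF a])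
  have gm: "grid a \<in> borel \<rightarrow>\<^sub>M count_space UNIV"
    unfolding grid_def by measurable
  have [measurable]: "(\<lambda>w. \<psi> (grid a w)) \<in> borel_measurable borel"
    using gm by (rule measurable_compose) simp
  have "(LINT w|circ. \<psi> (grid a w)) = (LINT w|circ. (\<Sum>i\<in>{1..int a}. \<psi> i * indicator (S i) w))"
  proof (rule integral_cong_AE)
    show "AE w in circ. \<psi> (grid a w) = (\<Sum>i\<in>{1..int a}. \<psi> i * indicator (S i) w)"
      using AE_circ_grid[OF a]
    proof eventually_elim
      case (elim w)
      have "(\<Sum>i\<in>{1..int a}. \<psi> i * indicator (S i) w) = (\<Sum>i\<in>{1..int a}. if i = grid a w then \<psi> i else 0)"
        using Siff[of w] by (intro sum.cong) (auto simp: indicator_def)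
      then show ?case using elim by simp
    qed
  qed measurable
  also have "\<dots> = (\<Sum>i\<in>{1..int a}. \<psi> i * (LINT w|circ. indicator (S i) w))"
    by (subst Bochner_Integration.integral_sum)
       (auto intro!: circ.integrable_const_bound[where B = 1])
  also have "\<dots> = (\<Sum>i\<in>{1..int a}. \<psi> i / a)"
  proof (intro sum.cong refl)
    fix i assume i: "i \<in> {1..int a}"
    have "real_of_int i \<le> real a" using i by (metis atLeastAtMost_iff of_int_le_iff of_int_of_nat_eq)
    then have "(LINT w|circ. indicator (S i) w) = (of_int i * pi / a - (of_int i - 1) * pi / a) / pi"
      unfolding S_def using i a by (intro circ_measure_annulus) (auto simp: divide_le_eq divide_right_mono)
    also have "\<dots> = 1 / a" using a by (simp add: field_simps)
    finally show "\<psi> i * (LINT w|circ. indicator (S i) w) = \<psi> i / a" by simp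
  qed
  finally show ?thesis by (simp add: sum_divide_distrib)
qed

text \<open>The cells have width \<pi> / a but the nodes of the sine basis have spacing \<pi> / (a +
  1); the mismatch is at most of order 1 / (a + 1).\<close>

lemma grid_tendsto:
  assumes a: "filterlim a at_top sequentially"
  shows "(\<lambda>k. pi * grid (a k) w / (real (a k) + 1)) \<longlonglongrightarrow> \<bar>w\<bar>"
proof -
  have inf: "filterlim (\<lambda>k. real (a k) + 1) at_top sequentially"
    by (rule filterlim_at_top_mono[OF filterlim_compose[OF filterlim_real_sequentially a]]) simp
  have lim: "(\<lambda>k. \<bar>w\<bar> + d / (real (a k) + 1)) \<longlonglongrightarrow> \<bar>w\<bar>" for d
    using tendsto_add[OF tendsto_const[of "\<bar>w\<bar>"] real_tendsto_divide_at_top[OF tendsto_const[of d] inf]] by simp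
  have eq: "(real (a k) * \<bar>w\<bar> + d) / (real (a k) + 1) = \<bar>w\<bar> + (d - \<bar>w\<bar>) / (real (a k) + 1)" for d k
    by (simp add: field_simps)
  show ?thesis
  proof (rule tendsto_sandwich[OF _ _ lim[of "0 - \<bar>w\<bar>"] lim[of "pi - \<bar>w\<bar>"]]; rule always_eventually; rule allI)
    fix k
    have "pi * (a k * \<bar>w\<bar> / pi) \<le> pi * grid (a k) w"
      using grid_bounds(1) by (intro mult_left_mono) auto
    then have "real (a k) * \<bar>w\<bar> + 0 \<le> pi * grid (a k) w" by simp
    then have "(real (a k) * \<bar>w\<bar> + 0) / (real (a k) + 1) \<le> pi * grid (a k) w / (real (a k) + 1)"
      by (intro divide_right_mono) auto
    then show "\<bar>w\<bar> + (0 - \<bar>w\<bar>) / (real (a k) + 1) \<le> pi * grid (a k) w / (real (a k) + 1)"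
      by (simp only: eq)
    have "pi * grid (a k) w \<le> pi * (a k * \<bar>w\<bar> / pi + 1)"
      using less_imp_le[OF grid_bounds(2)] by (intro mult_left_mono) auto
    then have "pi * grid (a k) w \<le> real (a k) * \<bar>w\<bar> + pi" by (simp add: distrib_left)
    then have "pi * grid (a k) w / (real (a k) + 1) \<le> (real (a k) * \<bar>w\<bar> + pi) / (real (a k) + 1)"
      by (intro divide_right_mono) auto
    then show "pi * grid (a k) w / (real (a k) + 1) \<le> \<bar>w\<bar> + (pi - \<bar>w\<bar>) / (real (a k) + 1)"
      by (simp only: eq)
  qed
qed

text \<open>Each sum is the integral of a step function, so dominated convergence replaces estimates
  of the mesh, and the two side lengths may grow at unrelated rates. The nodes converge to absolute
  values, hence the evenness.\<close>

theorem torus_Riemann_sum: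
  fixes \<Phi> :: "real \<Rightarrow> real \<Rightarrow> real"
  assumes cont: "continuous_on UNIV (\<lambda>p. \<Phi> (fst p) (snd p))"
    and bound: "\<And>u v. \<bar>\<Phi> u v\<bar> \<le> B" and even: "\<And>u v. \<Phi> \<bar>u\<bar> \<bar>v\<bar> = \<Phi> u v"
    and a: "filterlim a at_top sequentially" and b: "filterlim b at_top sequentially"
  shows "(\<lambda>k. (\<Sum>i\<in>{1..int (a k)}. \<Sum>j\<in>{1..int (b k)}. \<Phi> (pi * i / (real (a k) + 1)) (pi * j / (real (b k) + 1)))
      / (real (a k) * real (b k))) \<longlonglongrightarrow> (LINT p|(circ \<Otimes>\<^sub>M circ). \<Phi> (fst p) (snd p))"
proof -
  have \<Phi>m: "(\<lambda>p. \<Phi> (fst p) (snd p)) \<in> borel_measurable borel"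
    by (rule borel_measurable_continuous_onI[OF cont])
  have \<Phi>_meas: "(\<lambda>x. \<Phi> (f x) (g x)) \<in> borel_measurable N"
    if [measurable]: "f \<in> borel_measurable N" "g \<in> borel_measurable N" for f g and N :: "'c measure"
  proof -
    have "(\<lambda>x. (f x, g x)) \<in> N \<rightarrow>\<^sub>M borel" by measurable
    from measurable_compose[OF this \<Phi>m] show ?thesis by simp
  qed
  have \<Phi>m2: "(\<lambda>p. \<Phi> (fst p) (snd p)) \<in> borel_measurable (circ \<Otimes>\<^sub>M circ)"
    by (rule \<Phi>_meas) measurable
  define S where "S = (\<lambda>k (p :: real \<times> real). \<Phi> (pi * grid (a k) (fst p) / (real (a k) + 1)) (pi * grid (b k) (snd p) / (real (b k) + 1)))"
  have S_meas: "S k \<in> borel_measurable (circ \<Otimes>\<^sub>M circ)" for k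
    unfolding S_def by (rule \<Phi>_meas) measurable
  have S_int: "integrable (circ \<Otimes>\<^sub>M circ) (S k)" for k
    by (rule torus.P.integrable_const_bound[where B = B]) (use bound S_meas in \<open>auto simp: S_def\<close>)
  have lim: "(\<lambda>k. LINT p|(circ \<Otimes>\<^sub>M circ). S k p) \<longlonglongrightarrow> (LINT p|(circ \<Otimes>\<^sub>M circ). \<Phi> (fst p) (snd p))"
  proof (rule integral_dominated_convergence[where w = "\<lambda>_. B"])
    show "AE p in circ \<Otimes>\<^sub>M circ. (\<lambda>k. S k p) \<longlonglongrightarrow> \<Phi> (fst p) (snd p)"
    proof (rule AE_I2)
      fix p :: "real \<times> real"
      have "(\<lambda>k. (pi * grid (a k) (fst p) / (real (a k) + 1), pi * grid (b k) (snd p) / (real (b k) + 1))) \<longlonglongrightarrow> (\<bar>fst p\<bar>, \<bar>snd p\<bar>)"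
        by (intro tendsto_Pair grid_tendsto a b)
      from continuous_on_tendsto_compose[OF cont this] show "(\<lambda>k. S k p) \<longlonglongrightarrow> \<Phi> (fst p) (snd p)"
        by (simp add: S_def even)
    qed
    show "AE p in circ \<Otimes>\<^sub>M circ. norm (S k p) \<le> B" for k using bound by (simp add: S_def)
  qed (use S_meas \<Phi>m2 in auto)
  have "\<forall>\<^sub>F k in sequentially. 1 \<le> a k \<and> 1 \<le> b k"
    using a b unfolding filterlim_at_top by (intro eventually_conj) auto
  then have "\<forall>\<^sub>F k in sequentially. (LINT p|(circ \<Otimes>\<^sub>M circ). S k p)
      = (\<Sum>i\<in>{1..int (a k)}. \<Sum>j\<in>{1..int (b k)}. \<Phi> (pi * i / (real (a k) + 1)) (pi * j / (real (b k) + 1))) / (real (a k) * real (b k))"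
  proof eventually_elim
    case (elim k)
    then have pos: "0 < a k" "0 < b k" by auto
    have "(LINT p|(circ \<Otimes>\<^sub>M circ). S k p) = (LINT u|circ. LINT v|circ. S k (u, v))"
      using torus.integral_fst'[OF S_int] by simp
    also have "\<dots> = (LINT u|circ. (\<lambda>i. (\<Sum>j\<in>{1..int (b k)}. \<Phi> (pi * i / (real (a k) + 1)) (pi * j / (real (b k) + 1))) / real (b k)) (grid (a k) u))"
    proof (intro Bochner_Integration.integral_cong refl)
      fix u
      show "(LINT v|circ. S k (u, v)) = (\<lambda>i. (\<Sum>j\<in>{1..int (b k)}. \<Phi> (pi * i / (real (a k) + 1)) (pi * j / (real (b k) + 1))) / real (b k)) (grid (a k) u)"
        using circ_grid_average[OF pos(2), of "\<lambda>j. \<Phi> (pi * grid (a k) u / (real (a k) + 1)) (pi * j / (real (b k) + 1))"]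
        by (simp add: S_def)
    qed
    also have "\<dots> = (\<Sum>i\<in>{1..int (a k)}. (\<Sum>j\<in>{1..int (b k)}. \<Phi> (pi * i / (real (a k) + 1)) (pi * j / (real (b k) + 1))) / real (b k)) / real (a k)"
      by (rule circ_grid_average[OF pos(1)])
    finally show ?case by (simp add: sum_divide_distrib[symmetric] mult.commute)
  qed
  from Lim_transform_eventually[OF lim this] show ?thesis .
qed

lemma set_integral_eq_circ:
  assumes [measurable]: "f \<in> borel_measurable borel"
  shows "(LBINT w:{- pi..pi}. f w) = 2 * pi * (LINT w|circ. f w :: real)"
proof -
  have "(LBINT w:{- pi..pi}. f w) = (LINT w|lborel. f w * indicator {- pi..<pi} w)"
    unfolding set_lebesgue_integral_def
    by (rule integral_cong_AE, simp, simp, rule AE_mp[OF AE_lborel_singleton[of pi]], rule AE_I2)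
       (auto simp: indicator_def)
  then show ?thesis by (simp add: integral_circ)
qed

lemma torus_average_eq:
  fixes \<Phi> :: "real \<Rightarrow> real \<Rightarrow> real"
  assumes m[measurable]: "(\<lambda>p. \<Phi> (fst p) (snd p)) \<in> borel_measurable (borel \<Otimes>\<^sub>M borel)"
    and bound: "\<And>u v. \<bar>\<Phi> u v\<bar> \<le> B"
  shows "1 / (4 * pi\<^sup>2) * (LBINT w1:{- pi..pi}. LBINT w2:{- pi..pi}. \<Phi> w1 w2)
    = (LINT p|(circ \<Otimes>\<^sub>M circ). \<Phi> (fst p) (snd p))"
proof -
  have m1: "(\<lambda>v. \<Phi> u v) \<in> borel_measurable borel" for u
    using measurable_compose[OF measurable_Pair1'[of u borel borel] m] by simp
  have m2: "(\<lambda>u. LINT v|circ. \<Phi> u v) \<in> borel_measurable borel"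
    by (rule circ.borel_measurable_lebesgue_integral) (simp add: split_beta')
  have int: "integrable (circ \<Otimes>\<^sub>M circ) (\<lambda>p. \<Phi> (fst p) (snd p))"
    by (rule torus.P.integrable_const_bound[where B = B]) (use bound in auto)
  have "(LBINT w1:{- pi..pi}. LBINT w2:{- pi..pi}. \<Phi> w1 w2)
      = (LBINT w1:{- pi..pi}. 2 * pi * (LINT w2|circ. \<Phi> w1 w2))"
    by (simp only: set_integral_eq_circ[OF m1])
  also have "\<dots> = 2 * pi * (LINT w1|circ. 2 * pi * (LINT w2|circ. \<Phi> w1 w2))"
    by (rule set_integral_eq_circ) (use m2 in measurable)
  also have "\<dots> = 4 * pi\<^sup>2 * (LINT w1|circ. LINT w2|circ. \<Phi> w1 w2)"
    by (simp add: power2_eq_square)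
  also have "(LINT w1|circ. LINT w2|circ. \<Phi> w1 w2) = (LINT p|(circ \<Otimes>\<^sub>M circ). \<Phi> (fst p) (snd p))"
    using torus.integral_fst'[OF int] by simp
  finally show ?thesis by simp
qed

section \<open>The error exponent in an orthonormal basis\<close>

lemma (in prob_space) white_noise_char:
  assumes W: "white_gaussian_noise M \<sigma> W" and s: "0 < \<sigma>"
  shows "(CLINT \<omega>|M. iexp (\<Sum>s\<in>I. c s * W s \<omega>)) = complex_of_real (exp (- (\<sigma>\<^sup>2 * (\<Sum>s\<in>I. (c s)\<^sup>2) / 2)))"
proof (cases "finite I")
  case False
  \<comment> \<open>Sums over infinite sets are 0 by convention, and both sides equal 1.\<close>
  then show ?thesis using prob_space by simp
next
  case fin: True
  have indep: "indep_vars (\<lambda>_. borel) W UNIV" and d: "distributed M lborel (W s) (normal_density 0 \<sigma>)" for s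
    using W unfolding white_gaussian_noise_def by blast+
  have [measurable]: "W s \<in> borel_measurable M" for s
    using distributed_measurable[OF d[of s]] by simp
  have law: "distr M borel (W s) = normal_law 0 \<sigma>" for s
  proof -
    have "distr M borel (W s) = distr M lborel (W s)" by (rule distr_cong) auto
    also have "\<dots> = density lborel (normal_density 0 \<sigma>)" using d[of s] by (simp add: distributed_def)
    finally show ?thesis using s by (simp add: normal_law_def)
  qed
  have "indep_vars (\<lambda>_. borel) W I" using indep by (rule indep_vars_subset) simp
  then have ind: "indep_vars (\<lambda>_. borel) (\<lambda>s \<omega>. c s * W s \<omega>) I"
    by (rule indep_vars_compose2) simp
  have "(CLINT \<omega>|M. iexp (\<Sum>s\<in>I. c s * W s \<omega>)) = char (distr M borel (\<lambda>\<omega>. \<Sum>s\<in>I. c s * W s \<omega>)) 1"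
    unfolding char_def by (subst integral_distr) auto
  also have "\<dots> = (\<Prod>s\<in>I. char (distr M borel (\<lambda>\<omega>. c s * W s \<omega>)) 1)"
    by (rule char_distr_sum[OF ind])
  also have "\<dots> = (\<Prod>s\<in>I. complex_of_real (exp (- ((c s)\<^sup>2 * \<sigma>\<^sup>2 / 2))))"
  proof (intro prod.cong refl)
    fix s assume "s \<in> I"
    have "char (distr M borel (\<lambda>\<omega>. c s * W s \<omega>)) 1 = (CLINT x|distr M borel (W s). iexp (c s * x))"
      unfolding char_def by (subst integral_distr, simp, simp, subst integral_distr) auto
    also have "\<dots> = complex_of_real (exp (- ((c s)\<^sup>2 * \<sigma>\<^sup>2 / 2)))"
      unfolding law using normal_law_char[of \<sigma> 0 "c s"] \<open>0 < \<sigma>\<close> by simp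
    finally show "char (distr M borel (\<lambda>\<omega>. c s * W s \<omega>)) 1 = complex_of_real (exp (- ((c s)\<^sup>2 * \<sigma>\<^sup>2 / 2)))" .
  qed
  also have "\<dots> = complex_of_real (exp (\<Sum>s\<in>I. - ((c s)\<^sup>2 * \<sigma>\<^sup>2 / 2)))"
    unfolding of_real_prod[symmetric] exp_sum[OF fin] ..
  also have "(\<Sum>s\<in>I. - ((c s)\<^sup>2 * \<sigma>\<^sup>2 / 2)) = - (\<sigma>\<^sup>2 * (\<Sum>s\<in>I. (c s)\<^sup>2) / 2)"
    by (simp add: sum_negf sum_distrib_left sum_divide_distrib mult.commute)
  finally show ?thesis .
qed

text \<open>An orthonormal basis of the functions on a window, given by a symmetric and hence involutive
  matrix.\<close>

locale window = prob_space M for M :: "'a measure" +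
  fixes X W :: "site \<Rightarrow> 'a \<Rightarrow> real" and \<sigma> :: real and I :: "site set" and E :: "site \<Rightarrow> site \<Rightarrow> real"
    and g :: "site \<Rightarrow> real" and h :: "site \<Rightarrow> 'a \<Rightarrow> real"
  assumes X: "\<And>s. X s \<in> borel_measurable M" and sigma_pos: "0 < \<sigma>"
    and noise: "white_gaussian_noise M \<sigma> W" and indep: "independent_fields M X W"
    and fin_I: "finite I" and E_sym: "\<And>p s. p \<in> I \<Longrightarrow> s \<in> I \<Longrightarrow> E p s = E s p"
    and E_orth: "\<And>p q. p \<in> I \<Longrightarrow> q \<in> I \<Longrightarrow> (\<Sum>s\<in>I. E p s * E q s) = (if p = q then 1 else 0)"
    and g_nonneg: "\<And>p. p \<in> I \<Longrightarrow> 0 \<le> g p" and h_meas: "\<And>p. p \<in> I \<Longrightarrow> h p \<in> borel_measurable M"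
    and signal_char: "\<And>t. (CLINT \<omega>|M. iexp (\<Sum>p\<in>I. t p * (\<Sum>s\<in>I. E p s * X s \<omega>)))
      = (CLINT \<omega>|M. iexp (\<Sum>p\<in>I. t p * h p \<omega>)) * complex_of_real (exp (- (\<sigma>\<^sup>2 * (\<Sum>p\<in>I. (t p)\<^sup>2 * g p) / 2)))"

sublocale window \<subseteq> gauss_mixture M I \<sigma> g h
  by unfold_locales (use fin_I sigma_pos g_nonneg h_meas in auto)

context window
begin

definition trafo :: "(site \<Rightarrow> real) \<Rightarrow> site \<Rightarrow> real" where
  "trafo y = (\<lambda>p\<in>I. \<Sum>s\<in>I. E p s * y s)"

abbreviation "P0 \<equiv> field_law M I W"
abbreviation "P1 \<equiv> field_law M I (\<lambda>s \<omega>. X s \<omega> + W s \<omega>)"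

lemma W_meas: "W s \<in> borel_measurable M"
  using distributed_measurable[OF noise[unfolded white_gaussian_noise_def, THEN conjunct1, THEN spec, of s]]
  by simp

lemma trafo_measurable[measurable]: "trafo \<in> (\<Pi>\<^sub>M s\<in>I. borel) \<rightarrow>\<^sub>M (\<Pi>\<^sub>M s\<in>I. borel)"
  unfolding trafo_def by measurable

lemma trafo_trafo: "y \<in> space (\<Pi>\<^sub>M s\<in>I. borel) \<Longrightarrow> trafo (trafo y) = y"
proof -
  assume y: "y \<in> space (\<Pi>\<^sub>M s\<in>I. (borel :: real measure))"
  have "(\<Sum>s\<in>I. E p s * (\<Sum>r\<in>I. E s r * y r)) = y p" if p: "p \<in> I" for p
  proof -
    have "(\<Sum>s\<in>I. E p s * (\<Sum>r\<in>I. E s r * y r)) = (\<Sum>s\<in>I. \<Sum>r\<in>I. E p s * E r s * y r)"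
      using E_sym by (intro sum.cong refl) (simp add: sum_distrib_left mult.assoc)
    also have "\<dots> = (\<Sum>r\<in>I. \<Sum>s\<in>I. E p s * E r s * y r)" by (rule sum.swap)
    also have "\<dots> = (\<Sum>r\<in>I. if p = r then y r else 0)"
      using p by (intro sum.cong refl) (simp add: E_orth sum_distrib_right[symmetric])
    also have "\<dots> = y p" using p fin_I by simp
    finally show ?thesis .
  qed
  then show "trafo (trafo y) = y"
    using y unfolding trafo_def by (auto simp: fun_eq_iff space_PiM PiE_def extensional_def)
qed

lemma Parseval: "(\<Sum>s\<in>I. (\<Sum>p\<in>I. t p * E p s)\<^sup>2) = (\<Sum>p\<in>I. (t p)\<^sup>2)"
proof -
  have "(\<Sum>s\<in>I. (\<Sum>p\<in>I. t p * E p s)\<^sup>2) = (\<Sum>s\<in>I. \<Sum>p\<in>I. \<Sum>q\<in>I. t p * t q * (E p s * E q s))"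
    by (simp add: power2_eq_square sum_product mult_ac)
  also have "\<dots> = (\<Sum>p\<in>I. \<Sum>q\<in>I. \<Sum>s\<in>I. t p * t q * (E p s * E q s))"
    by (subst sum.swap, rule sum.cong[OF refl], rule sum.swap)
  also have "\<dots> = (\<Sum>p\<in>I. \<Sum>q\<in>I. if p = q then t p * t q else 0)"
    by (intro sum.cong refl) (simp add: sum_distrib_left[symmetric] E_orth)
  also have "\<dots> = (\<Sum>p\<in>I. (t p)\<^sup>2)"
    using fin_I by (simp add: power2_eq_square)
  finally show ?thesis .
qed

lemma sum_trafo: "(\<Sum>p\<in>I. t p * (\<Sum>s\<in>I. E p s * y s)) = (\<Sum>s\<in>I. (\<Sum>p\<in>I. t p * E p s) * y s)"
  for y :: "site \<Rightarrow> real"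
proof -
  have "(\<Sum>p\<in>I. t p * (\<Sum>s\<in>I. E p s * y s)) = (\<Sum>p\<in>I. \<Sum>s\<in>I. t p * E p s * y s)"
    by (simp add: sum_distrib_left mult.assoc)
  also have "\<dots> = (\<Sum>s\<in>I. \<Sum>p\<in>I. t p * E p s * y s)" by (rule sum.swap)
  finally show ?thesis by (simp add: sum_distrib_right)
qed

lemma field_measurable:
  assumes "\<And>s. Y s \<in> borel_measurable M"
  shows "(\<lambda>\<omega>. \<lambda>s\<in>I. Y s \<omega>) \<in> M \<rightarrow>\<^sub>M (\<Pi>\<^sub>M s\<in>I. borel)"
  using assms by measurable

lemma trafo_law:
  assumes Y: "\<And>s. Y s \<in> borel_measurable M"
  shows "prob_space (field_law M I Y)" "sets (field_law M I Y) = sets (\<Pi>\<^sub>M s\<in>I. borel)"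
    "prob_space (distr (field_law M I Y) (\<Pi>\<^sub>M s\<in>I. borel) trafo)"
    "(CLINT y|distr (field_law M I Y) (\<Pi>\<^sub>M s\<in>I. borel) trafo. iexp (\<Sum>p\<in>I. t p * y p))
      = (CLINT \<omega>|M. iexp (\<Sum>p\<in>I. t p * (\<Sum>s\<in>I. E p s * Y s \<omega>)))"
proof -
  note m = field_measurable[OF Y]
  show ps: "prob_space (field_law M I Y)" unfolding field_law_def by (rule prob_space_distr[OF m])
  show sets: "sets (field_law M I Y) = sets (\<Pi>\<^sub>M s\<in>I. borel)" by (simp add: field_law_def)
  have tm: "trafo \<in> field_law M I Y \<rightarrow>\<^sub>M (\<Pi>\<^sub>M s\<in>I. borel)"
    by (simp add: measurable_cong_sets[OF sets refl])
  show "prob_space (distr (field_law M I Y) (\<Pi>\<^sub>M s\<in>I. borel) trafo)"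
    by (rule prob_space.prob_space_distr[OF ps tm])
  have f: "(\<lambda>y. iexp (\<Sum>p\<in>I. t p * y p)) \<in> borel_measurable (\<Pi>\<^sub>M s\<in>I. borel)" by measurable
  have f2: "(\<lambda>y. iexp (\<Sum>p\<in>I. t p * trafo y p)) \<in> borel_measurable (\<Pi>\<^sub>M s\<in>I. borel)"
    by (rule measurable_compose[OF trafo_measurable f])
  have "(CLINT y|distr (field_law M I Y) (\<Pi>\<^sub>M s\<in>I. borel) trafo. iexp (\<Sum>p\<in>I. t p * y p))
      = (CLINT y|field_law M I Y. iexp (\<Sum>p\<in>I. t p * trafo y p))"
    by (rule integral_distr[OF tm f])
  also have "\<dots> = (CLINT \<omega>|M. iexp (\<Sum>p\<in>I. t p * trafo (\<lambda>s\<in>I. Y s \<omega>) p))"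
    unfolding field_law_def by (rule integral_distr[OF m f2])
  also have "\<dots> = (CLINT \<omega>|M. iexp (\<Sum>p\<in>I. t p * (\<Sum>s\<in>I. E p s * Y s \<omega>)))"
    by (simp add: trafo_def)
  finally show "(CLINT y|distr (field_law M I Y) (\<Pi>\<^sub>M s\<in>I. borel) trafo. iexp (\<Sum>p\<in>I. t p * y p))
      = (CLINT \<omega>|M. iexp (\<Sum>p\<in>I. t p * (\<Sum>s\<in>I. E p s * Y s \<omega>)))" .
qed

lemma noise_char: "(CLINT \<omega>|M. iexp (\<Sum>p\<in>I. t p * (\<Sum>s\<in>I. E p s * W s \<omega>)))
    = complex_of_real (exp (- (\<sigma>\<^sup>2 * (\<Sum>p\<in>I. (t p)\<^sup>2) / 2)))"
  unfolding sum_trafo by (subst white_noise_char[OF noise sigma_pos]) (simp only: Parseval)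

text \<open>White noise is invariant under orthogonal maps, here in the form of Parseval's identity
  for the frequencies.\<close>

lemma null_eq: "distr P0 (\<Pi>\<^sub>M s\<in>I. borel) trafo = null"
proof (rule PiM_char_uniqueness[OF fin_I trafo_law(3)[OF W_meas] prob_space_null])
  fix t
  have "(CLINT y|null. iexp (\<Sum>s\<in>I. t s * y s)) = complex_of_real (exp (- (\<Sum>p\<in>I. (t p)\<^sup>2 * \<sigma>\<^sup>2) / 2))"
    unfolding null_def using sigma_pos by (intro char_PiM_normal[OF fin_I]) simp
  then show "(CLINT y|distr P0 (\<Pi>\<^sub>M s\<in>I. borel) trafo. iexp (\<Sum>s\<in>I. t s * y s)) = (CLINT y|null. iexp (\<Sum>s\<in>I. t s * y s))"
    unfolding trafo_law(4)[OF W_meas] noise_char by (simp add: sum_distrib_left mult.commute)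
qed simp_all

lemma observation_char:
  "(CLINT \<omega>|M. iexp (\<Sum>p\<in>I. t p * (\<Sum>s\<in>I. E p s * (X s \<omega> + W s \<omega>))))
    = (CLINT \<omega>|M. iexp (\<Sum>p\<in>I. t p * (\<Sum>s\<in>I. E p s * X s \<omega>)))
      * (CLINT \<omega>|M. iexp (\<Sum>p\<in>I. t p * (\<Sum>s\<in>I. E p s * W s \<omega>)))"
proof -
  define F where "F = (\<lambda>y :: site \<Rightarrow> real. iexp (\<Sum>p\<in>I. t p * (\<Sum>s\<in>I. E p s * y s)))"
  have Fm: "F \<in> borel_measurable (\<Pi>\<^sub>M s\<in>UNIV. borel)" unfolding F_def by measurable
  have m: "(\<lambda>\<omega> s. Y s \<omega>) \<in> M \<rightarrow>\<^sub>M (\<Pi>\<^sub>M s\<in>UNIV. borel)" if "\<And>s. Y s \<in> borel_measurable M" for Y :: "site \<Rightarrow> 'a \<Rightarrow> real"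
    using that by (intro measurable_PiM_single') auto
  have i: "integrable M (\<lambda>\<omega>. F (\<lambda>s. Y s \<omega>))" if "\<And>s. Y s \<in> borel_measurable M" for Y
    by (rule integrable_const_bound[where B = 1, OF _ measurable_compose[OF m[OF that] Fm]]) (auto simp: F_def)
  have "indep_var borel (F \<circ> (\<lambda>\<omega> s. X s \<omega>)) borel (F \<circ> (\<lambda>\<omega> s. W s \<omega>))"
    using indep unfolding independent_fields_def by (rule indep_var_compose[OF _ Fm Fm])
  from indep_var_lebesgue_integral[OF this] i[OF X] i[OF W_meas]
  have "(CLINT \<omega>|M. F (\<lambda>s. X s \<omega>) * F (\<lambda>s. W s \<omega>)) = (CLINT \<omega>|M. F (\<lambda>s. X s \<omega>)) * (CLINT \<omega>|M. F (\<lambda>s. W s \<omega>))"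
    by (simp add: comp_def)
  moreover have "iexp (\<Sum>p\<in>I. t p * (\<Sum>s\<in>I. E p s * (x s + w s))) = F x * F w" for x w
    unfolding F_def exp_add[symmetric]
    by (simp only: distrib_left sum.distrib of_real_add)
  ultimately show ?thesis by (simp only:) (simp only: F_def)
qed

text \<open>By independence the transforms of signal and noise multiply; the relative variances
  \<open>g\<close> and 1 add up to those in \<open>sd\<close>.\<close>

lemma observation_eq: "distr P1 (\<Pi>\<^sub>M s\<in>I. borel) trafo = density null lik"
proof (rule law_eq_density_lik)
  have XW: "(\<lambda>\<omega>. X s \<omega> + W s \<omega>) \<in> borel_measurable M" for s
    using X W_meas by (intro borel_measurable_add)
  show "prob_space (distr P1 (\<Pi>\<^sub>M s\<in>I. borel) trafo)" by (rule trafo_law(3)[OF XW])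
  fix t
  have "(\<Sum>i\<in>I. (t i)\<^sup>2 * (sd i)\<^sup>2) = \<sigma>\<^sup>2 * (\<Sum>p\<in>I. (t p)\<^sup>2 * g p) + \<sigma>\<^sup>2 * (\<Sum>p\<in>I. (t p)\<^sup>2)"
    by (simp add: sd_square sum_distrib_left sum.distrib[symmetric] algebra_simps)
  then have "exp (- (\<Sum>i\<in>I. (t i)\<^sup>2 * (sd i)\<^sup>2) / 2)
      = exp (- (\<sigma>\<^sup>2 * (\<Sum>p\<in>I. (t p)\<^sup>2 * g p) / 2)) * exp (- (\<sigma>\<^sup>2 * (\<Sum>p\<in>I. (t p)\<^sup>2) / 2))"
    by (simp add: exp_add[symmetric] add_divide_distrib)
  then show "(CLINT y|distr P1 (\<Pi>\<^sub>M s\<in>I. borel) trafo. iexp (\<Sum>i\<in>I. t i * y i))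
      = (CLINT \<omega>|M. iexp (\<Sum>i\<in>I. t i * h i \<omega>)) * complex_of_real (exp (- (\<Sum>i\<in>I. (t i)\<^sup>2 * (sd i)\<^sup>2) / 2))"
    unfolding trafo_law(4)[OF XW] observation_char signal_char noise_char by (simp add: mult.assoc)
qed simp

lemma lik_trafo_measurable: "(\<lambda>y. lik (trafo y)) \<in> borel_measurable P0"
  using measurable_compose[OF trafo_measurable lik_measurable]
  by (simp add: measurable_cong_sets[OF trafo_law(2)[OF W_meas] refl])

text \<open>Because \<open>trafo\<close> is its own inverse on the observation space, every event is
  the preimage of an event in basis coordinates, so the density found there may be pulled
  back.\<close>

lemma observation_density: "P1 = density P0 (\<lambda>y. lik (trafo y))"
proof (rule measure_eqI)
  have XW: "(\<lambda>\<omega>. X s \<omega> + W s \<omega>) \<in> borel_measurable M" for s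
    using X W_meas by (intro borel_measurable_add)
  note sets1 = trafo_law(2)[OF XW] and sets0 = trafo_law(2)[OF W_meas]
  have sp1: "space P1 = space (\<Pi>\<^sub>M s\<in>I. borel)" and sp0: "space P0 = space (\<Pi>\<^sub>M s\<in>I. borel)"
    by (rule sets_eq_imp_space_eq[OF sets1] sets_eq_imp_space_eq[OF sets0])+
  show "sets P1 = sets (density P0 (\<lambda>y. lik (trafo y)))" using sets1 sets0 by simp
  fix A assume "A \<in> sets P1"
  then have A: "A \<in> sets (\<Pi>\<^sub>M s\<in>I. borel)" by (simp add: sets1)
  define B where "B = trafo -` A \<inter> space (\<Pi>\<^sub>M s\<in>I. borel)"
  have B: "B \<in> sets (\<Pi>\<^sub>M s\<in>I. borel)"
    unfolding B_def by (rule measurable_sets[OF trafo_measurable A])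
  have B_iff: "trafo y \<in> B \<longleftrightarrow> y \<in> A" if "y \<in> space (\<Pi>\<^sub>M s\<in>I. borel)" for y
    using that trafo_trafo[OF that] measurable_space[OF trafo_measurable that] by (simp add: B_def)
  have tm: "trafo \<in> P \<rightarrow>\<^sub>M (\<Pi>\<^sub>M s\<in>I. borel)" if "sets P = sets (\<Pi>\<^sub>M s\<in>I. borel)" for P
    by (simp add: measurable_cong_sets[OF that refl])
  have "emeasure P1 A = emeasure (distr P1 (\<Pi>\<^sub>M s\<in>I. borel) trafo) B"
  proof -
    have "trafo -` B \<inter> space P1 = A"
      using B_iff sets.sets_into_space[OF A] by (auto simp: sp1)
    then show ?thesis by (simp add: emeasure_distr[OF tm[OF sets1] B])
  qed
  also have "\<dots> = (\<integral>\<^sup>+y. lik y * indicator B y \<partial>null)"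
    unfolding observation_eq using B by (intro emeasure_density) simp_all
  also have "\<dots> = (\<integral>\<^sup>+y. lik (trafo y) * indicator B (trafo y) \<partial>P0)"
    unfolding null_eq[symmetric] using B by (intro nn_integral_distr[OF tm[OF sets0]]) simp
  also have "\<dots> = (\<integral>\<^sup>+y. lik (trafo y) * indicator A y \<partial>P0)"
    by (intro nn_integral_cong) (simp add: sp0 B_iff indicator_def)
  also have "\<dots> = emeasure (density P0 (\<lambda>y. lik (trafo y))) A"
    using A sets0 by (intro emeasure_density[symmetric] lik_trafo_measurable) simp
  finally show "emeasure P1 A = emeasure (density P0 (\<lambda>y. lik (trafo y))) A" .
qed

lemma measure_null_eq:
  assumes "{y\<in>space null. Q y} \<in> sets null"
  shows "measure P0 {y\<in>space P0. Q (trafo y)} = measure null {y\<in>space null. Q y}"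
proof -
  have tm: "trafo \<in> P0 \<rightarrow>\<^sub>M (\<Pi>\<^sub>M s\<in>I. borel)"
    by (simp add: measurable_cong_sets[OF trafo_law(2)[OF W_meas] refl])
  have "measure (distr P0 (\<Pi>\<^sub>M s\<in>I. borel) trafo) {y\<in>space null. Q y} = measure P0 (trafo -` {y\<in>space null. Q y} \<inter> space P0)"
    using assms by (intro measure_distr[OF tm]) simp
  moreover have "trafo -` {y\<in>space null. Q y} \<inter> space P0 = {y\<in>space P0. Q (trafo y)}"
    using measurable_space[OF tm] sets_eq_imp_space_eq[OF sets_null] by auto
  ultimately show ?thesis by (simp add: null_eq)
qed

end

text \<open>Two demands remain on a model: \<open>mix\<close> is nowhere smaller than the
  exponential of minus \<open>b k\<close>, a quantity of smaller order than the number of sites, and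
  the divergences have an average limit. Both ranges of \<zeta> are instances.\<close>

theorem window_error_exponent:
  fixes n :: "nat \<Rightarrow> real"
  assumes n_def: "n = (\<lambda>k. real (card (I k)))"
    and win: "\<And>k. window M X W \<sigma> (I k) (E k) (g k) (h k)"
    and \<alpha>: "0 < \<alpha>" "\<alpha> < 1" and n: "filterlim n at_top sequentially"
    and b: "\<And>k y. ennreal (exp (- b k)) \<le> gauss_mixture.mix M (I k) \<sigma> (g k) (h k) y"
    and b0: "(\<lambda>k. b k / n k) \<longlonglongrightarrow> 0"
    and K: "(\<lambda>k. (\<Sum>p\<in>I k. stein (g k p)) / n k) \<longlonglongrightarrow> K"
    and np: "\<And>k. neyman_pearson \<alpha> (field_law M (I k) W) (field_law M (I k) (\<lambda>s \<omega>. X s \<omega> + W s \<omega>)) (\<phi> k)"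
  shows "(\<lambda>k. - (1 / n k) * ln (miss_prob (field_law M (I k) (\<lambda>s \<omega>. X s \<omega> + W s \<omega>)) (\<phi> k))) \<longlonglongrightarrow> K"
proof -
  define P0 where "P0 = (\<lambda>k. field_law M (I k) W)"
  define Lik where "Lik = (\<lambda>k. gauss_mixture.lik M (I k) \<sigma> (g k) (h k))"
  define T where "T = (\<lambda>k. window.trafo (I k) (E k))"
  define L where "L = (\<lambda>k y. Lik k (T k y))"
  define N where "N = (\<lambda>k. gauss_mixture.null (I k) \<sigma>)"
  define S where "S = (\<lambda>k. \<Sum>p\<in>I k. stein (g k p))"
  have W: "W s \<in> borel_measurable M" for s
    using window.W_meas[OF win[of 0]] .
  have X: "X s \<in> borel_measurable M" for s
    using window.X[OF win[of 0]] .
  have P1: "field_law M (I k) (\<lambda>s \<omega>. X s \<omega> + W s \<omega>) = density (P0 k) (L k)" for k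
    unfolding P0_def L_def Lik_def T_def by (rule window.observation_density[OF win])
  have gm: "gauss_mixture M (I k) \<sigma> (g k) (h k)" for k
  proof -
    interpret window M X W \<sigma> "I k" "E k" "g k" "h k" by (rule win)
    show ?thesis by unfold_locales
  qed
  have Lm: "Lik k \<in> borel_measurable (N k)" for k
    using gauss_mixture.lik_measurable[OF gm] by (simp add: Lik_def N_def measurable_cong_sets[OF gauss_mixture.sets_null[OF gm] refl])
  have tr: "measure (P0 k) {y\<in>space (P0 k). Q (T k y)} = measure (N k) {y\<in>space (N k). Q y}"
    if "{y\<in>space (N k). Q y} \<in> sets (N k)" for k Q
    using window.measure_null_eq[OF win, of k Q] that by (simp only: P0_def T_def N_def)
  have nev: "\<forall>\<^sub>F k in sequentially. c < n k" for c
    using n unfolding filterlim_at_top_dense by blast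
  have inv: "(\<lambda>k. c / n k) \<longlonglongrightarrow> 0" for c
    by (rule real_tendsto_divide_at_top[OF tendsto_const n])
  have "(\<lambda>k. - (1 / n k) * ln (miss_prob (density (P0 k) (L k)) (\<phi> k))) \<longlonglongrightarrow> K"
  proof (rule stein_lemma[where \<alpha> = \<alpha>])
    show "prob_space (P0 k)" for k
      unfolding P0_def by (rule window.trafo_law(1)[OF win W])
    show "L k \<in> borel_measurable (P0 k)" for k
      unfolding P0_def L_def Lik_def T_def by (rule window.lik_trafo_measurable[OF win])
    show "prob_space (density (P0 k) (L k))" for k
      unfolding P1[symmetric] by (rule window.trafo_law(1)[OF win]) (use X W in measurable)
    show "neyman_pearson \<alpha> (P0 k) (density (P0 k) (L k)) (\<phi> k)" for k
      unfolding P1[symmetric] unfolding P0_def by (rule np)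
    fix \<epsilon> :: real assume e: "0 < \<epsilon>"
    \<comment> \<open>Chebyshev's bound at deviation n \<epsilon> / 4, of order 1 / n.\<close>
    have tail: "n k / (2 * (n k * \<epsilon> / 4)\<^sup>2) = 8 / \<epsilon>\<^sup>2 / n k" for k
      by (simp add: power2_eq_square)
    show "(\<lambda>k. measure (P0 k) {y\<in>space (P0 k). L k y < ennreal (exp (- (n k * (K + \<epsilon>))))}) \<longlonglongrightarrow> 0"
    proof (rule tendsto_sandwich[OF _ _ tendsto_const inv[of "8 / \<epsilon>\<^sup>2"]])
      have "\<forall>\<^sub>F k in sequentially. S k / n k < K + \<epsilon> / 4" "\<forall>\<^sub>F k in sequentially. b k / n k < \<epsilon> / 4"
        using order_tendstoD(2)[OF K, of "K + \<epsilon> / 4"] order_tendstoD(2)[OF b0, of "\<epsilon> / 4"] e by (auto simp: S_def)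
      then show "\<forall>\<^sub>F k in sequentially. measure (P0 k) {y\<in>space (P0 k). L k y < ennreal (exp (- (n k * (K + \<epsilon>))))} \<le> 8 / \<epsilon>\<^sup>2 / n k"
        using nev[of 0]
      proof eventually_elim
        case (elim k)
        interpret N: prob_space "N k" unfolding N_def by (rule gauss_mixture.prob_space_null[OF gm])
        note [measurable] = Lm[of k]
        have a: "0 < n k * \<epsilon> / 4" using elim e by simp
        have "S k < (K + \<epsilon> / 4) * n k" "b k < \<epsilon> / 4 * n k"
          using elim by (simp_all only: pos_divide_less_eq)
        \<comment> \<open>A quarter of \<epsilon> each for the divergences, the fluctuation and
          \<open>b k\<close>.\<close>
        then have le: "S k + n k * \<epsilon> / 4 + b k \<le> n k * (K + \<epsilon>)"
        proof -
          have "(K + \<epsilon> / 4) * n k = K * n k + n k * \<epsilon> / 4" "\<epsilon> / 4 * n k = n k * \<epsilon> / 4"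
            "n k * (K + \<epsilon>) = K * n k + n k * \<epsilon>" by (simp_all add: algebra_simps)
          then show ?thesis using a \<open>S k < _\<close> \<open>b k < _\<close> by linarith
        qed
        have "measure (P0 k) {y\<in>space (P0 k). L k y < ennreal (exp (- (n k * (K + \<epsilon>))))}
            = measure (N k) {y\<in>space (N k). Lik k y < ennreal (exp (- (n k * (K + \<epsilon>))))}"
          unfolding L_def by (rule tr) measurable
        also have "\<dots> \<le> measure (N k) {y\<in>space (N k). Lik k y < ennreal (exp (- (S k + n k * \<epsilon> / 4 + b k)))}"
        proof (rule N.finite_measure_mono)
          show "{y\<in>space (N k). Lik k y < ennreal (exp (- (n k * (K + \<epsilon>))))}
              \<subseteq> {y\<in>space (N k). Lik k y < ennreal (exp (- (S k + n k * \<epsilon> / 4 + b k)))}"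
            using le by (auto elim!: order_less_le_trans intro!: ennreal_leI)
        qed measurable
        also have "\<dots> \<le> n k / (2 * (n k * \<epsilon> / 4)\<^sup>2)"
          unfolding N_def Lik_def S_def n_def
          by (rule gauss_mixture.lik_lower_tail[OF gm b]) (use a in \<open>simp add: n_def\<close>)
        finally show ?case by (simp only: tail)
      qed
    qed simp
    show "(\<lambda>k. measure (P0 k) {y\<in>space (P0 k). ennreal (exp (- (n k * (K - \<epsilon>)))) \<le> L k y}) \<longlonglongrightarrow> 0"
    proof (rule tendsto_sandwich[OF _ _ tendsto_const])
      have "filterlim (\<lambda>k. \<epsilon> / 4 * n k) at_top sequentially"
        using e by (intro filterlim_tendsto_pos_mult_at_top[OF tendsto_const _ n]) simp
      then have "(\<lambda>k. exp (- (\<epsilon> / 4 * n k))) \<longlonglongrightarrow> 0"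
        by (intro filterlim_compose[OF exp_at_bot]) (simp add: filterlim_uminus_at_bot)
      from tendsto_add[OF inv[of "8 / \<epsilon>\<^sup>2"] this]
      show "(\<lambda>k. 8 / \<epsilon>\<^sup>2 / n k + exp (- (\<epsilon> / 4 * n k))) \<longlonglongrightarrow> 0" by simp
      have "\<forall>\<^sub>F k in sequentially. K - \<epsilon> / 2 < S k / n k"
        using order_tendstoD(1)[OF K, of "K - \<epsilon> / 2"] e by (auto simp: S_def)
      then show "\<forall>\<^sub>F k in sequentially. measure (P0 k) {y\<in>space (P0 k). ennreal (exp (- (n k * (K - \<epsilon>)))) \<le> L k y}
          \<le> 8 / \<epsilon>\<^sup>2 / n k + exp (- (\<epsilon> / 4 * n k))"
        using nev[of 0]
      proof eventually_elim
        case (elim k)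
        interpret N: prob_space "N k" unfolding N_def by (rule gauss_mixture.prob_space_null[OF gm])
        note [measurable] = Lm[of k]
        have a: "0 < n k * \<epsilon> / 4" using elim e by simp
        have "(K - \<epsilon> / 2) * n k < S k" using elim by (simp only: pos_less_divide_eq)
        \<comment> \<open>Half of \<epsilon> pays for the divergences; the other half is the 2 a of
          \<open>lik_upper_tail\<close> with a = n \<epsilon> / 4.\<close>
        then have le: "n k * (K - \<epsilon>) \<le> S k - 2 * (n k * \<epsilon> / 4)"
          by (simp add: algebra_simps)
        have "measure (P0 k) {y\<in>space (P0 k). ennreal (exp (- (n k * (K - \<epsilon>)))) \<le> L k y}
            = measure (N k) {y\<in>space (N k). ennreal (exp (- (n k * (K - \<epsilon>)))) \<le> Lik k y}"
          unfolding L_def by (rule tr) measurable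
        also have "\<dots> \<le> measure (N k) {y\<in>space (N k). ennreal (exp (- (S k - 2 * (n k * \<epsilon> / 4)))) \<le> Lik k y}"
        proof (rule N.finite_measure_mono)
          show "{y\<in>space (N k). ennreal (exp (- (n k * (K - \<epsilon>)))) \<le> Lik k y}
              \<subseteq> {y\<in>space (N k). ennreal (exp (- (S k - 2 * (n k * \<epsilon> / 4)))) \<le> Lik k y}"
            using le by (auto elim!: order_trans[rotated] intro!: ennreal_leI)
        qed measurable
        also have "\<dots> \<le> n k / (2 * (n k * \<epsilon> / 4)\<^sup>2) + exp (- (n k * \<epsilon> / 4))"
          unfolding N_def Lik_def S_def n_def
          by (rule gauss_mixture.lik_upper_tail[OF gm]) (use a in \<open>simp add: n_def\<close>)
        finally show ?case by (simp only: tail) (simp only: mult.commute[of "n k" \<epsilon>] times_divide_eq_left)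
      qed
    qed simp
  qed (use \<alpha> n in auto)
  then show ?thesis by (simp only: P1)
qed

section \<open>The Dirichlet decomposition of the signal on a rectangle\<close>

text \<open>On a rectangle the operator \<open>1 - \<zeta> N\<close>, with \<open>N\<close> the adjacency operator with zero boundary
  values, is diagonal in the sine basis with eigenvalues \<open>symb \<zeta>\<close> at the grid points. Its
  Green's function applied to the innovations gives the part \<open>field0\<close> of the signal that is
  independent of the exterior; \<open>bdry\<close> is the part explained by the exterior.\<close>

locale sine_window = sfar M X \<zeta> \<kappa> for M :: "'a measure" and X \<zeta> \<kappa> +
  fixes a c :: int and A B :: nat
begin

definition rect :: "site set" where
  "rect = {a..<a + int A} \<times> {c..<c + int B}"

text \<open>The offsets move the rectangle to indices starting at 1. Frequencies are labelled by the
  same rectangle as sites, which makes the matrix square and symmetric.\<close>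

definition basis :: "site \<Rightarrow> site \<Rightarrow> real" where
  "basis p s = sine A (fst p - a + 1) (fst s - a + 1) * sine B (snd p - c + 1) (snd s - c + 1)"

definition eig :: "site \<Rightarrow> real" where
  "eig p = symb \<zeta> (pi * of_int (fst p - a + 1) / (real A + 1)) (pi * of_int (snd p - c + 1) / (real B + 1))"

lemma finite_rect: "finite rect"
  by (simp add: rect_def)

lemma card_rect: "card rect = A * B"
  by (simp add: rect_def)

lemma sum_rect: "(\<Sum>s\<in>rect. f (fst s - a + 1) (snd s - c + 1)) = (\<Sum>i\<in>{1..int A}. \<Sum>j\<in>{1..int B}. f i j)"
proof -
  have "(\<Sum>s\<in>rect. f (fst s - a + 1) (snd s - c + 1)) = (\<Sum>s\<in>{1..int A} \<times> {1..int B}. f (fst s) (snd s))"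
    by (rule sum.reindex_bij_witness[where i = "\<lambda>s. (fst s + a - 1, snd s + c - 1)"
          and j = "\<lambda>s. (fst s - a + 1, snd s - c + 1)"]) (auto simp: rect_def)
  then show ?thesis by (simp add: sum.cartesian_product split_beta')
qed

lemma basis_sym: "basis p s = basis s p"
  unfolding basis_def by (simp only: sine_sym)

lemma basis_orthonormal:
  assumes p: "p \<in> rect" and q: "q \<in> rect"
  shows "(\<Sum>s\<in>rect. basis p s * basis q s) = (if p = q then 1 else 0)"
proof -
  have "(\<Sum>s\<in>rect. basis p s * basis q s)
      = (\<Sum>i\<in>{1..int A}. \<Sum>j\<in>{1..int B}. (sine A (fst p - a + 1) i * sine A (fst q - a + 1) i)
          * (sine B (snd p - c + 1) j * sine B (snd q - c + 1) j))"
    unfolding basis_def sum_rect[symmetric] by (simp only: mult_ac)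
  also have "\<dots> = (\<Sum>i\<in>{1..int A}. sine A (fst p - a + 1) i * sine A (fst q - a + 1) i)
      * (\<Sum>j\<in>{1..int B}. sine B (snd p - c + 1) j * sine B (snd q - c + 1) j)"
    by (rule sum_product[symmetric])
  also have "\<dots> = (if fst p = fst q then 1 else 0) * (if snd p = snd q then 1 else 0)"
    using p q by (subst (1 2) sine_orthonormal) (auto simp: rect_def)
  finally show ?thesis by (auto simp: prod_eq_iff)
qed

lemma basis_orthonormal_rows:
  assumes "s \<in> rect" "t \<in> rect"
  shows "(\<Sum>p\<in>rect. basis p s * basis p t) = (if s = t then 1 else 0)"
  using basis_orthonormal[OF assms] by (simp only: basis_sym[of s] basis_sym[of t])

lemma eig_pos: "0 < eig p"
  unfolding eig_def by (rule symb_pos[OF zeta_nonneg zeta_less])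

text \<open>The addition formula in each coordinate. It is valid on the whole lattice; the rectangle
  enters only through the zeros at its boundary.\<close>

lemma basis_neighbours:
  "basis p s - \<zeta> * (basis p (s + (1, 0)) + basis p (s + (- 1, 0)) + basis p (s + (0, 1)) + basis p (s + (0, - 1)))
    = eig p * basis p s"
proof -
  define x y where "x = fst s - a + 1" and "y = snd s - c + 1"
  define m n where "m = fst p - a + 1" and "n = snd p - c + 1"
  have e: "basis p s = sine A m x * sine B n y" "basis p (s + (1, 0)) = sine A m (x + 1) * sine B n y"
    "basis p (s + (- 1, 0)) = sine A m (x - 1) * sine B n y" "basis p (s + (0, 1)) = sine A m x * sine B n (y + 1)"
    "basis p (s + (0, - 1)) = sine A m x * sine B n (y - 1)"
    unfolding basis_def x_def y_def m_def n_def by (simp_all add: algebra_simps)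
  have "basis p (s + (1, 0)) + basis p (s + (- 1, 0)) + basis p (s + (0, 1)) + basis p (s + (0, - 1))
      = (sine A m (x + 1) + sine A m (x - 1)) * sine B n y + sine A m x * (sine B n (y + 1) + sine B n (y - 1))"
    unfolding e by (simp add: algebra_simps)
  also have "\<dots> = (2 * cos (pi * of_int m / (real A + 1)) + 2 * cos (pi * of_int n / (real B + 1))) * basis p s"
    unfolding sine_neighbours e by (simp add: algebra_simps)
  finally have nb: "basis p (s + (1, 0)) + basis p (s + (- 1, 0)) + basis p (s + (0, 1)) + basis p (s + (0, - 1)) = \<dots>" .
  have ev: "eig p = 1 - 2 * \<zeta> * cos (pi * of_int m / (real A + 1)) - 2 * \<zeta> * cos (pi * of_int n / (real B + 1))"
    by (simp only: eig_def symb_def m_def n_def)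
  show ?thesis unfolding nb ev by (simp add: algebra_simps)
qed

lemma basis_boundary:
  assumes "s \<in> rect" "s + e \<notin> rect" "e \<in> {(1, 0), (- 1, 0), (0, 1), (0, - 1)}"
  shows "basis p (s + e) = 0"
proof -
  have "fst (s + e) - a + 1 \<in> {0, int A + 1} \<or> snd (s + e) - c + 1 \<in> {0, int B + 1}"
    using assms by (auto simp: rect_def)
  then show ?thesis using sine_boundary by (auto simp: basis_def)
qed

text \<open>If the neighbour lies outside the rectangle, its term is missing from the sum, but there
  the basis function vanishes. Truncating the neighbour sum thus does not change its action on the
  basis.\<close>

lemma basis_shift_sum:
  assumes s: "s \<in> rect" and e: "- e \<in> {(1, 0), (- 1, 0), (0, 1), (0, - 1)}"
  shows "(\<Sum>t\<in>rect. basis r t * (if t + e = s then 1 else 0)) = basis r (s + - e)"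
proof -
  have "(\<Sum>t\<in>rect. basis r t * (if t + e = s then 1 else 0)) = (\<Sum>t\<in>rect. if t = s + - e then basis r t else 0)"
    by (intro sum.cong refl) (auto simp: algebra_simps)
  also have "\<dots> = (if s + - e \<in> rect then basis r (s + - e) else 0)"
    using finite_rect by simp
  finally show ?thesis using basis_boundary[OF s _ e] by auto
qed

text \<open>Basis functions are eigenvectors of the covariance matrix of the innovations in the
  rectangle.\<close>

lemma basis_innov_cov:
  assumes s: "s \<in> rect"
  shows "(\<Sum>t\<in>rect. basis r t * (LINT \<omega>|M. innov s \<omega> * innov t \<omega>)) = eig r * basis r s / \<kappa>"
proof -
  let ?d = "\<lambda>e t. if t + e = s then 1 else (0::real)"
  have "(\<Sum>t\<in>rect. basis r t * (LINT \<omega>|M. innov s \<omega> * innov t \<omega>))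
      = (\<Sum>t\<in>rect. (basis r t * (if t = s then 1 else 0) - \<zeta> * (basis r t * ?d (1, 0) t + basis r t * ?d (- 1, 0) t
        + basis r t * ?d (0, 1) t + basis r t * ?d (0, - 1) t)) / \<kappa>)"
    unfolding innov_innov_cov by (intro sum.cong refl) (simp add: algebra_simps eq_commute[of s])
  also have "\<dots> = ((\<Sum>t\<in>rect. basis r t * (if t = s then 1 else 0)) - \<zeta> * ((\<Sum>t\<in>rect. basis r t * ?d (1, 0) t)
      + (\<Sum>t\<in>rect. basis r t * ?d (- 1, 0) t) + (\<Sum>t\<in>rect. basis r t * ?d (0, 1) t) + (\<Sum>t\<in>rect. basis r t * ?d (0, - 1) t))) / \<kappa>"
    by (simp only: sum_divide_distrib[symmetric] sum_subtractf sum_distrib_left[symmetric] sum.distrib)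
  also have "(\<Sum>t\<in>rect. basis r t * (if t = s then 1 else 0)) = basis r s"
    using finite_rect s by (simp add: if_distrib[where f = "\<lambda>x. _ * x"] cong: if_cong)
  also have "(\<Sum>t\<in>rect. basis r t * ?d (1, 0) t) = basis r (s + (- 1, 0))"
    using basis_shift_sum[OF s, of "(1, 0)" r] by simp
  also have "(\<Sum>t\<in>rect. basis r t * ?d (- 1, 0) t) = basis r (s + (1, 0))"
    using basis_shift_sum[OF s, of "(- 1, 0)" r] by simp
  also have "(\<Sum>t\<in>rect. basis r t * ?d (0, 1) t) = basis r (s + (0, - 1))"
    using basis_shift_sum[OF s, of "(0, 1)" r] by simp
  also have "(\<Sum>t\<in>rect. basis r t * ?d (0, - 1) t) = basis r (s + (0, 1))"
    using basis_shift_sum[OF s, of "(0, - 1)" r] by simp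
  finally show ?thesis
    using basis_neighbours[of r s] by (simp add: algebra_simps)
qed

section \<open>Orthogonal splitting of the signal coefficients\<close>

definition Xh :: "site \<Rightarrow> 'a \<Rightarrow> real" where "Xh p \<omega> = (\<Sum>s\<in>rect. basis p s * X s \<omega>)"
definition innovh :: "site \<Rightarrow> 'a \<Rightarrow> real" where "innovh p \<omega> = (\<Sum>s\<in>rect. basis p s * innov s \<omega>)"
text \<open>Dividing by the eigenvalue is the Green's function in the sine basis. It is also the
  regression coefficient (1 / \<kappa>) / (\<open>eig p\<close> / \<kappa>), so this is the
  orthogonal projection of \<open>Xh p\<close> on the innovations of the rectangle.\<close>

definition field0 :: "site \<Rightarrow> 'a \<Rightarrow> real" where "field0 p \<omega> = 1 / eig p * innovh p \<omega>"
definition bdry :: "site \<Rightarrow> 'a \<Rightarrow> real" where "bdry p \<omega> = Xh p \<omega> - field0 p \<omega>"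

lemma Xh_lin: "Xh p \<in> lin"
proof -
  have "(\<lambda>\<omega>. \<Sum>s\<in>rect. basis p s * X s \<omega>) \<in> lin" by (rule lin_span_sum[OF lin_span_scale[OF X_lin]])
  then show ?thesis unfolding Xh_def[abs_def] .
qed

lemma innovh_lin: "innovh p \<in> lin"
proof -
  have "(\<lambda>\<omega>. \<Sum>s\<in>rect. basis p s * innov s \<omega>) \<in> lin" by (rule lin_span_sum[OF lin_span_scale[OF innov_lin]])
  then show ?thesis unfolding innovh_def[abs_def] .
qed

lemma field0_lin: "field0 p \<in> lin"
  using lin_span_scale[OF innovh_lin] unfolding field0_def[abs_def] .

lemma bdry_lin: "bdry p \<in> lin"
  using lin_span_diff[OF Xh_lin field0_lin] unfolding bdry_def[abs_def] .

lemma innovh_mult: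
  assumes "R \<in> lin"
  shows "(LINT \<omega>|M. innovh p \<omega> * R \<omega>) = (\<Sum>s\<in>rect. basis p s * (LINT \<omega>|M. innov s \<omega> * R \<omega>))"
  unfolding innovh_def by (rule lin_cov_sum[OF innov_lin assms])

lemma innovh_Xh_cov:
  assumes "p \<in> rect" "r \<in> rect"
  shows "(LINT \<omega>|M. innovh p \<omega> * Xh r \<omega>) = (if p = r then 1 / \<kappa> else 0)"
proof -
  have "(LINT \<omega>|M. innov s \<omega> * Xh r \<omega>) = basis r s / \<kappa>" if s: "s \<in> rect" for s
  proof -
    have "(LINT \<omega>|M. (\<Sum>t\<in>rect. basis r t * X t \<omega>) * innov s \<omega>) = (\<Sum>t\<in>rect. basis r t * (LINT \<omega>|M. X t \<omega> * innov s \<omega>))"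
      by (rule lin_cov_sum[OF X_lin innov_lin])
    also have "\<dots> = (\<Sum>t\<in>rect. if t = s then basis r t / \<kappa> else 0)"
      using innov_cov[of s] by (intro sum.cong refl) (simp add: mult.commute)
    finally show ?thesis using finite_rect s by (simp add: Xh_def mult.commute)
  qed
  then have "(LINT \<omega>|M. innovh p \<omega> * Xh r \<omega>) = (\<Sum>s\<in>rect. basis p s * basis r s) / \<kappa>"
    unfolding innovh_mult[OF Xh_lin] by (simp add: sum_divide_distrib)
  then show ?thesis by (simp add: basis_orthonormal[OF assms])
qed

lemma innovh_cov:
  assumes "p \<in> rect" "r \<in> rect"
  shows "(LINT \<omega>|M. innovh p \<omega> * innovh r \<omega>) = (if p = r then eig r / \<kappa> else 0)"
proof -
  have "(LINT \<omega>|M. innov s \<omega> * innovh r \<omega>) = eig r * basis r s / \<kappa>" if s: "s \<in> rect" for s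
  proof -
    have "(LINT \<omega>|M. innov s \<omega> * innovh r \<omega>) = (LINT \<omega>|M. innovh r \<omega> * innov s \<omega>)"
      by (simp only: mult.commute)
    also have "\<dots> = (\<Sum>t\<in>rect. basis r t * (LINT \<omega>|M. innov t \<omega> * innov s \<omega>))"
      by (rule innovh_mult[OF innov_lin])
    also have "\<dots> = (\<Sum>t\<in>rect. basis r t * (LINT \<omega>|M. innov s \<omega> * innov t \<omega>))"
      by (simp only: mult.commute)
    finally show ?thesis using basis_innov_cov[OF s] by simp
  qed
  then have "(LINT \<omega>|M. innovh p \<omega> * innovh r \<omega>) = (\<Sum>s\<in>rect. basis p s * (eig r * basis r s / \<kappa>))"
    unfolding innovh_mult[OF innovh_lin] by simp
  also have "\<dots> = eig r / \<kappa> * (\<Sum>s\<in>rect. basis p s * basis r s)"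
    by (simp add: sum_distrib_left mult_ac)
  finally show ?thesis by (simp add: basis_orthonormal[OF assms])
qed

lemma field0_mult: "(LINT \<omega>|M. field0 p \<omega> * R \<omega>) = (LINT \<omega>|M. innovh p \<omega> * R \<omega>) / eig p"
  unfolding field0_def by (simp add: mult.assoc)

lemma field0_cov:
  assumes "p \<in> rect" "r \<in> rect"
  shows "(LINT \<omega>|M. field0 p \<omega> * field0 r \<omega>) = (if p = r then 1 / (\<kappa> * eig p) else 0)"
proof -
  have "(LINT \<omega>|M. innovh p \<omega> * field0 r \<omega>) = (LINT \<omega>|M. field0 r \<omega> * innovh p \<omega>)"
    by (simp only: mult.commute)
  also have "\<dots> = (if p = r then 1 / \<kappa> else 0)"
    unfolding field0_mult innovh_cov[OF assms(2,1)] using eig_pos[of r] by auto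
  finally show ?thesis unfolding field0_mult by simp
qed

text \<open>\<open>Xh r\<close> and \<open>field0 r\<close> have the same covariance with
  \<open>field0 p\<close>: the first by biorthogonality of field and innovations, the second because
  the eigenvalue cancels once.\<close>

lemma field0_bdry_cov:
  assumes "p \<in> rect" "r \<in> rect"
  shows "(LINT \<omega>|M. bdry r \<omega> * field0 p \<omega>) = 0"
proof -
  have "(LINT \<omega>|M. Xh r \<omega> * field0 p \<omega>) = (LINT \<omega>|M. field0 p \<omega> * Xh r \<omega>)"
    by (simp only: mult.commute)
  also have "\<dots> = (if p = r then 1 / (\<kappa> * eig p) else 0)"
    unfolding field0_mult innovh_Xh_cov[OF assms] by simp
  finally show ?thesis
    unfolding bdry_def lin_cov_diff[OF Xh_lin field0_lin field0_lin] field0_cov[OF assms(2,1)] by auto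
qed

text \<open>Orthogonality of the splitting subtracts the variances of \<open>field0\<close>;
  orthonormality of the basis preserves the total variance of the signal, and stationarity evaluates
  it.\<close>

lemma bdry_variance_sum:
  "(\<Sum>p\<in>rect. LINT \<omega>|M. (bdry p \<omega>)\<^sup>2) = card rect * gam (0, 0) - (\<Sum>p\<in>rect. 1 / (\<kappa> * eig p))"
proof -
  have "(LINT \<omega>|M. (bdry p \<omega>)\<^sup>2) = (LINT \<omega>|M. (Xh p \<omega>)\<^sup>2) - 1 / (\<kappa> * eig p)" if p: "p \<in> rect" for p
  proof -
    have "(LINT \<omega>|M. (Xh p \<omega>)\<^sup>2) = (LINT \<omega>|M. (bdry p \<omega> + field0 p \<omega>)\<^sup>2)"
      by (simp add: bdry_def)
    then show ?thesis
      unfolding lin_square_add[OF bdry_lin field0_lin] field0_bdry_cov[OF p p]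
      using field0_cov[OF p p] by (simp add: power2_eq_square)
  qed
  then have "(\<Sum>p\<in>rect. LINT \<omega>|M. (bdry p \<omega>)\<^sup>2) = (\<Sum>p\<in>rect. LINT \<omega>|M. (Xh p \<omega>)\<^sup>2) - (\<Sum>p\<in>rect. 1 / (\<kappa> * eig p))"
    by (simp add: sum_subtractf)
  also have "(\<Sum>p\<in>rect. LINT \<omega>|M. (Xh p \<omega>)\<^sup>2)
      = (\<Sum>p\<in>rect. \<Sum>s\<in>rect. \<Sum>t\<in>rect. basis p s * basis p t * (LINT \<omega>|M. X s \<omega> * X t \<omega>))"
    unfolding Xh_def by (intro sum.cong refl lin_square_sum[OF X_lin])
  also have "\<dots> = (\<Sum>s\<in>rect. \<Sum>t\<in>rect. \<Sum>p\<in>rect. basis p s * basis p t * (LINT \<omega>|M. X s \<omega> * X t \<omega>))"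
    by (subst sum.swap, rule sum.cong[OF refl], rule sum.swap)
  also have "\<dots> = (\<Sum>s\<in>rect. \<Sum>t\<in>rect. if s = t then (LINT \<omega>|M. X s \<omega> * X t \<omega>) else 0)"
    by (intro sum.cong refl)
       (simp add: sum_distrib_right[symmetric] basis_orthonormal_rows)
  also have "\<dots> = (\<Sum>s\<in>rect. gam (0, 0))"
    using finite_rect variance_eq_gam by (simp add: power2_eq_square)
  finally show ?thesis by simp
qed

text \<open>Every combination of the two parts is Gaussian, so a vanishing covariance makes the
  exponent additive. The variance 1 / (\<kappa> \<open>eig p\<close>) is expressed relative to the
  noise because \<open>window\<close> measures \<open>g\<close> in units of the noise
  variance.\<close>

lemma signal_char_decomposition:
  assumes \<sigma>: "0 < \<sigma>"
  shows "(CLINT \<omega>|M. iexp (\<Sum>p\<in>rect. t p * (\<Sum>s\<in>rect. basis p s * X s \<omega>)))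
    = (CLINT \<omega>|M. iexp (\<Sum>p\<in>rect. t p * bdry p \<omega>))
      * complex_of_real (exp (- (\<sigma>\<^sup>2 * (\<Sum>p\<in>rect. (t p)\<^sup>2 * (1 / (\<kappa> * \<sigma>\<^sup>2 * eig p))) / 2)))"
proof -
  define H where "H = (\<lambda>\<omega>. \<Sum>p\<in>rect. t p * bdry p \<omega>)"
  define Z where "Z = (\<lambda>\<omega>. \<Sum>p\<in>rect. t p * field0 p \<omega>)"
  have H: "H \<in> lin" unfolding H_def by (rule lin_span_sum[OF lin_span_scale[OF bdry_lin]])
  have Z: "Z \<in> lin" unfolding Z_def by (rule lin_span_sum[OF lin_span_scale[OF field0_lin]])
  have "(LINT \<omega>|M. H \<omega> * Z \<omega>) = (\<Sum>r\<in>rect. t r * (LINT \<omega>|M. bdry r \<omega> * Z \<omega>))"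
    unfolding H_def by (rule lin_cov_sum[OF bdry_lin Z])
  also have "\<dots> = 0"
  proof (intro sum.neutral ballI)
    fix r assume r: "r \<in> rect"
    have "(LINT \<omega>|M. bdry r \<omega> * Z \<omega>) = (LINT \<omega>|M. Z \<omega> * bdry r \<omega>)" by (simp only: mult.commute)
    also have "\<dots> = (\<Sum>p\<in>rect. t p * (LINT \<omega>|M. field0 p \<omega> * bdry r \<omega>))"
      unfolding Z_def by (rule lin_cov_sum[OF field0_lin bdry_lin])
    also have "\<dots> = (\<Sum>p\<in>rect. t p * (LINT \<omega>|M. bdry r \<omega> * field0 p \<omega>))" by (simp only: mult.commute)
    also have "\<dots> = 0" using field0_bdry_cov[OF _ r] by simp
    finally show "t r * (LINT \<omega>|M. bdry r \<omega> * Z \<omega>) = 0" by simp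
  qed
  finally have HZ: "(LINT \<omega>|M. H \<omega> * Z \<omega>) = 0" .
  have "(LINT \<omega>|M. (Z \<omega>)\<^sup>2) = (\<Sum>p\<in>rect. \<Sum>r\<in>rect. t p * t r * (LINT \<omega>|M. field0 p \<omega> * field0 r \<omega>))"
    unfolding Z_def by (rule lin_square_sum[OF field0_lin])
  also have "\<dots> = (\<Sum>p\<in>rect. \<Sum>r\<in>rect. if p = r then (t p)\<^sup>2 * (1 / (\<kappa> * eig p)) else 0)"
    by (intro sum.cong refl) (simp add: field0_cov power2_eq_square)
  also have "\<dots> = \<sigma>\<^sup>2 * (\<Sum>p\<in>rect. (t p)\<^sup>2 * (1 / (\<kappa> * \<sigma>\<^sup>2 * eig p)))"
    using finite_rect \<sigma> by (simp add: sum_distrib_left)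
  finally have ZZ: "(LINT \<omega>|M. (Z \<omega>)\<^sup>2) = \<sigma>\<^sup>2 * (\<Sum>p\<in>rect. (t p)\<^sup>2 * (1 / (\<kappa> * \<sigma>\<^sup>2 * eig p)))" .
  have "(\<Sum>p\<in>rect. t p * (\<Sum>s\<in>rect. basis p s * X s \<omega>)) = H \<omega> + Z \<omega>" for \<omega>
    by (simp add: H_def Z_def bdry_def Xh_def sum.distrib[symmetric] right_diff_distrib)
  then have "(CLINT \<omega>|M. iexp (\<Sum>p\<in>rect. t p * (\<Sum>s\<in>rect. basis p s * X s \<omega>)))
      = (CLINT \<omega>|M. iexp (H \<omega> + Z \<omega>))"
    by (simp only:)
  also have "\<dots> = complex_of_real (exp (- ((LINT \<omega>|M. (H \<omega> + Z \<omega>)\<^sup>2) / 2)))"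
    by (rule lin_iexp[OF lin_span_add[OF H Z]])
  also have "- ((LINT \<omega>|M. (H \<omega> + Z \<omega>)\<^sup>2) / 2) = - ((LINT \<omega>|M. (H \<omega>)\<^sup>2) / 2) + - ((LINT \<omega>|M. (Z \<omega>)\<^sup>2) / 2)"
    unfolding lin_square_add[OF H Z] HZ by (simp add: add_divide_distrib)
  also have "complex_of_real (exp \<dots>) = (CLINT \<omega>|M. iexp (H \<omega>)) * complex_of_real (exp (- ((LINT \<omega>|M. (Z \<omega>)\<^sup>2) / 2)))"
    unfolding exp_add lin_iexp[OF H] by simp
  finally show ?thesis unfolding ZZ H_def .
qed

end

section \<open>The error exponent of the autoregression\<close>

lemma filterlim_nat_at_top:
  assumes "filterlim f at_top (sequentially :: nat filter)"
  shows "filterlim (\<lambda>k. nat (f k + 1)) at_top sequentially"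
  unfolding filterlim_at_top
proof
  fix N :: nat
  have "\<forall>\<^sub>F k in sequentially. int N \<le> f k" using assms unfolding filterlim_at_top by blast
  then show "\<forall>\<^sub>F k in sequentially. N \<le> nat (f k + 1)" by eventually_elim auto
qed

lemma filterlim_mult_nat_at_top:
  fixes A B :: "nat \<Rightarrow> nat"
  assumes A: "filterlim A at_top sequentially" and B: "filterlim B at_top sequentially"
  shows "filterlim (\<lambda>k. real (A k * B k)) at_top sequentially"
proof (rule filterlim_at_top_mono[OF filterlim_compose[OF filterlim_real_sequentially A]])
  have "\<forall>\<^sub>F k in sequentially. 1 \<le> B k" using B unfolding filterlim_at_top by blast
  then show "\<forall>\<^sub>F k in sequentially. real (A k) \<le> real (A k * B k)"
    by eventually_elim (simp only: of_nat_le_iff, simp)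
qed

lemma stein_zero: "stein 0 = 0"
  by (simp add: stein_def)

lemma stein_bound: "0 \<le> s \<Longrightarrow> \<bar>stein s\<bar> \<le> s + 2"
proof -
  assume s: "0 \<le> s"
  have "0 \<le> ln (1 + s)" "ln (1 + s) \<le> s" using s ln_add_one_self_le_self by auto
  moreover have "0 \<le> 1 / (1 + s)" "1 / (1 + s) \<le> 1" using s by auto
  ultimately show ?thesis using s unfolding stein_def by linarith
qed

section \<open>The case below 1/4\<close>

context sfar
begin

lemma symb_abs: "symb \<zeta> \<bar>u\<bar> \<bar>v\<bar> = symb \<zeta> u v"
  by (simp add: symb_def)

lemma inverse_symb_bound: "0 \<le> 1 / symb \<zeta> u v" "1 / symb \<zeta> u v \<le> 1 / (1 - 4 * \<zeta>)"
  using symb_pos[OF zeta_nonneg zeta_less, of u v] symb_ge[OF zeta_nonneg, of u v] zeta_less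
  by (auto intro: frac_le)

lemma symb_continuous: "continuous_on UNIV (\<lambda>p. symb \<zeta> (fst p) (snd p))"
  unfolding symb_def by (intro continuous_intros)

lemma symb_nonzero: "symb \<zeta> u v \<noteq> 0"
  using symb_pos[OF zeta_nonneg zeta_less, of u v] by simp

lemma stein_symb:
  assumes \<sigma>: "0 < \<sigma>"
  defines "\<Phi> \<equiv> \<lambda>u v. stein (1 / (\<kappa> * \<sigma>\<^sup>2 * symb \<zeta> u v))"
  shows "continuous_on UNIV (\<lambda>p. \<Phi> (fst p) (snd p))" "\<bar>\<Phi> u v\<bar> \<le> 1 / (\<kappa> * \<sigma>\<^sup>2) * (1 / (1 - 4 * \<zeta>)) + 2"
    "\<Phi> \<bar>u\<bar> \<bar>v\<bar> = \<Phi> u v"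
proof -
  have c: "0 < \<kappa> * \<sigma>\<^sup>2" using \<sigma> kappa_pos by simp
  have pos: "0 < 1 / (\<kappa> * \<sigma>\<^sup>2 * symb \<zeta> u v)" for u v
    using c symb_pos[OF zeta_nonneg zeta_less, of u v] by simp
  have cont: "continuous_on UNIV (\<lambda>p. 1 / (\<kappa> * \<sigma>\<^sup>2 * symb \<zeta> (fst p) (snd p)))"
    using c symb_nonzero by (intro continuous_intros symb_continuous) auto
  have one: "1 + 1 / (\<kappa> * \<sigma>\<^sup>2 * symb \<zeta> u v) \<noteq> 0" for u v
    using pos[of u v] by linarith
  show "continuous_on UNIV (\<lambda>p. \<Phi> (fst p) (snd p))"
  proof -
    have c1: "continuous_on UNIV (\<lambda>p. 1 + 1 / (\<kappa> * \<sigma>\<^sup>2 * symb \<zeta> (fst p) (snd p)))"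
      by (rule continuous_on_add[OF continuous_on_const cont])
    have ln: "continuous_on UNIV (\<lambda>p. ln (1 + 1 / (\<kappa> * \<sigma>\<^sup>2 * symb \<zeta> (fst p) (snd p))))"
      by (rule continuous_on_ln[OF c1]) (use one in blast)
    have inv: "continuous_on UNIV (\<lambda>p. 1 / (1 + 1 / (\<kappa> * \<sigma>\<^sup>2 * symb \<zeta> (fst p) (snd p))))"
      by (rule continuous_on_divide[OF continuous_on_const c1]) (use one in blast)
    show ?thesis
      unfolding \<Phi>_def stein_def
      by (rule continuous_on_diff[OF continuous_on_add[OF continuous_on_mult[OF continuous_on_const ln]
            continuous_on_mult[OF continuous_on_const inv]] continuous_on_const])
  qed
  have "1 / (\<kappa> * \<sigma>\<^sup>2 * symb \<zeta> u v) = 1 / (\<kappa> * \<sigma>\<^sup>2) * (1 / symb \<zeta> u v)" by simp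
  also have "\<dots> \<le> 1 / (\<kappa> * \<sigma>\<^sup>2) * (1 / (1 - 4 * \<zeta>))"
    using c by (intro mult_left_mono inverse_symb_bound) auto
  finally show "\<bar>\<Phi> u v\<bar> \<le> 1 / (\<kappa> * \<sigma>\<^sup>2) * (1 / (1 - 4 * \<zeta>)) + 2"
    unfolding \<Phi>_def using stein_bound[OF less_imp_le[OF pos[of u v]]] by linarith
  show "\<Phi> \<bar>u\<bar> \<bar>v\<bar> = \<Phi> u v" by (simp only: \<Phi>_def symb_abs)
qed

theorem sfar_error_exponent:
  assumes \<sigma>: "0 < \<sigma>" and W: "white_gaussian_noise M \<sigma> W" and ind: "independent_fields M X W"
    and \<alpha>: "0 < \<alpha>" "\<alpha> < 1" and I: "growing_lattice I"
    and np: "\<And>k. neyman_pearson \<alpha> (field_law M (I k) W) (field_law M (I k) (\<lambda>s \<omega>. X s \<omega> + W s \<omega>)) (\<phi> k)"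
  shows "(\<lambda>k. - (1 / real (card (I k))) * ln (miss_prob (field_law M (I k) (\<lambda>s \<omega>. X s \<omega> + W s \<omega>)) (\<phi> k)))
    \<longlonglongrightarrow> (LINT p|(circ \<Otimes>\<^sub>M circ). stein (1 / (\<kappa> * \<sigma>\<^sup>2 * symb \<zeta> (fst p) (snd p))))"
proof -
  obtain a b c d where Ieq: "\<And>k. I k = {a k..b k} \<times> {c k..d k}"
    and ab: "filterlim (\<lambda>k. b k - a k) at_top sequentially" and cd: "filterlim (\<lambda>k. d k - c k) at_top sequentially"
    using I unfolding growing_lattice_def by blast
  define A where "A = (\<lambda>k. nat (b k - a k + 1))"
  define B where "B = (\<lambda>k. nat (d k - c k + 1))"
  have A: "filterlim A at_top sequentially" and B: "filterlim B at_top sequentially"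
    unfolding A_def B_def using ab cd by (auto intro: filterlim_nat_at_top)
  define E where "E = (\<lambda>k. sine_window.basis (a k) (c k) (A k) (B k))"
  define eg where "eg = (\<lambda>k. sine_window.eig \<zeta> (a k) (c k) (A k) (B k))"
  define h where "h = (\<lambda>k. sine_window.bdry X \<zeta> (a k) (c k) (A k) (B k))"
  define g where "g = (\<lambda>k p. 1 / (\<kappa> * \<sigma>\<^sup>2 * eg k p))"
  define n where "n = (\<lambda>k. real (card (I k)))"
  define v where "v = (\<lambda>k. \<Sum>p\<in>I k. LINT \<omega>|M. (h k p \<omega>)\<^sup>2)"
  have sw: "sine_window M X \<zeta> \<kappa>"
    by (simp add: sine_window_def sfar_axioms)
  \<comment> \<open>Early windows may be empty; \<open>nat\<close> then yields side length 0 and the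
    equality persists.\<close>
  have rect: "I k = sine_window.rect (a k) (c k) (A k) (B k)" for k
    unfolding sine_window.rect_def[OF sw] Ieq A_def B_def by (cases "a k \<le> b k"; cases "c k \<le> d k") auto
  have nk: "n k = real (A k * B k)" for k
    unfolding n_def rect by (simp add: sine_window.card_rect[OF sw])
  have n: "filterlim n at_top sequentially"
    unfolding nk[abs_def] by (rule filterlim_mult_nat_at_top[OF A B])
  have hlin: "h k p \<in> lin" for k p
    unfolding h_def by (rule sine_window.bdry_lin[OF sw])
  have eg: "0 < eg k p" for k p
    unfolding eg_def by (rule sine_window.eig_pos[OF sw])
  have win: "window M X W \<sigma> (I k) (E k) (g k) (h k)" for k
  proof
    show "X s \<in> borel_measurable M" for s by measurable
    show "0 < \<sigma>" "white_gaussian_noise M \<sigma> W" "independent_fields M X W" by fact+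
    show "finite (I k)" unfolding rect by (rule sine_window.finite_rect[OF sw])
    show "E k p s = E k s p" for p s unfolding E_def by (rule sine_window.basis_sym[OF sw])
    show "(\<Sum>s\<in>I k. E k p s * E k q s) = (if p = q then 1 else 0)" if "p \<in> I k" "q \<in> I k" for p q
      using that unfolding E_def rect by (rule sine_window.basis_orthonormal[OF sw])
    show "0 \<le> g k p" for p unfolding g_def using eg[of k p] kappa_pos by simp
    show "h k p \<in> borel_measurable M" for p by (rule lin_measurable[OF hlin])
    show "(CLINT \<omega>|M. iexp (\<Sum>p\<in>I k. t p * (\<Sum>s\<in>I k. E k p s * X s \<omega>)))
      = (CLINT \<omega>|M. iexp (\<Sum>p\<in>I k. t p * h k p \<omega>)) * complex_of_real (exp (- (\<sigma>\<^sup>2 * (\<Sum>p\<in>I k. (t p)\<^sup>2 * g k p) / 2)))" for t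
      unfolding g_def E_def h_def rect eg_def by (rule sine_window.signal_char_decomposition[OF sw \<sigma>])
  qed
  have gm: "gauss_mixture M (I k) \<sigma> (g k) (h k)" for k
  proof -
    interpret window M X W \<sigma> "I k" "E k" "g k" "h k" by (rule win)
    show ?thesis by unfold_locales
  qed
  have grid_sums: "(\<lambda>k. (\<Sum>p\<in>I k. F (eg k p)) / n k) \<longlonglongrightarrow> (LINT p|(circ \<Otimes>\<^sub>M circ). F (symb \<zeta> (fst p) (snd p)))"
    if cont: "continuous_on UNIV (\<lambda>p. F (symb \<zeta> (fst p) (snd p)))" and bd: "\<And>u v. \<bar>F (symb \<zeta> u v)\<bar> \<le> D" for F :: "real \<Rightarrow> real" and D
  proof -
    have "(\<Sum>p\<in>I k. F (eg k p)) = (\<Sum>i\<in>{1..int (A k)}. \<Sum>j\<in>{1..int (B k)}. F (symb \<zeta> (pi * i / (real (A k) + 1)) (pi * j / (real (B k) + 1))))" for k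
      unfolding rect eg_def sine_window.eig_def[OF sw]
      by (rule sine_window.sum_rect[OF sw, of "\<lambda>i j. F (symb \<zeta> (pi * i / (real (A k) + 1)) (pi * j / (real (B k) + 1)))"])
    then show ?thesis
      using torus_Riemann_sum[OF cont bd _ A B] by (simp add: symb_abs nk)
  qed
  \<comment> \<open>The averaged trace of the Green's function tends to the torus average of 1 /
    (\<kappa> symb), which is the power of the signal itself; the difference is the averaged
    variance of the remainder.\<close>
  have "(\<lambda>k. (\<Sum>p\<in>I k. 1 / (\<kappa> * eg k p)) / n k) \<longlonglongrightarrow> gam (0, 0)"
    unfolding gam_zero_eq
  proof (rule grid_sums[of "\<lambda>x. 1 / (\<kappa> * x)" "1 / \<kappa> * (1 / (1 - 4 * \<zeta>))"])
    show "continuous_on UNIV (\<lambda>p. 1 / (\<kappa> * symb \<zeta> (fst p) (snd p)))"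
      using kappa_pos symb_nonzero by (intro continuous_intros symb_continuous) auto
    have bd: "1 / \<kappa> * (1 / symb \<zeta> u v) \<le> 1 / \<kappa> * (1 / (1 - 4 * \<zeta>))" "0 \<le> 1 / \<kappa> * (1 / symb \<zeta> u v)" for u v
      using kappa_pos inverse_symb_bound[of u v] by (intro mult_left_mono mult_nonneg_nonneg; simp)+
    have "1 / (\<kappa> * symb \<zeta> u v) = 1 / \<kappa> * (1 / symb \<zeta> u v)" for u v by simp
    then show "\<bar>1 / (\<kappa> * symb \<zeta> u v)\<bar> \<le> 1 / \<kappa> * (1 / (1 - 4 * \<zeta>))" for u v
      using bd[of u v] by (simp only: abs_of_nonneg)
  qed
  from tendsto_diff[OF tendsto_const[of "gam (0, 0)"] this]
  have "(\<lambda>k. gam (0, 0) - (\<Sum>p\<in>I k. 1 / (\<kappa> * eg k p)) / n k) \<longlonglongrightarrow> 0" by simp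
  moreover have "\<forall>\<^sub>F k in sequentially. gam (0, 0) - (\<Sum>p\<in>I k. 1 / (\<kappa> * eg k p)) / n k = v k / n k"
  proof -
    have veq: "v k = n k * gam (0, 0) - (\<Sum>p\<in>I k. 1 / (\<kappa> * eg k p))" for k
      unfolding v_def n_def h_def rect eg_def by (rule sine_window.bdry_variance_sum[OF sw])
    have "\<forall>\<^sub>F k in sequentially. 0 < n k" using n unfolding filterlim_at_top_dense by blast
    then show ?thesis
    proof eventually_elim
      case (elim k)
      then show ?case unfolding veq by (simp add: diff_divide_distrib)
    qed
  qed
  ultimately have "(\<lambda>k. v k / n k) \<longlonglongrightarrow> 0" by (rule Lim_transform_eventually)
  from tendsto_divide[OF this tendsto_const[of "2 * \<sigma>\<^sup>2"]] \<sigma>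
  have b0: "(\<lambda>k. v k / (2 * \<sigma>\<^sup>2) / n k) \<longlonglongrightarrow> 0" by (simp add: mult.commute)
  have mix: "ennreal (exp (- (v k / (2 * \<sigma>\<^sup>2)))) \<le> gauss_mixture.mix M (I k) \<sigma> (g k) (h k) y" for k y
    unfolding v_def
    by (rule gauss_mixture.mix_ge_Jensen[OF gm])
       (rule lin_integrable[OF hlin] lin_law(1)[OF hlin] lin_mean[OF hlin])+
  have K: "(\<lambda>k. (\<Sum>p\<in>I k. stein (g k p)) / n k)
      \<longlonglongrightarrow> (LINT p|(circ \<Otimes>\<^sub>M circ). stein (1 / (\<kappa> * \<sigma>\<^sup>2 * symb \<zeta> (fst p) (snd p))))"
    unfolding g_def by (rule grid_sums[of "\<lambda>x. stein (1 / (\<kappa> * \<sigma>\<^sup>2 * x))", OF stein_symb(1,2)[OF \<sigma>]])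
  show ?thesis
    using window_error_exponent[OF n_def win \<alpha> n mix b0 K np] by (simp only: n_def)
qed

end

section \<open>The perfectly correlated case\<close>

lemma ln_one_plus_over_tendsto_0:
  assumes n: "filterlim n at_top (sequentially :: nat filter)" and c: "0 < (c::real)"
  shows "(\<lambda>k. ln (1 + n k * c) / n k) \<longlonglongrightarrow> 0"
proof -
  have m: "filterlim (\<lambda>k. 1 + n k * c) at_top sequentially"
    using c by (intro filterlim_tendsto_add_at_top[OF tendsto_const] filterlim_at_top_mult_tendsto_pos[OF tendsto_const _ n])
  have "(\<lambda>k. ln (1 + n k * c) / (1 + n k * c)) \<longlonglongrightarrow> 0"
    by (rule filterlim_compose[OF ln_x_over_x_tendsto_0 m])
  moreover have "(\<lambda>k. 1 / n k + c) \<longlonglongrightarrow> 0 + c"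
    by (intro tendsto_add tendsto_const real_tendsto_divide_at_top[OF tendsto_const n])
  ultimately have "(\<lambda>k. ln (1 + n k * c) / (1 + n k * c) * (1 / n k + c)) \<longlonglongrightarrow> 0 * (0 + c)"
    by (rule tendsto_mult)
  then have lim: "(\<lambda>k. ln (1 + n k * c) / (1 + n k * c) * (1 / n k + c)) \<longlonglongrightarrow> 0" by simp
  have "\<forall>\<^sub>F k in sequentially. 0 < n k" using n unfolding filterlim_at_top_dense by blast
  then have "\<forall>\<^sub>F k in sequentially. ln (1 + n k * c) / (1 + n k * c) * (1 / n k + c) = ln (1 + n k * c) / n k"
  proof eventually_elim
    case (elim k)
    have "1 / n k + c = (1 + n k * c) / n k" using elim by (simp add: add_divide_distrib)
    moreover have "0 < 1 + n k * c" using elim c by (simp add: add_pos_pos)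
    ultimately show ?case by simp
  qed
  from Lim_transform_eventually[OF lim this] show ?thesis .
qed

text \<open>With a single random amplitude the covariance has rank one and the miss probability decays
  only polynomially.\<close>

theorem (in centered_gaussian) common_amplitude_error_exponent:
  assumes common: "\<And>s. AE \<omega> in M. X s \<omega> = X (0, 0) \<omega>" and pow: "0 < (LINT \<omega>|M. (X (0, 0) \<omega>)\<^sup>2)"
    and \<sigma>: "0 < \<sigma>" and W: "white_gaussian_noise M \<sigma> W" and ind: "independent_fields M X W"
    and \<alpha>: "0 < \<alpha>" "\<alpha> < 1" and I: "growing_lattice I"
    and np: "\<And>k. neyman_pearson \<alpha> (field_law M (I k) W) (field_law M (I k) (\<lambda>s \<omega>. X s \<omega> + W s \<omega>)) (\<phi> k)"
  shows "(\<lambda>k. - (1 / real (card (I k))) * ln (miss_prob (field_law M (I k) (\<lambda>s \<omega>. X s \<omega> + W s \<omega>)) (\<phi> k))) \<longlonglongrightarrow> 0"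
proof -
  obtain a b c d where Ieq: "\<And>k. I k = {a k..b k} \<times> {c k..d k}"
    and ab: "filterlim (\<lambda>k. b k - a k) at_top sequentially" and cd: "filterlim (\<lambda>k. d k - c k) at_top sequentially"
    using I unfolding growing_lattice_def by blast
  \<comment> \<open>Nothing has to be diagonalized: with \<open>g\<close> = 0 the whole signal is
    treated as shift, and the site coordinates serve as basis.\<close>
  define E where "E = (\<lambda>(p::site) (s::site). if p = s then 1 else (0::real))"
  define n where "n = (\<lambda>k. real (card (I k)))"
  have nk: "n k = real (nat (b k - a k + 1) * nat (d k - c k + 1))" for k
    by (simp add: n_def Ieq)
  have n: "filterlim n at_top sequentially"
    unfolding nk[abs_def] by (intro filterlim_mult_nat_at_top filterlim_nat_at_top ab cd)
  have fin: "finite (I k)" for k by (simp add: Ieq)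
  have Esum: "(\<Sum>s\<in>J. E p s * f s) = f p" if "finite J" "p \<in> J" for p f and J :: "site set"
    using that by (simp add: E_def if_distrib[where f = "\<lambda>x. x * _"] cong: if_cong)
  define v where "v = sqrt (LINT \<omega>|M. (X (0, 0) \<omega>)\<^sup>2)"
  have v: "0 < v" using pow by (simp add: v_def)
  have law: "distr M borel (X (0, 0)) = normal_law 0 v"
    unfolding v_def by (rule lin_law(2)[OF lin_span_base]) simp
  have win: "window M X W \<sigma> (I k) E (\<lambda>_. 0) X" for k
  proof
    show "X s \<in> borel_measurable M" for s by measurable
    show "0 < \<sigma>" "white_gaussian_noise M \<sigma> W" "independent_fields M X W" "finite (I k)" by fact+
    show "E p s = E s p" for p s by (simp add: E_def)
    show "(\<Sum>s\<in>I k. E p s * E q s) = (if p = q then 1 else 0)" if "p \<in> I k" "q \<in> I k" for p q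
      using Esum[OF fin that(1), of "E q"] by (simp add: E_def eq_commute)
    show "(CLINT \<omega>|M. iexp (\<Sum>p\<in>I k. t p * (\<Sum>s\<in>I k. E p s * X s \<omega>)))
      = (CLINT \<omega>|M. iexp (\<Sum>p\<in>I k. t p * X p \<omega>)) * complex_of_real (exp (- (\<sigma>\<^sup>2 * (\<Sum>p\<in>I k. (t p)\<^sup>2 * 0) / 2)))" for t
    proof -
      have "(\<Sum>p\<in>I k. t p * (\<Sum>s\<in>I k. E p s * X s \<omega>)) = (\<Sum>p\<in>I k. t p * X p \<omega>)" for \<omega>
        by (intro sum.cong refl arg_cong2[where f = "(*)"] Esum fin)
      then show ?thesis by simp
    qed
  qed simp_all
  have gm: "gauss_mixture M (I k) \<sigma> (\<lambda>_. 0) X" for k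
  proof -
    interpret window M X W \<sigma> "I k" E "\<lambda>_. 0" X by (rule win)
    show ?thesis by unfold_locales
  qed
  define r where "r = v\<^sup>2 / \<sigma>\<^sup>2"
  have r: "0 < r" using v \<sigma> by (simp add: r_def)
  \<comment> \<open>The inverse square root from \<open>mix_ge_common\<close> written as an
    exponential, so that its logarithmic rate is the \<open>b k\<close> of the general
    theorem.\<close>
  have mix: "ennreal (exp (- (ln (1 + n k * r) / 2))) \<le> gauss_mixture.mix M (I k) \<sigma> (\<lambda>_. 0) X y" for k y
  proof -
    have p: "0 < 1 + n k * r" using r by (simp add: n_def add_pos_nonneg)
    have "exp (- (ln (1 + n k * r) / 2)) = 1 / sqrt (1 + n k * r)"
      using p by (simp add: exp_minus ln_sqrt[symmetric] field_simps)
    also have "\<dots> = 1 / sqrt (1 + real (card (I k)) / \<sigma>\<^sup>2 * v\<^sup>2)" by (simp add: n_def r_def)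
    finally show ?thesis
      using gauss_mixture.mix_ge_common[OF gm X_measurable law v common] by simp
  qed
  have "(\<lambda>k. ln (1 + n k * r) / n k / 2) \<longlonglongrightarrow> 0 / 2"
    by (intro tendsto_divide ln_one_plus_over_tendsto_0 n r tendsto_const) simp
  then have b0: "(\<lambda>k. ln (1 + n k * r) / 2 / n k) \<longlonglongrightarrow> 0" by (simp add: mult.commute)
  have K: "(\<lambda>k. (\<Sum>p\<in>I k. stein 0) / n k) \<longlonglongrightarrow> 0" by (simp add: stein_zero)
  show ?thesis
    using window_error_exponent[OF n_def win \<alpha> n mix b0 K np] by (simp only: n_def)
qed

lemma spectral_snr_quarter: "spectral_snr SNR (1 / 4) w1 w2 = 0"
proof -
  have "ennreal (2 / pi) * ellipticK (4 * (1 / 4)) = \<infinity>"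
    by (simp add: ellipticK_1 ennreal_mult_top)
  \<comment> \<open>Covers the points where the symbol vanishes: there the denominator is
    \<infinity> times 0, which is 0, and division by it gives 0 or \<infinity>, both sent to 0. The
    quotient is thus 0 everywhere, not only almost everywhere.\<close>
  moreover have "enn2real (x * \<infinity>) = 0" for x
    by (cases "x = 0") (auto simp: ennreal_mult_top)
  ultimately show ?thesis
    unfolding spectral_snr_def
    by (cases "ennreal (1 - 2 * (1 / 4) * cos w1 - 2 * (1 / 4) * cos w2) = 0")
       (auto simp: ennreal_top_mult ennreal_divide_top divide_ennreal_def ennreal_mult_eq_top_iff)
qed

theorem corollary1:
  fixes M :: "'a measure"
    and X W :: "int \<times> int \<Rightarrow> 'a \<Rightarrow> real"
    and lam \<kappa> \<zeta> \<sigma> SNR \<alpha> :: real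
    and I :: "nat \<Rightarrow> (int \<times> int) set"
    and \<phi> :: "nat \<Rightarrow> (int \<times> int \<Rightarrow> real) \<Rightarrow> real"
  assumes "prob_space M"
    and "0 < \<kappa>" and "0 \<le> lam" and "lam \<le> \<kappa> / 4" and "\<zeta> = lam / \<kappa>"
    and "sfar_signal M lam \<kappa> X"
    and "0 < \<sigma>" and "white_gaussian_noise M \<sigma> W"
    and "independent_fields M X W"
    and "SNR = signal_power M X / \<sigma>\<^sup>2"
    and "0 < \<alpha>" and "\<alpha> < 1"
    and "growing_lattice I"
    and "\<And>k. neyman_pearson \<alpha>
               (field_law M (I k) W) (field_law M (I k) (\<lambda>s \<omega>. X s \<omega> + W s \<omega>)) (\<phi> k)"
  shows "(\<zeta> < 1 / 4 \<longrightarrow>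
            has_spectral_density M X
              (\<lambda>w1 w2. 1 / (4 * pi\<^sup>2 * \<kappa> * (1 - 2 * \<zeta> * cos w1 - 2 * \<zeta> * cos w2))) \<and>
            ennreal (signal_power M X) = 2 * ellipticK (4 * \<zeta>) / ennreal (pi * \<kappa>)) \<and>
         (\<lambda>k. - (1 / real (card (I k))) *
             ln (miss_prob (field_law M (I k) (\<lambda>s \<omega>. X s \<omega> + W s \<omega>)) (\<phi> k)))
         \<longlonglongrightarrow>
         1 / (4 * pi\<^sup>2) *
           (LBINT w1:{-pi..pi}. LBINT w2:{-pi..pi}.
              1 / 2 * ln (1 + spectral_snr SNR \<zeta> w1 w2)
              + 1 / 2 * (1 / (1 + spectral_snr SNR \<zeta> w1 w2)) - 1 / 2)"
proof -
  have sig: "gaussian_field M X" "\<And>s. integral\<^sup>L M (X s) = 0" "stationary_field M X"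
    using assms(6) unfolding sfar_signal_def by blast+
  have cg: "centered_gaussian M X"
    using assms(1) sig by (simp add: centered_gaussian_def centered_gaussian_axioms_def)
  interpret centered_gaussian M X by (rule cg)
  show ?thesis
  proof (cases "\<zeta> < 1 / 4")
    case True
    then have "\<forall>i j. full_conditional_normal M X (i, j)
        (\<lambda>\<omega>. lam / \<kappa> * (X (i + 1, j) \<omega> + X (i - 1, j) \<omega> + X (i, j + 1) \<omega> + X (i, j - 1) \<omega>)) \<kappa>"
      using assms(6) unfolding sfar_signal_def \<open>\<zeta> = lam / \<kappa>\<close> by presburger
    then have "sfar M X \<zeta> \<kappa>"
      using True assms(2,3,5) sig(3) by (intro sfar.intro cg sfar_axioms.intro) auto
    then interpret sfar M X \<zeta> \<kappa> .
    have power: "signal_power M X = gam (0, 0)"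
      by (simp add: signal_power_def gam_def power2_eq_square)
    have snr: "spectral_snr SNR \<zeta> w1 w2 = 1 / (\<kappa> * \<sigma>\<^sup>2 * symb \<zeta> w1 w2)" for w1 w2
      unfolding assms(10) power by (rule spectral_snr_eq[OF assms(7)])
    have "1 / (4 * pi\<^sup>2) * (LBINT w1:{-pi..pi}. LBINT w2:{-pi..pi}. stein (1 / (\<kappa> * \<sigma>\<^sup>2 * symb \<zeta> w1 w2)))
        = (LINT p|(circ \<Otimes>\<^sub>M circ). stein (1 / (\<kappa> * \<sigma>\<^sup>2 * symb \<zeta> (fst p) (snd p))))"
      using stein_symb[OF assms(7)]
      by (intro torus_average_eq[of _ "1 / (\<kappa> * \<sigma>\<^sup>2) * (1 / (1 - 4 * \<zeta>)) + 2"])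
         (simp_all add: borel_prod borel_measurable_continuous_onI)
    with sfar_error_exponent[OF assms(7-9) assms(11-14)]
    have "(\<lambda>k. - (1 / real (card (I k))) *
             ln (miss_prob (field_law M (I k) (\<lambda>s \<omega>. X s \<omega> + W s \<omega>)) (\<phi> k)))
         \<longlonglongrightarrow> 1 / (4 * pi\<^sup>2) * (LBINT w1:{-pi..pi}. LBINT w2:{-pi..pi}. stein (1 / (\<kappa> * \<sigma>\<^sup>2 * symb \<zeta> w1 w2)))"
      by (simp only:)
    then show ?thesis
      using has_spectral_density_sfar power_elliptic power by (simp only: snr stein_def) simp
  next
    case False
    have z: "\<zeta> = 1 / 4" using False assms(2,4,5) by (auto simp: divide_less_eq)
    have amp: "\<And>s. AE \<omega> in M. X s \<omega> = X (0, 0) \<omega>" "0 < (\<integral>\<omega>. (X (0, 0) \<omega>)\<^sup>2 \<partial>M)"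
      using assms(6) False unfolding sfar_signal_def \<open>\<zeta> = lam / \<kappa>\<close> by presburger+
    have "(\<lambda>k. - (1 / real (card (I k))) *
             ln (miss_prob (field_law M (I k) (\<lambda>s \<omega>. X s \<omega> + W s \<omega>)) (\<phi> k))) \<longlonglongrightarrow> 0"
      by (rule common_amplitude_error_exponent[OF amp assms(7-9) assms(11-14)])
    \<comment> \<open>With the quotient equal to 0 the integrand is 1/2 ln 1 + 1/2 - 1/2.\<close>
    moreover have "1 / (4 * pi\<^sup>2) *
           (LBINT w1:{-pi..pi}. LBINT w2:{-pi..pi}.
              1 / 2 * ln (1 + spectral_snr SNR \<zeta> w1 w2)
              + 1 / 2 * (1 / (1 + spectral_snr SNR \<zeta> w1 w2)) - 1 / 2) = 0"
      by (simp add: z spectral_snr_quarter)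
    ultimately show ?thesis using False by (simp only: simp_thms)
  qed
qed

end
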